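(* Every t-perfect graph is $186$-colorable, i.e., every t-perfect graph $G$ satisfies $\chi(G) \le 186$.
   Context: Graphs are finite, simple and undirected. A stable set of a graph is a set of pairwise non-adjacent vertices. The stable set polytope of a graph $G$ is the convex hull in $\mathbb{R}^{V(G)}$ of the characteristic vectors of all stable sets of $G$. A graph $G$ is called t-perfect if its stable set polytope coincides with the set of vectors $x \in [0,1]^{V(G)}$ satisfying $x_u + x_v \le 1$ for every edge $uv \in E(G)$ and $\sum_{v \in V(C)} x_v \le \frac12(|V(C)|-1)$ for every odd cycle $C$ of $G$ (cycles are subgraphs, not necessarily induced). $\chi(G)$ denotes the chromatic number of $G$. *)

theory Defs
  imports
    "HOL-Analysis.Analysis"
    "HOL-Library.Function_Algebras"
    "Graph_Theory.Pair_Digraph"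
begin

text \<open>
  A finite simple undirected graph is a \<open>pair_graph\<close>: finite vertex set \<open>pverts G\<close> and
  a finite, irreflexive, symmetric set \<open>parcs G\<close> of ordered pairs, so that the
  edge \<open>uv\<close> is represented by the two arcs \<open>(u, v)\<close> and \<open>(v, u)\<close>.

  The space \<open>R^V(G)\<close> is represented by the functions \<open>'a \<Rightarrow> real\<close> that vanish
  outside \<open>pverts G\<close>. Addition on functions is pointwise by \<open>Function_Algebras\<close>; the
  pointwise scalar multiplication below makes the \<open>convex hull\<close> of HOL-Analysis
  available for them.
\<close>

instantiation "fun" :: (type, real_vector) real_vector
begin

definition scaleR_fun :: "real \<Rightarrow> ('a \<Rightarrow> 'b) \<Rightarrow> 'a \<Rightarrow> 'b" where
  "scaleR_fun r f = (\<lambda>x. r *\<^sub>R f x)"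

instance
  by standard (simp_all add: scaleR_fun_def fun_eq_iff scaleR_add_right scaleR_add_left)

end

definition stable_set :: "'a pair_pre_digraph \<Rightarrow> 'a set \<Rightarrow> bool" where
  "stable_set G S \<longleftrightarrow> S \<subseteq> pverts G \<and> (\<forall>u\<in>S. \<forall>v\<in>S. (u, v) \<notin> parcs G)"

definition stable_set_polytope :: "'a pair_pre_digraph \<Rightarrow> ('a \<Rightarrow> real) set" where
  "stable_set_polytope G = convex hull {indicator S | S. stable_set G S}"

text \<open>
  Cycles are given by the list of arcs traversed. The bound on the length excludes the closed
  walks \<open>u, v, u\<close>, which \<open>pre_digraph.cycle\<close> admits because it is a notion for digraphs.
\<close>

definition graph_cycle :: "'a pair_pre_digraph \<Rightarrow> ('a \<times> 'a) list \<Rightarrow> bool" where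
  "graph_cycle G C \<longleftrightarrow> pre_digraph.cycle (with_proj G) C \<and> 3 \<le> length C"

text \<open>On a closed walk every vertex is the tail of some arc.\<close>

definition cycle_verts :: "('a \<times> 'a) list \<Rightarrow> 'a set" where
  "cycle_verts C = fst ` set C"

definition odd_cycle_polytope :: "'a pair_pre_digraph \<Rightarrow> ('a \<Rightarrow> real) set" where
  "odd_cycle_polytope G = {x.
     (\<forall>v. v \<notin> pverts G \<longrightarrow> x v = 0) \<and>
     (\<forall>v\<in>pverts G. 0 \<le> x v \<and> x v \<le> 1) \<and>
     (\<forall>u v. (u, v) \<in> parcs G \<longrightarrow> x u + x v \<le> 1) \<and>
     (\<forall>C. graph_cycle G C \<and> odd (card (cycle_verts C)) \<longrightarrow>
        (\<Sum>v\<in>cycle_verts C. x v) \<le> 1 / 2 * (real (card (cycle_verts C)) - 1))}"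

definition t_perfect :: "'a pair_pre_digraph \<Rightarrow> bool" where
  "t_perfect G \<longleftrightarrow> stable_set_polytope G = odd_cycle_polytope G"

definition colorable :: "'a pair_pre_digraph \<Rightarrow> nat \<Rightarrow> bool" where
  "colorable G k \<longleftrightarrow>
     (\<exists>c :: 'a \<Rightarrow> nat. c ` pverts G \<subseteq> {..<k} \<and> (\<forall>u v. (u, v) \<in> parcs G \<longrightarrow> c u \<noteq> c v))"

definition chromatic_number :: "'a pair_pre_digraph \<Rightarrow> nat" where
  "chromatic_number G = (LEAST k. colorable G k)"

end

theory Submission
  imports Defs
begin

text \<open>
  Rational points of the odd cycle polytope with few values are turned into combinatorial
  information: every stable set in a convex combination representing such a point is tight on all
  constraints that the point satisfies with equality. The uniform point \<open>m / (2 m + 1)\<close> yields a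
  stable set that meets all shortest odd closed walks; removing four such sets leaves a t-perfect
  graph without odd closed walks of length less than 11. The point with value 1/3 on a set of low
  and 2/3 on the remaining high vertices yields stable sets that respect the contraction of the
  low-high edges, so the neighbourhood of a contracted connected bipartite hub is bipartite: there
  is no contracted odd wheel.

  If a breadth first search level of the graph without short odd cycles needed more than 91 colours,
  it would contain a long rope with two parallel arcs of different parity at three places. The ends
  of the rope and a vertex in the middle of it have neighbours in the previous level and are joined
  through the earlier levels. By choosing the arcs one finds a contracted odd wheel. Hence
  every level has a colouring with 91 colours, the levels together one with \<open>2 * 91\<close> colours, and
  \<open>2 * 91 + 4 = 186\<close>.
\<close>

section \<open>Connected sets, colourings and convex combinations\<close>

text \<open>The weights 1/3 and 2/3 stand in for a graph minor. In the graph obtained by contracting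
  the classes, the constant 1/3 would be tight on every triangle, so a stable set that misses the
  hub meets each rim edge forming a triangle with the hub in exactly one end, and the rim is even.
  The contracted graph is never formed; the alternation of low and high inside the classes replaces
  it. The obstacle is therefore parity: on an arbitrary rim the length or the positions of the
  contacts are wrong. The two arcs of a bead are a switch that corrects this. A rope has two such
  switches, one for the position of a contact and one for the length of the rim, and a third bead
  between them that yields the contradiction. The bound 11 comes from the arcs. An arc with an odd
  number of vertices needs five of them to have an interior vertex at an even position, and shorter
  arcs close up to an odd walk of length at most 9. Everything else only excludes odd walks of
  length 3 and 5. Each removed stable set raises the odd girth by 2, from 3 to 11 in four
  steps.\<close>

lemma convex_tight:
  fixes w f :: "nat \<Rightarrow> real"
  assumes w: "\<And>i. i < N \<Longrightarrow> 0 < w i" "(\<Sum>i<N. w i) = 1" and i: "i < N" and f: "\<And>i. i < N \<Longrightarrow> f i \<le> 1" "(\<Sum>i<N. f i * w i) = 1"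
  shows "f i = 1"
proof (rule ccontr)
  assume "f i \<noteq> 1"
  then have "f i < 1" using f(1)[OF i] by linarith
  have "(\<Sum>i<N. f i * w i) < (\<Sum>i<N. w i)"
  proof (rule sum_strict_mono_ex1)
    show "\<forall>j\<in>{..<N}. f j * w j \<le> w j"
    proof
      fix j assume "j \<in> {..<N}"
      then show "f j * w j \<le> w j" using mult_right_mono[OF f(1), of j "w j"] w(1)[of j] by simp
    qed
    show "\<exists>j\<in>{..<N}. f j * w j < w j"
      using mult_strict_right_mono[OF \<open>f i < 1\<close> w(1)[OF i]] i by auto
  qed simp
  then show False using f(2) w(2) by simp
qed

text \<open>Vertex set and adjacency are separate parameters, so that deleting vertices gives
  another instance over the same type.\<close>

locale sgraph =
  fixes V :: "'a set" and E :: "'a \<Rightarrow> 'a \<Rightarrow> bool"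
  assumes finV: "finite V"
    and symE: "E u v \<Longrightarrow> E v u"
    and irrE: "\<not> E v v"
    and inV: "E u v \<Longrightarrow> u \<in> V"
begin

lemma inV': "E u v \<Longrightarrow> v \<in> V"
  using inV symE by blast

definition col :: "'a set \<Rightarrow> nat \<Rightarrow> bool" where
  "col X k \<longleftrightarrow> (\<exists>c::'a \<Rightarrow> nat. (\<forall>v\<in>X. c v < k) \<and> (\<forall>u\<in>X. \<forall>v\<in>X. E u v \<longrightarrow> c u \<noteq> c v))"

text \<open>Connectivity by cuts instead of paths: components are then found by minimality, and an
  edge leaving a proper subset is available at once.\<close>

definition con :: "'a set \<Rightarrow> bool" where
  "con S \<longleftrightarrow> S \<noteq> {} \<and> (\<forall>T\<subseteq>S. T \<noteq> {} \<longrightarrow> T \<noteq> S \<longrightarrow> (\<exists>u\<in>T. \<exists>v\<in>S - T. E u v))"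

text \<open>The two sets may overlap; \<open>anti X X\<close> expresses that \<open>X\<close> is
  stable.\<close>

definition anti :: "'a set \<Rightarrow> 'a set \<Rightarrow> bool" where
  "anti A B \<longleftrightarrow> (\<forall>a\<in>A. \<forall>b\<in>B. \<not> E a b)"

definition bip :: "'a set \<Rightarrow> ('a \<Rightarrow> bool) \<Rightarrow> bool" where
  "bip S l \<longleftrightarrow> (\<forall>u\<in>S. \<forall>v\<in>S. E u v \<longrightarrow> l u \<noteq> l v)"

definition ipath :: "'a list \<Rightarrow> bool" where
  "ipath xs \<longleftrightarrow> distinct xs \<and>
     (\<forall>i<length xs. \<forall>j<length xs. E (xs ! i) (xs ! j) \<longleftrightarrow> i = Suc j \<or> j = Suc i)"

text \<open>Vertices may repeat, so a short odd closed walk is refuted without checking that its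
  vertices are distinct.\<close>

definition clw :: "nat \<Rightarrow> (nat \<Rightarrow> 'a) \<Rightarrow> bool" where
  "clw n c \<longleftrightarrow> (\<forall>i<n. E (c i) (c (Suc i))) \<and> c n = c 0"

lemma colI: "(\<And>v. v \<in> X \<Longrightarrow> c v < k) \<Longrightarrow> (\<And>u v. u \<in> X \<Longrightarrow> v \<in> X \<Longrightarrow> E u v \<Longrightarrow> c u \<noteq> c v) \<Longrightarrow> col X k"
  unfolding col_def by (intro exI[of _ c]) blast

lemma col_mono: "col X k \<Longrightarrow> Y \<subseteq> X \<Longrightarrow> k \<le> m \<Longrightarrow> col Y m"
  unfolding col_def by (meson order_less_le_trans subsetD)

lemma col_Un: assumes "col X k" "col Y m" shows "col (X \<union> Y) (k + m)"
proof -
  obtain c where c: "\<And>v. v \<in> X \<Longrightarrow> c v < k" "\<And>u v. u \<in> X \<Longrightarrow> v \<in> X \<Longrightarrow> E u v \<Longrightarrow> c u \<noteq> c v"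
    using assms(1) unfolding col_def by blast
  obtain d where d: "\<And>v. v \<in> Y \<Longrightarrow> d v < m" "\<And>u v. u \<in> Y \<Longrightarrow> v \<in> Y \<Longrightarrow> E u v \<Longrightarrow> d u \<noteq> d v"
    using assms(2) unfolding col_def by blast
  show ?thesis
    by (rule colI[of _ "\<lambda>v. if v \<in> X then c v else k + d v"])
      (use c d in \<open>auto simp: trans_less_add1 split: if_splits dest: c(1)\<close>)
qed

text \<open>The accounting step of all later arguments: a cheap part may be discarded at its price,
  and what remains is still expensive.\<close>

lemma col_Diff: "\<not> col X (k + m) \<Longrightarrow> col Y m \<Longrightarrow> \<not> col (X - Y) k"
  using col_Un[of "X - Y" k Y m] col_mono[of "X - Y \<union> Y" "k + m" X "k + m"] by blast

lemma col_stable: "anti X X \<Longrightarrow> col X 1"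
  by (rule colI[of _ "\<lambda>_. 0"]) (auto simp: anti_def)

lemma col_bip: "bip X l \<Longrightarrow> col X 2"
  by (rule colI[of _ "\<lambda>v. if l v then 1 else 0"]) (auto simp: bip_def)

lemma col_empty: "col {} k"
  by (rule colI) auto

lemma anti_sym: "anti A B \<Longrightarrow> anti B A"
  unfolding anti_def using symE by blast

lemma con_ne: "con S \<Longrightarrow> S \<noteq> {}"
  unfolding con_def by blast

lemma con_cut: "con S \<Longrightarrow> T \<subseteq> S \<Longrightarrow> T \<noteq> {} \<Longrightarrow> T \<noteq> S \<Longrightarrow> \<exists>u\<in>T. \<exists>v\<in>S - T. E u v"
  unfolding con_def by blast

text \<open>Every vertex outside the root \<open>A\<close> has a neighbour in \<open>A\<close> or of
  smaller \<open>f\<close>. For a part that contains \<open>A\<close>, a missing vertex of least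
  \<open>f\<close> thus has a neighbour inside. A part disjoint from \<open>A\<close> is handled
  through its complement, and one that splits \<open>A\<close> by the connectivity of
  \<open>A\<close>.\<close>

lemma con_rank:
  assumes "con A \<or> (\<exists>a. A = {a})" "A \<subseteq> S"
    and step: "\<And>v. v \<in> S \<Longrightarrow> v \<notin> A \<Longrightarrow> \<exists>u\<in>S. E v u \<and> (u \<in> A \<or> f u < (f v :: nat))"
  shows "con S"
proof -
  have key: "\<exists>u\<in>T. \<exists>v\<in>S - T. E u v" if T: "T \<subseteq> S" "A \<subseteq> T" "T \<noteq> S" for T
  proof -
    have "\<exists>v. v \<in> S - T" using T by blast
    then obtain v where v: "v \<in> S - T" "\<And>w. w \<in> S - T \<Longrightarrow> f v \<le> f w"
      using ex_has_least_nat[of "\<lambda>v. v \<in> S - T" _ f] by blast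
    then obtain u where u: "u \<in> S" "E v u" "u \<in> A \<or> f u < f v" using step T by blast
    then have "u \<in> T" using v(2)[of u] T by fastforce
    then show ?thesis using u v symE by blast
  qed
  have Ane: "A \<noteq> {}" using assms(1) con_ne by auto
  show ?thesis unfolding con_def
  proof (intro conjI allI impI)
    show "S \<noteq> {}" using Ane assms by blast
    fix T assume T: "T \<subseteq> S" "T \<noteq> {}" "T \<noteq> S"
    consider "A \<subseteq> T" | "A \<subseteq> S - T" | "A \<inter> T \<noteq> {}" "\<not> A \<subseteq> T" using assms(2) by blast
    then show "\<exists>u\<in>T. \<exists>v\<in>S - T. E u v"
    proof cases
      case 1 then show ?thesis using key T by blast
    next
      case 2
      then obtain u v where "u \<in> S - T" "v \<in> S - (S - T)" "E u v" using key[of "S - T"] T by blast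
      then show ?thesis using symE by blast
    next
      case 3
      then have "con A" using assms(1) by blast
      then obtain u v where "u \<in> A \<inter> T" "v \<in> A - (A \<inter> T)" "E u v" using con_cut[of A "A \<inter> T"] 3 by blast
      then show ?thesis using assms(2) by blast
    qed
  qed
qed

lemma con_sing: "con {a}"
  unfolding con_def by blast

lemma con_insert: "con A \<Longrightarrow> u \<in> A \<Longrightarrow> E v u \<Longrightarrow> con (insert v A)"
  by (rule con_rank[of A _ "\<lambda>_. 0"]) auto

lemma con_Un: assumes "con A" "con B" "u \<in> A" "v \<in> B" "E u v \<or> u = v" shows "con (A \<union> B)"
proof -
  have *: "\<exists>u\<in>T. \<exists>v\<in>A \<union> B - T. E u v" if T: "T \<subseteq> A \<union> B" "A \<inter> T \<noteq> {}" "T \<noteq> A \<union> B" for T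
  proof (cases "A \<subseteq> T")
    case False
    then show ?thesis using con_cut[OF assms(1), of "A \<inter> T"] T by blast
  next
    case True
    show ?thesis
    proof (cases "B \<inter> T = {}")
      case True
      then have "u \<in> T" "v \<notin> T" using \<open>A \<subseteq> T\<close> assms by blast+
      then show ?thesis using assms by blast
    next
      case False
      then show ?thesis using con_cut[OF assms(2), of "B \<inter> T"] T True by blast
    qed
  qed
  show ?thesis unfolding con_def
  proof (intro conjI allI impI)
    show "A \<union> B \<noteq> {}" using assms by blast
    fix T assume T: "T \<subseteq> A \<union> B" "T \<noteq> {}" "T \<noteq> A \<union> B"
    show "\<exists>u\<in>T. \<exists>v\<in>A \<union> B - T. E u v"
    proof (cases "A \<inter> T = {}")
      case False then show ?thesis using * T by blast
    next
      case True
      then have "A \<inter> (A \<union> B - T) \<noteq> {}" using con_ne[OF assms(1)] by blast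
      then obtain u v where "u \<in> A \<union> B - T" "v \<in> A \<union> B - (A \<union> B - T)" "E u v" 
        using *[of "A \<union> B - T"] T by blast
      then show ?thesis using symE by blast
    qed
  qed
qed

text \<open>Take a smallest part without \<open>P\<close> that has no edges to the rest of
  \<open>X\<close>. If some cut of it had no edge, both sides would be smaller and satisfy
  \<open>P\<close>, and so would their union. The property is abstract because
  \<open>bead_layers\<close> needs colourings with a side condition.\<close>

lemma con_component_pred:
  assumes X: "finite X" "\<not> P X" and P: "\<And>A B. P A \<Longrightarrow> P B \<Longrightarrow> A \<inter> B = {} \<Longrightarrow> anti A B \<Longrightarrow> P (A \<union> B)" "P {}"
  obtains K where "K \<subseteq> X" "con K" "\<not> P K" "anti K (X - K)"
proof -
  let ?Q = "\<lambda>K. K \<subseteq> X \<and> \<not> P K \<and> anti K (X - K)"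
  have "?Q X" using assms by (auto simp: anti_def)
  then obtain K where K: "?Q K" "\<And>L. ?Q L \<Longrightarrow> card K \<le> card L"
    using ex_has_least_nat[of ?Q X card] by blast
  have fK: "finite K" using K X finite_subset by blast
  have "con K" unfolding con_def
  proof (intro conjI allI impI)
    show "K \<noteq> {}" using K P by blast
    fix T assume T: "T \<subseteq> K" "T \<noteq> {}" "T \<noteq> K"
    show "\<exists>u\<in>T. \<exists>v\<in>K - T. E u v"
    proof (rule ccontr)
      assume n: "\<not> ?thesis"
      then have a: "anti T (K - T)" "anti (K - T) T" unfolding anti_def using symE by blast+
      have lt: "card T < card K" "card (K - T) < card K"
        using T fK by (auto intro!: psubset_card_mono)
      have "anti T (X - T)" using a(1) K(1) T unfolding anti_def by blast
      then have "P T" using K(2)[of T] lt T K(1) by fastforce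
      moreover have "anti (K - T) (X - (K - T))" using a(2) K(1) T unfolding anti_def by blast
      then have "P (K - T)" using K(2)[of "K - T"] lt T K(1) by fastforce
      ultimately have "P (T \<union> (K - T))" using P(1) a(1) by blast
      then show False using K(1) T by (simp add: Un_absorb1)
    qed
  qed
  then show ?thesis using K that by blast
qed

lemma con_component:
  assumes "finite X" "\<not> col X k"
  obtains K where "K \<subseteq> X" "con K" "\<not> col K k" "anti K (X - K)"
proof (rule con_component_pred[where P = "\<lambda>X. col X k", OF assms])
  fix A B assume AB: "col A k" "col B k" "A \<inter> B = {}" "anti A B"
  obtain c where c: "\<And>v. v \<in> A \<Longrightarrow> c v < k" "\<And>u v. u \<in> A \<Longrightarrow> v \<in> A \<Longrightarrow> E u v \<Longrightarrow> c u \<noteq> c v"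
    using AB(1) unfolding col_def by blast
  obtain d where d: "\<And>v. v \<in> B \<Longrightarrow> d v < k" "\<And>u v. u \<in> B \<Longrightarrow> v \<in> B \<Longrightarrow> E u v \<Longrightarrow> d u \<noteq> d v"
    using AB(2) unfolding col_def by blast
  show "col (A \<union> B) k"
    by (rule colI[of _ "\<lambda>v. if v \<in> A then c v else d v"])
      (use c d AB(4) anti_sym[OF AB(4)] in \<open>auto simp: anti_def split: if_splits\<close>)
qed (use that col_empty in auto)

lemma even_changes: "f n = f 0 \<Longrightarrow> even (card {i. i < n \<and> f i \<noteq> f (Suc i)})" for f :: "nat \<Rightarrow> bool"
proof -
  have "even (card {i. i < n \<and> f i \<noteq> f (Suc i)}) \<longleftrightarrow> f n = f 0"
  proof (induction n)
    case (Suc n)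
    have "{i. i < Suc n \<and> f i \<noteq> f (Suc i)} = {i. i < n \<and> f i \<noteq> f (Suc i)} \<union> (if f n \<noteq> f (Suc n) then {n} else {})"
      by (auto simp: less_Suc_eq)
    moreover have "card ({i. i < n \<and> f i \<noteq> f (Suc i)} \<union> {n}) = Suc (card {i. i < n \<and> f i \<noteq> f (Suc i)})"
      by (subst card_Un_disjoint) auto
    ultimately show ?case using Suc by (auto split: if_splits)
  qed auto
  then show "f n = f 0 \<Longrightarrow> ?thesis" by simp
qed

lemma sum_shift: assumes "x (c n) = x (c 0)"
  shows "(\<Sum>i<n. x (c (Suc i))) = (\<Sum>i<n. (x (c i) :: real))"
proof -
  have "(\<Sum>i<Suc n. x (c i)) = (\<Sum>i<n. x (c i)) + x (c n)" by simp
  moreover have "(\<Sum>i<Suc n. x (c i)) = x (c 0) + (\<Sum>i<n. x (c (Suc i)))" by (rule sum.lessThan_Suc_shift)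
  ultimately show ?thesis using assms by simp
qed

text \<open>Passes from the vertices of a closed walk to its edges, where tightness of edge
  constraints becomes visible.\<close>

lemma clw_sum: assumes "clw n c"
  shows "2 * (\<Sum>i<n. (x (c i) :: real)) = (\<Sum>i<n. x (c i) + x (c (Suc i)))"
  using sum_shift[of x c n] assms unfolding clw_def by (simp add: sum.distrib)

end

text \<open>The weights are required to be positive, so that tight constraints hold for each \<open>S i\<close>.
  Cycles are injective closed walks; the values \<open>c i\<close> for \<open>i > n\<close> are irrelevant.\<close>
locale tgraph = sgraph +
  assumes tp: "\<And>x :: 'a \<Rightarrow> real. \<lbrakk> \<And>v. v \<in> V \<Longrightarrow> 0 \<le> x v; \<And>v. v \<in> V \<Longrightarrow> x v \<le> 1;
     \<And>u v. E u v \<Longrightarrow> x u + x v \<le> 1;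
     \<And>n c. \<lbrakk>odd n; 3 \<le> n; clw n c; inj_on c {..<n}\<rbrakk> \<Longrightarrow> (\<Sum>i<n. x (c i)) \<le> (real n - 1) / 2 \<rbrakk> \<Longrightarrow>
     \<exists>N S w. (\<forall>i<N. S i \<subseteq> V \<and> (\<forall>u\<in>S i. \<forall>v\<in>S i. \<not> E u v) \<and> (0::real) < w i) \<and> (\<Sum>i<(N::nat). w i) = 1 \<and>
       (\<forall>v\<in>V. x v = (\<Sum>i<N. if v \<in> S i then w i else 0))"
begin

text \<open>t-perfection passes to induced subgraphs: extend the point by 0. The only new
  constraints come from odd cycles that leave \<open>Y\<close>, and positive weights keep the stable
  sets inside \<open>Y\<close>.\<close>

lemma tp_sub:
  fixes x :: "'a \<Rightarrow> real"
  assumes Y: "Y \<subseteq> V"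
    and x0: "\<And>v. v \<in> Y \<Longrightarrow> 0 \<le> x v" and x1: "\<And>v. v \<in> Y \<Longrightarrow> x v \<le> 1"
    and xe: "\<And>u v. u \<in> Y \<Longrightarrow> v \<in> Y \<Longrightarrow> E u v \<Longrightarrow> x u + x v \<le> 1"
    and xc: "\<And>n c. \<lbrakk>odd n; 3 \<le> n; clw n c; inj_on c {..<n}; \<And>i. c i \<in> Y\<rbrakk> \<Longrightarrow> (\<Sum>i<n. x (c i)) \<le> (real n - 1) / 2"
  shows "\<exists>N S w. (\<forall>i<N. S i \<subseteq> Y \<and> (\<forall>u\<in>S i. \<forall>v\<in>S i. \<not> E u v) \<and> (0::real) < w i) \<and> (\<Sum>i<(N::nat). w i) = 1 \<and>
       (\<forall>v\<in>Y. x v = (\<Sum>i<N. if v \<in> S i then w i else 0))"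
proof -
  define y where "y = (\<lambda>v. if v \<in> Y then x v else 0)"
  have ye: "y u + y v \<le> 1" if "E u v" for u v
    using xe[of u v] x1[of u] x1[of v] that by (auto simp: y_def)
  have "\<exists>N S w. (\<forall>i<N. S i \<subseteq> V \<and> (\<forall>u\<in>S i. \<forall>v\<in>S i. \<not> E u v) \<and> (0::real) < w i) \<and> (\<Sum>i<(N::nat). w i) = 1 \<and>
       (\<forall>v\<in>V. y v = (\<Sum>i<N. if v \<in> S i then w i else 0))"
  proof (rule tp)
    fix n c assume n: "odd n" "3 \<le> n" and c: "clw n c" "inj_on c {..<n}"
    show "(\<Sum>i<n. y (c i)) \<le> (real n - 1) / 2"
    proof (cases "\<forall>i<n. c i \<in> Y")
      case True
      \<comment> \<open>The hypothesis \<open>xc\<close> wants all values in \<open>Y\<close>,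
        including the irrelevant ones after \<open>n\<close>.\<close>
      define d where "d = (\<lambda>i. if i \<le> n then c i else c 0)"
      have "clw n d" "inj_on d {..<n}" using c unfolding clw_def d_def inj_on_def by auto
      moreover have "d i \<in> Y" for i
        using True c n unfolding d_def clw_def by (cases "i = n") auto
      ultimately have "(\<Sum>i<n. x (d i)) \<le> (real n - 1) / 2" using xc n by blast
      moreover have "(\<Sum>i<n. x (d i)) = (\<Sum>i<n. y (c i))"
        by (rule sum.cong) (use True in \<open>auto simp: d_def y_def\<close>)
      ultimately show ?thesis by simp
    next
      case False
      then obtain j where j: "j < n" "c j \<notin> Y" by blast
      \<comment> \<open>a vertex of weight 0 leaves a path, which is matched up edge by edge\<close>
      define d where "d = (\<lambda>i. c ((j + i) mod n))"
      have dE: "E (d i) (d (Suc i))" for i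
      proof -
        have l: "(j + i) mod n < n" using n by simp
        have "(j + Suc i) mod n = (if Suc ((j + i) mod n) = n then 0 else Suc ((j + i) mod n))"
          by (simp add: mod_Suc)
        then show ?thesis using c(1) l unfolding d_def clw_def by (metis)
      qed
      have b: "bij_betw (\<lambda>i. (j + i) mod n) {..<n} {..<n}"
      proof (rule bij_betw_byWitness[where f' = "\<lambda>i. (i + (n - j)) mod n"])
        show "\<forall>a\<in>{..<n}. ((j + a) mod n + (n - j)) mod n = a"
        proof
          fix a assume a: "a \<in> {..<n}"
          have "((j + a) mod n + (n - j)) mod n = (j + a + (n - j)) mod n" by (rule mod_add_left_eq)
          also have "j + a + (n - j) = a + n" using j by simp
          finally show "((j + a) mod n + (n - j)) mod n = a" using a by simp
        qed
        show "\<forall>a\<in>{..<n}. (j + (a + (n - j)) mod n) mod n = a"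
        proof
          fix a assume a: "a \<in> {..<n}"
          have "(j + (a + (n - j)) mod n) mod n = (j + (a + (n - j))) mod n" by (rule mod_add_right_eq)
          also have "j + (a + (n - j)) = a + n" using j by simp
          finally show "(j + (a + (n - j)) mod n) mod n = a" using a by simp
        qed
      qed (use n in auto)
      have s1: "(\<Sum>i<n. y (c i)) = (\<Sum>i<n. y (d i))"
        unfolding d_def using sum.reindex_bij_betw[OF b, of "\<lambda>i. y (c i)"] by simp
      obtain m where m: "n = Suc (2 * m)" using n by (metis oddE Suc_eq_plus1)
      have p: "(\<Sum>i<k. y (d (Suc (2*i))) + y (d (Suc (Suc (2*i))))) \<le> real k" for k
      proof (induction k)
        case (Suc k)
        then show ?case using ye[OF dE[of "Suc (2 * k)"]] by simp
      qed simp
      have q: "(\<Sum>i<Suc (2*k). y (d i)) = y (d 0) + (\<Sum>i<k. y (d (Suc (2*i))) + y (d (Suc (Suc (2*i)))))" for k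
        by (induction k) auto
      have "d 0 = c j" using j by (simp add: d_def)
      then have "y (d 0) = 0" using j by (simp add: y_def)
      then show ?thesis using p[of m] q[of m] s1 m by simp
    qed
  qed (use ye x0 x1 in \<open>auto simp: y_def\<close>)
  then obtain N S w where NS: "\<And>i. i < N \<Longrightarrow> S i \<subseteq> V \<and> (\<forall>u\<in>S i. \<forall>v\<in>S i. \<not> E u v) \<and> (0::real) < w i" 
    "(\<Sum>i<(N::nat). w i) = 1" "\<And>v. v \<in> V \<Longrightarrow> y v = (\<Sum>i<N. if v \<in> S i then w i else 0)" by blast
  have sY: "S i \<subseteq> Y" if i: "i < N" for i
  proof
    fix v assume v: "v \<in> S i"
    show "v \<in> Y"
    proof (rule ccontr)
      assume "v \<notin> Y"
      then have "(\<Sum>i<N. if v \<in> S i then w i else 0) = 0" using NS(3)[of v] NS(1)[OF i] v by (auto simp: y_def)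
      moreover have "0 < (\<Sum>i<N. if v \<in> S i then w i else 0)"
        by (rule sum_pos2[of _ i]) (use i v NS(1) in \<open>auto simp: less_imp_le\<close>)
      ultimately show False by simp
    qed
  qed
  have "x v = (\<Sum>i<N. if v \<in> S i then w i else 0)" if "v \<in> Y" for v
    using NS(3)[of v] that Y by (auto simp: y_def)
  then show ?thesis using NS sY by (intro exI[of _ N] exI[of _ S] exI[of _ w]) blast
qed


section \<open>Contracting hubs\<close>

text \<open>Weight 1/3 on low and 2/3 on high vertices: the stable sets in a convex combination alternate along
  low-high edges, hence on each class of \<open>\<pi>\<close>. They act on the quotient by \<open>\<pi>\<close>, where every
  triangle is met exactly once; \<open>sel\<close> is the trace of a stable set that misses the class \<open>h\<close>.\<close>
lemma quotient_alternation:
  fixes \<pi> :: "'a \<Rightarrow> 'b"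
  assumes Y: "Y \<subseteq> V"
    and hh: "\<And>u v. u \<in> Y \<Longrightarrow> v \<in> Y \<Longrightarrow> E u v \<Longrightarrow> low u \<or> low v"
    and ti: "\<And>u v. u \<in> Y \<Longrightarrow> v \<in> Y \<Longrightarrow> E u v \<Longrightarrow> low u \<Longrightarrow> \<not> low v \<Longrightarrow> \<pi> u = \<pi> v"
    and lo: "\<And>u v. u \<in> Y \<Longrightarrow> v \<in> Y \<Longrightarrow> E u v \<Longrightarrow> low u \<Longrightarrow> low v \<Longrightarrow> \<pi> u \<noteq> \<pi> v"
    and cn: "\<And>v. v \<in> Y \<Longrightarrow> con {u \<in> Y. \<pi> u = \<pi> v}"
  obtains sel :: "'b \<Rightarrow> bool" where
    "\<And>u v a b a' b'. \<lbrakk>u \<in> Y; v \<in> Y; a \<in> Y; b \<in> Y; a' \<in> Y; b' \<in> Y; low u; low v; low a; low b; low a'; low b';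
       E u v; E a b; E a' b'; \<pi> a = h; \<pi> a' = h; \<pi> b = \<pi> u; \<pi> b' = \<pi> v\<rbrakk> \<Longrightarrow> sel (\<pi> u) \<noteq> sel (\<pi> v)"
proof (cases "\<exists>a\<in>Y. low a \<and> \<pi> a = h")
  case False
  show ?thesis by (rule that[of "\<lambda>_. True"]) (use False in blast)
next
  case True
  then obtain a0 where a0: "a0 \<in> Y" "low a0" "\<pi> a0 = h" by blast
  define x where "x = (\<lambda>v. if low v then 1/3 else 2/3 :: real)"
  have "\<exists>N S w. (\<forall>i<N. S i \<subseteq> Y \<and> (\<forall>u\<in>S i. \<forall>v\<in>S i. \<not> E u v) \<and> (0::real) < w i) \<and> (\<Sum>i<(N::nat). w i) = 1 \<and>
       (\<forall>v\<in>Y. x v = (\<Sum>i<N. if v \<in> S i then w i else 0))"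
  proof (rule tp_sub[OF Y])
    fix u v assume "u \<in> Y" "v \<in> Y" "E u v"
    then show "x u + x v \<le> 1" using hh by (auto simp: x_def)
  next
    fix n c assume n: "odd n" "3 \<le> n" and c: "clw n c" "inj_on c {..<n}" and cY: "\<And>i. c i \<in> Y"
    \<comment> \<open>Low-high edges are tight and low-low edges have slack 1/3. The former occur an
      even number of times on the cycle, so the latter occur an odd number of times. A single one
      would have both ends in one class, by following the tight edges around the cycle, against
      \<open>lo\<close>. Hence there are at least three, and the total slack is at least 1.\<close>
    define L where "L = {i. i < n \<and> low (c i) \<and> low (c (Suc i))}"
    define T where "T = {i. i < n \<and> low (c i) \<noteq> low (c (Suc i))}"
    have E: "i < n \<Longrightarrow> E (c i) (c (Suc i))" for i using c by (simp add: clw_def)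
    have c0: "c n = c 0" using c by (simp add: clw_def)
    have fin: "finite L" "finite T" by (auto simp: L_def T_def)
    have "{..<n} = L \<union> T" using hh[OF cY cY E] by (auto simp: L_def T_def)
    moreover have "L \<inter> T = {}" by (auto simp: L_def T_def)
    ultimately have card: "n = card L + card T" using card_Un_disjoint[OF fin] by (metis card_lessThan)
    have "even (card T)" unfolding T_def using even_changes[of "\<lambda>i. low (c i)" n] c0 by simp
    then have oL: "odd (card L)" using card n by auto
    have tight: "\<pi> (c i) = \<pi> (c (Suc i))" if "i < n" "i \<notin> L" for i
      using that hh[OF cY cY E[OF that(1)]] ti[OF cY cY E[OF that(1)]] ti[OF cY cY symE[OF E[OF that(1)]]]
      unfolding L_def by fastforce
    have "card L \<noteq> 1"
    proof
      assume "card L = 1"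
      then obtain j where j: "L = {j}" by (auto simp: card_1_singleton_iff)
      have jn: "j < n" "low (c j)" "low (c (Suc j))" using j by (auto simp: L_def)
      have p1: "\<pi> (c i) = \<pi> (c 0)" if "i \<le> j" for i
        using that
      proof (induction i)
        case (Suc i)
        then have "i < n" "i \<notin> L" using jn j by auto
        then show ?case using Suc tight[of i] by simp
      qed simp
      have p2: "Suc j \<le> i \<Longrightarrow> i \<le> n \<Longrightarrow> \<pi> (c i) = \<pi> (c (Suc j))" for i
      proof (induction i rule: dec_induct)
        case (step i)
        then have "i < n" "i \<notin> L" using jn j by auto
        then show ?case using step tight[of i] by simp
      qed simp
      have "\<pi> (c j) = \<pi> (c (Suc j))" using p1[of j] p2[of n] jn c0 by simp
      then show False using lo[OF cY cY E[OF jn(1)]] jn by blast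
    qed
    moreover have "card L \<noteq> 0" "card L \<noteq> 2" using oL by (intro notI, simp)+
    ultimately have L3: "3 \<le> card L" by linarith
    define g where "g = (\<lambda>i. if i \<in> L then 1/3 else 0 :: real)"
    have "x (c i) + x (c (Suc i)) = 1 - g i" if "i < n" for i
      using hh[OF cY cY E[OF that]] that by (auto simp: x_def L_def g_def)
    then have "(\<Sum>i<n. x (c i) + x (c (Suc i))) = (\<Sum>i<n. 1 - g i)" by (intro sum.cong) auto
    also have "\<dots> = (\<Sum>i<n. 1) - (\<Sum>i<n. g i)" by (rule sum_subtractf)
    finally have s1: "(\<Sum>i<n. x (c i) + x (c (Suc i))) = real n - (\<Sum>i<n. g i)" by simp
    have "L \<subseteq> {..<n}" by (auto simp: L_def)
    then have "(\<Sum>i<n. g i) = (\<Sum>i\<in>L. g i)"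
      by (intro sum.mono_neutral_right) (auto simp: g_def)
    also have "\<dots> = real (card L) / 3" by (simp add: g_def)
    finally have "1 \<le> (\<Sum>i<n. g i)" using L3 by simp
    moreover have "2 * (\<Sum>i<n. x (c i)) = real n - (\<Sum>i<n. g i)" using clw_sum[OF c(1), of x] s1 by (rule trans)
    ultimately have "2 * (\<Sum>i<n. x (c i)) \<le> real n - 1" by (metis diff_left_mono)
    then show "(\<Sum>i<n. x (c i)) \<le> (real n - 1) / 2" by (metis mult.commute pos_le_divide_eq zero_less_numeral)
  qed (auto simp: x_def)
  then obtain N S w where NS: "\<forall>i<N. S i \<subseteq> Y \<and> (\<forall>u\<in>S i. \<forall>v\<in>S i. \<not> E u v) \<and> (0::real) < w i"
    and w2: "(\<Sum>i<(N::nat). w i) = 1" and x': "\<forall>v\<in>Y. x v = (\<Sum>i<N. if v \<in> S i then w i else 0)"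
    by (elim exE conjE) (rule that)
  have S: "S i \<subseteq> Y" "u \<in> S i \<Longrightarrow> v \<in> S i \<Longrightarrow> \<not> E u v" if "i < N" for i u v
    using NS[rule_format, OF that] by auto
  have w: "i < N \<Longrightarrow> (0::real) < w i" "(\<Sum>i<(N::nat). w i) = 1" for i
    using NS w2 by auto
  have x: "x v = (\<Sum>i<N. if v \<in> S i then w i else 0)" if "v \<in> Y" for v
    using x' that by (rule bspec)
  have tightness: "f i = 1" if "i < N" "\<And>i. i < N \<Longrightarrow> f i \<le> 1" "(\<Sum>i<N. f i * w i) = 1" for f i
    by (rule convex_tight[OF w(1) w(2) that])
  have alt: "u \<in> S i \<longleftrightarrow> v \<notin> S i" if "i < N" "u \<in> Y" "v \<in> Y" "E u v" "low u" "\<not> low v" for i u v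
  proof -
    define f where "f = (\<lambda>i. (if u \<in> S i then 1 else 0) + (if v \<in> S i then 1 else 0) :: real)"
    have "f i = 1"
    proof (rule tightness[OF that(1)])
      show "f i \<le> 1" if "i < N" for i using S(2)[OF that, of u v] \<open>E u v\<close> by (auto simp: f_def)
      have "x u + x v = 1" using that by (simp add: x_def)
      moreover have "(\<Sum>i<N. f i * w i) = x u + x v"
        unfolding x[OF that(2)] x[OF that(3)] sum.distrib[symmetric] by (rule sum.cong) (auto simp: f_def)
      ultimately show "(\<Sum>i<N. f i * w i) = 1" by simp
    qed
    then show ?thesis by (auto simp: f_def split: if_splits)
  qed
  have same: "u \<in> S i \<longleftrightarrow> v \<in> S i" if i: "i < N" and uv: "u \<in> Y" "v \<in> Y" "\<pi> u = \<pi> v" "low u" "low v" for i u v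
  proof -
    let ?C = "{z \<in> Y. \<pi> z = \<pi> v}"
    \<comment> \<open>All edges inside a class are low-high, so by \<open>alt\<close> no such edge
      leaves this set; connectivity makes it the whole class.\<close>
    let ?T = "{z \<in> ?C. (z \<in> S i \<longleftrightarrow> low z) = (v \<in> S i \<longleftrightarrow> low v)}"
    have "?T = ?C"
    proof (rule ccontr)
      assume "?T \<noteq> ?C"
      moreover have "v \<in> ?T" using uv by simp
      ultimately obtain a b where ab: "a \<in> ?T" "b \<in> ?C - ?T" "E a b"
        using con_cut[OF cn[OF uv(2)], of ?T] by blast
      then have abY: "a \<in> Y" "b \<in> Y" "\<pi> a = \<pi> b" by auto
      then have "low a \<noteq> low b" using hh[OF abY(1,2) ab(3)] lo[OF abY(1,2) ab(3)] by blast
      then have "(a \<in> S i \<longleftrightarrow> low a) = (b \<in> S i \<longleftrightarrow> low b)"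
        using alt[OF i abY(1,2) ab(3)] alt[OF i abY(2,1) symE[OF ab(3)]] by blast
      then show False using ab by auto
    qed
    then have "u \<in> ?T" using uv by blast
    then show ?thesis using uv by simp
  qed
  have "\<exists>i<N. a0 \<notin> S i"
  proof (rule ccontr)
    assume "\<not> ?thesis"
    then have "x a0 = 1" using x[OF a0(1)] w by simp
    then show False using a0 by (simp add: x_def)
  qed
  then obtain i where i: "i < N" "a0 \<notin> S i" by blast
  show ?thesis
  proof (rule that[of "\<lambda>p. \<exists>v\<in>Y. low v \<and> \<pi> v = p \<and> v \<in> S i"])
    fix u v a b a' b'
    assume Y': "u \<in> Y" "v \<in> Y" "a \<in> Y" "b \<in> Y" "a' \<in> Y" "b' \<in> Y"
      and l: "low u" "low v" "low a" "low b" "low a'" "low b'"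
      and e: "E u v" "E a b" "E a' b'" and p: "\<pi> a = h" "\<pi> a' = h" "\<pi> b = \<pi> u" "\<pi> b' = \<pi> v"
    \<comment> \<open>The constraint of a quotient triangle. By \<open>same\<close>, membership of
      \<open>u\<close>, \<open>v\<close> and \<open>a0\<close> can be read off at the ends of the
      edges \<open>a b\<close> and \<open>a' b'\<close>, so at most one of the three is chosen,
      while the weights add up to 1.\<close>
    define f where "f = (\<lambda>i. (if u \<in> S i then 1 else 0) + (if v \<in> S i then 1 else 0) + (if a0 \<in> S i then 1 else 0) :: real)"
    have "f i = 1"
    proof (rule tightness[OF i(1)])
      show "f i \<le> 1" if "i < N" for i
      proof -
        have "u \<in> S i \<longleftrightarrow> b \<in> S i" "v \<in> S i \<longleftrightarrow> b' \<in> S i" "a0 \<in> S i \<longleftrightarrow> a \<in> S i" "a0 \<in> S i \<longleftrightarrow> a' \<in> S i"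
          using same[OF that Y'(1) Y'(4)] same[OF that Y'(2) Y'(6)] same[OF that a0(1) Y'(3)] same[OF that a0(1) Y'(5)]
            l p a0 by simp_all
        then show ?thesis using S(2)[OF that] e by (auto simp: f_def)
      qed
      have "x u + x v + x a0 = 1" using l a0 by (simp add: x_def)
      moreover have "(\<Sum>i<N. f i * w i) = x u + x v + x a0"
        unfolding x[OF Y'(1)] x[OF Y'(2)] x[OF a0(1)] sum.distrib[symmetric] by (rule sum.cong) (auto simp: f_def)
      ultimately show "(\<Sum>i<N. f i * w i) = 1" by simp
    qed
    then have "(u \<in> S i) \<noteq> (v \<in> S i)" using i by (auto simp: f_def split: if_splits)
    moreover have "(\<exists>z\<in>Y. low z \<and> \<pi> z = \<pi> u \<and> z \<in> S i) \<longleftrightarrow> u \<in> S i" "(\<exists>z\<in>Y. low z \<and> \<pi> z = \<pi> v \<and> z \<in> S i) \<longleftrightarrow> v \<in> S i"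
      using same[OF i(1)] Y' l by blast+
    ultimately show "(\<exists>z\<in>Y. low z \<and> \<pi> z = \<pi> u \<and> z \<in> S i) \<noteq> (\<exists>z\<in>Y. low z \<and> \<pi> z = \<pi> v \<and> z \<in> S i)" by simp
  qed
qed

end

section \<open>Induced paths and induced odd cycles\<close>

context sgraph begin

lemma ipath_Nil [simp]: "ipath []"
  by (simp add: ipath_def)

lemma ipath_Cons: "ipath (x # xs) \<longleftrightarrow> x \<notin> set xs \<and> ipath xs \<and> (\<forall>y\<in>set xs. E x y \<longleftrightarrow> y = hd xs)"
proof (cases "x \<notin> set xs \<and> distinct xs")
  case True
  have *: "(\<forall>j<length xs. E x (xs ! j) \<longleftrightarrow> j = 0) \<longleftrightarrow> (\<forall>y\<in>set xs. E x y \<longleftrightarrow> y = hd xs)"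
  proof (cases "xs = []")
    case False
    have "(\<forall>y\<in>set xs. E x y \<longleftrightarrow> y = hd xs) \<longleftrightarrow> (\<forall>j<length xs. E x (xs ! j) \<longleftrightarrow> xs ! j = xs ! 0)"
      using False by (simp add: all_set_conv_all_nth hd_conv_nth)
    then show ?thesis using True False by (simp add: nth_eq_iff_index_eq)
  qed simp
  have "ipath (x # xs) \<longleftrightarrow> (\<forall>j<length xs. E x (xs ! j) \<longleftrightarrow> j = 0) \<and> (\<forall>j<length xs. E (xs ! j) x \<longleftrightarrow> j = 0) \<and>
     (\<forall>i<length xs. \<forall>j<length xs. E (xs ! i) (xs ! j) \<longleftrightarrow> i = Suc j \<or> j = Suc i)"
    unfolding ipath_def using True irrE by (auto simp: All_less_Suc2)
  also have "\<dots> \<longleftrightarrow> (\<forall>j<length xs. E x (xs ! j) \<longleftrightarrow> j = 0) \<and> ipath xs"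
    unfolding ipath_def using True symE by blast
  finally show ?thesis using * True by blast
qed (auto simp: ipath_def)

text \<open>If one part is empty, the condition on cross edges is vacuous, so the values of
  \<open>last []\<close> and \<open>hd []\<close> never matter.\<close>

lemma ipath_append: "ipath (xs @ ys) \<longleftrightarrow> ipath xs \<and> ipath ys \<and> set xs \<inter> set ys = {} \<and>
   (\<forall>x\<in>set xs. \<forall>y\<in>set ys. E x y \<longleftrightarrow> x = last xs \<and> y = hd ys)"
proof (induction xs)
  case (Cons a xs)
  show ?case
  proof (cases "xs = []")
    case True then show ?thesis by (auto simp: ipath_Cons)
  next
    case False
    then have l: "last (a # xs) = last xs" "last xs \<in> set xs" "hd (xs @ ys) = hd xs" "hd xs \<in> set xs" by auto
    have d: "hd xs \<notin> set ys" if "set xs \<inter> set ys = {}" using that l(4) by blast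
    show ?thesis unfolding append_Cons ipath_Cons Cons.IH l using l(2,4) d by (auto simp: l)
  qed
qed simp

lemma ipath_rev: "ipath (rev xs) \<longleftrightarrow> ipath xs"
proof (induction xs)
  case (Cons a xs)
  have e: "E x a \<longleftrightarrow> E a x" for x using symE by blast
  show ?case using Cons by (auto simp: ipath_append ipath_Cons last_rev e)
qed simp

lemma ipath_distinct: "ipath xs \<Longrightarrow> distinct xs"
  by (simp add: ipath_def)

lemma ipath_nth: "ipath xs \<Longrightarrow> i < length xs \<Longrightarrow> j < length xs \<Longrightarrow> E (xs ! i) (xs ! j) \<longleftrightarrow> i = Suc j \<or> j = Suc i"
  by (simp add: ipath_def)

definition pos :: "'a list \<Rightarrow> 'a \<Rightarrow> nat" where
  "pos xs v = (THE i. i < length xs \<and> xs ! i = v)"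

lemma pos_nth: "distinct xs \<Longrightarrow> i < length xs \<Longrightarrow> pos xs (xs ! i) = i"
  unfolding pos_def by (rule the_equality) (auto simp: nth_eq_iff_index_eq)

lemma pos_in: "distinct xs \<Longrightarrow> v \<in> set xs \<Longrightarrow> pos xs v < length xs \<and> xs ! pos xs v = v"
  by (metis in_set_conv_nth pos_nth)

lemma ipath_con: "ipath xs \<Longrightarrow> xs \<noteq> [] \<Longrightarrow> con (set xs)"
proof (induction xs)
  case (Cons a xs)
  show ?case
  proof (cases "xs = []")
    case False
    then have "con (set xs)" "E a (hd xs)" "hd xs \<in> set xs" using Cons by (auto simp: ipath_Cons)
    then show ?thesis using con_insert[of "set xs" "hd xs" a] by simp
  qed (simp add: con_sing)
qed simp

text \<open>The parameter \<open>b\<close> decides which parity of positions counts as low.\<close>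

lemma ipath_bip: "ipath xs \<Longrightarrow> bip (set xs) (\<lambda>v. even (pos xs v) = b)"
  unfolding bip_def
proof (intro ballI impI)
  fix u v assume x: "ipath xs" and u: "u \<in> set xs" and v: "v \<in> set xs" and e: "E u v"
  have d: "distinct xs" using x by (rule ipath_distinct)
  have "pos xs u = Suc (pos xs v) \<or> pos xs v = Suc (pos xs u)"
    using ipath_nth[OF x, of "pos xs u" "pos xs v"] pos_in[OF d u] pos_in[OF d v] e by simp
  then show "(even (pos xs u) = b) \<noteq> (even (pos xs v) = b)" by auto
qed

text \<open>An induced odd cycle, cut open at the vertex \<open>q\<close>.\<close>
definition icyc :: "'a \<Rightarrow> 'a list \<Rightarrow> bool" where
  "icyc q xs \<longleftrightarrow> xs \<noteq> [] \<and> even (length xs) \<and> q \<notin> set xs \<and> ipath xs \<and> (\<forall>v\<in>set xs. E q v \<longleftrightarrow> v = hd xs \<or> v = last xs)"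

text \<open>Any vertex of the cycle can be made the one at which it is cut, so contacts can be
  brought into a convenient linear order.\<close>

lemma icyc_rotate: assumes "icyc q (as @ r # bs)" shows "icyc r (bs @ q # as)"
proof -
  have e: "E x y \<longleftrightarrow> E y x" for x y using symE by blast
  have ne: "as \<noteq> [] \<or> bs \<noteq> []" using assms by (auto simp: icyc_def)
  have i: "ipath as" "ipath bs" "ipath (as @ r # bs)" and q: "q \<notin> set (as @ r # bs)"
    using assms by (auto simp: icyc_def ipath_append ipath_Cons)
  have dis: "set as \<inter> set bs = {}" "r \<notin> set as" "r \<notin> set bs" using i(3) by (auto simp: ipath_append ipath_Cons)
  have Q: "E q v \<longleftrightarrow> v = hd (as @ r # bs) \<or> v = last (as @ r # bs)" if "v \<in> set (as @ r # bs)" for v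
  proof -
    have "\<forall>v\<in>set (as @ r # bs). E q v \<longleftrightarrow> v = hd (as @ r # bs) \<or> v = last (as @ r # bs)"
      using assms unfolding icyc_def by (elim conjE)
    then show ?thesis using that by (rule bspec)
  qed
  have q1: "E q v \<longleftrightarrow> v = hd as" if v: "v \<in> set as" for v
  proof -
    have "last (as @ r # bs) \<in> insert r (set bs)" by simp
    then have "last (as @ r # bs) \<notin> set as" using dis by auto
    then have "v \<noteq> last (as @ r # bs)" using v by metis
    moreover have "hd (as @ r # bs) = hd as" using v by (cases as) auto
    ultimately show ?thesis using Q[of v] v by simp
  qed
  have q2: "E q v \<longleftrightarrow> v = last bs" if v: "v \<in> set bs" for v
  proof -
    have "hd (as @ r # bs) \<in> insert r (set as)" by (cases as) auto
    then have "hd (as @ r # bs) \<notin> set bs" using dis by auto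
    then have "v \<noteq> hd (as @ r # bs)" using v by metis
    moreover have "last (as @ r # bs) = last bs" using v by auto
    ultimately show ?thesis using Q[of v] v by simp
  qed
  have r1: "v \<in> set as \<Longrightarrow> E r v \<longleftrightarrow> v = last as" for v
    using i(3) e[of r v] by (auto simp: ipath_append)
  have r2: "v \<in> set bs \<Longrightarrow> E r v \<longleftrightarrow> v = hd bs" for v
    using i(3) by (auto simp: ipath_append ipath_Cons)
  have qr: "E q r \<longleftrightarrow> as = [] \<or> bs = []"
  proof -
    have "r = hd (as @ r # bs) \<longleftrightarrow> as = []" using dis by (cases as) auto
    moreover have "r = last (as @ r # bs) \<longleftrightarrow> bs = []" using dis by (cases bs rule: rev_cases) auto
    ultimately show ?thesis using Q[of r] by simp
  qed
  have ab: "a \<in> set as \<Longrightarrow> b \<in> set bs \<Longrightarrow> \<not> E b a" for a b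
    using i(3) e[of b a] by (auto simp: ipath_append ipath_Cons)
  have p: "ipath (q # as)" using i q q1 by (auto simp: ipath_Cons)
  have "ipath (bs @ q # as)"
    using p i(2) dis q q2 ab e[of _ q] by (auto simp: ipath_append)
  moreover have "even (length (bs @ q # as))" using assms by (auto simp: icyc_def)
  moreover have "E r v \<longleftrightarrow> v = hd (bs @ q # as) \<or> v = last (bs @ q # as)" if as: "v \<in> set (bs @ q # as)" for v
  proof -
    consider "v \<in> set as" | "v \<in> set bs" | "v = q" using as by auto
    then show ?thesis
    proof cases
      case 1
      then have "v \<noteq> hd (bs @ q # as)" "as \<noteq> []" using dis q by (cases bs; force)+
      then show ?thesis using r1[OF 1] by simp
    next
      case 2
      then have "v \<noteq> last (bs @ q # as)" "bs \<noteq> []" using dis q by (cases as rule: rev_cases; force)+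
      then show ?thesis using r2[OF 2] by simp
    next
      case 3
      have "q = hd (bs @ q # as) \<longleftrightarrow> bs = []" using q by (cases bs) auto
      moreover have "q = last (bs @ q # as) \<longleftrightarrow> as = []" using q by (cases as rule: rev_cases) auto
      ultimately show ?thesis unfolding 3 using qr e[of r q] by metis
    qed
  qed
  ultimately show ?thesis using dis q by (auto simp: icyc_def)
qed

end

section \<open>Hubs with contacts on an odd rim\<close>

context tgraph begin

text \<open>The conclusion of \<open>quotient_alternation\<close> as a predicate: \<open>sel\<close>
  separates the classes of every low-low edge that forms a triangle with the class \<open>h\<close>
  in the quotient.\<close>

definition qsel :: "'a set \<Rightarrow> ('a \<Rightarrow> bool) \<Rightarrow> ('a \<Rightarrow> 'b) \<Rightarrow> 'b \<Rightarrow> ('b \<Rightarrow> bool) \<Rightarrow> bool" where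
  "qsel Y low \<pi> h sel \<longleftrightarrow> (\<forall>u v a b a' b'. u \<in> Y \<longrightarrow> v \<in> Y \<longrightarrow> a \<in> Y \<longrightarrow> b \<in> Y \<longrightarrow> a' \<in> Y \<longrightarrow> b' \<in> Y \<longrightarrow>
     low u \<longrightarrow> low v \<longrightarrow> low a \<longrightarrow> low b \<longrightarrow> low a' \<longrightarrow> low b' \<longrightarrow>
     E u v \<longrightarrow> E a b \<longrightarrow> E a' b' \<longrightarrow> \<pi> a = h \<longrightarrow> \<pi> a' = h \<longrightarrow> \<pi> b = \<pi> u \<longrightarrow> \<pi> b' = \<pi> v \<longrightarrow> sel (\<pi> u) \<noteq> sel (\<pi> v))"

lemma qselD:
  assumes "qsel Y low \<pi> h sel" "u \<in> Y" "v \<in> Y" "a \<in> Y" "b \<in> Y" "a' \<in> Y" "b' \<in> Y" "low u" "low v" "low a" "low b" "low a'" "low b'"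
       "E u v" "E a b" "E a' b'" "\<pi> a = h" "\<pi> a' = h" "\<pi> b = \<pi> u" "\<pi> b' = \<pi> v"
  shows "sel (\<pi> u) \<noteq> sel (\<pi> v)"
  by (rule assms(1)[unfolded qsel_def, rule_format, OF assms(2-)])

text \<open>The form in which contraction is applied: the edges between classes are exactly the
  low-low ones, and all others are low-high inside a class. This edge check and the connectivity of
  the classes are the whole work of an application.\<close>

lemma quotient_selection:
  fixes \<pi> :: "'a \<Rightarrow> 'b"
  assumes Y: "Y \<subseteq> V"
    and ok: "\<And>u v. u \<in> Y \<Longrightarrow> v \<in> Y \<Longrightarrow> E u v \<Longrightarrow> (low u \<or> low v) \<and> (low u \<and> low v \<longleftrightarrow> \<pi> u \<noteq> \<pi> v)"
    and cn: "\<And>v. v \<in> Y \<Longrightarrow> con {u \<in> Y. \<pi> u = \<pi> v}"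
  shows "\<exists>sel. qsel Y low \<pi> h sel"
proof -
  have a: "low u \<or> low v" if "u \<in> Y" "v \<in> Y" "E u v" for u v using ok[OF that] by blast
  have b: "\<pi> u = \<pi> v" if "u \<in> Y" "v \<in> Y" "E u v" "low u" "\<not> low v" for u v using ok[OF that(1-3)] that(4-) by blast
  have c: "\<pi> u \<noteq> \<pi> v" if "u \<in> Y" "v \<in> Y" "E u v" "low u" "low v" for u v using ok[OF that(1-3)] that(4-) by blast
  show ?thesis
  proof (rule quotient_alternation[where low = low and \<pi> = \<pi> and h = h, OF Y], erule (2) a, erule (4) b, erule (4) c, erule cn, goal_cases)
    case (1 sel)
    have "qsel Y low \<pi> h sel" unfolding qsel_def by (intro allI impI) (rule 1)
    then show ?case by blast
  qed
qed

text \<open>The path \<open>xs\<close> and the set \<open>W\<close> close up to a rim. Cutting the path before every contact with the hub \<open>A\<close>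
  whose predecessor is low makes the contacts low and the number \<open>m\<close> of classes on the rim odd. All classes
  touch the hub, so \<open>sel\<close> would alternate around an odd cycle.\<close>
lemma no_odd_hub_path_contacts:
  assumes A: "con A" "bip A la" "A \<subseteq> V" and W: "con W" "bip W lo" "W \<subseteq> V" and xs: "ipath xs" "set xs \<subseteq> V" "even (length xs)"
    and dis: "A \<inter> W = {}" "A \<inter> set xs = {}" "W \<inter> set xs = {}"
    and Ax: "\<And>a z. a \<in> A \<Longrightarrow> z \<in> set xs \<Longrightarrow> E a z \<Longrightarrow> la a"
    and AW: "\<And>a w. a \<in> A \<Longrightarrow> w \<in> W \<Longrightarrow> E a w \<Longrightarrow> la a \<and> lo w" "\<exists>a\<in>A. \<exists>w\<in>W. E a w"
    and Wx: "\<And>w z. w \<in> W \<Longrightarrow> z \<in> set xs \<Longrightarrow> E w z \<Longrightarrow> lo w \<and> (z = hd xs \<or> z = last xs)"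
      "\<exists>w\<in>W. E w (hd xs)" "\<exists>w\<in>W. E w (last xs)"
    and c: "i1 < i2" "i2 < length xs" "even i1" "odd i2" "\<exists>a\<in>A. E a (xs ! i1)" "\<exists>a\<in>A. E a (xs ! i2)"
  shows False
proof -
  define D where "D i = (\<exists>a\<in>A. E a (xs ! i))" for i
  \<comment> \<open>\<open>lp i\<close> says that the \<open>i\<close>-th path vertex is low: low
    and high alternate, except that a contact is always low.\<close>
  define lp where "lp = rec_nat (D 0) (\<lambda>i l. D (Suc i) \<or> \<not> l)"
  have lp0: "lp 0 = D 0" and lpS: "lp (Suc i) = (D (Suc i) \<or> \<not> lp i)" for i by (simp_all add: lp_def)
  \<comment> \<open>The index of the class, raised at each low-low edge of the path. It starts at 1
    if the first vertex is a contact, since the edge from \<open>W\<close> to it is then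
    low-low.\<close>
  define pc where "pc = rec_nat (if D 0 then 1 else 0 :: nat) (\<lambda>i r. r + (if lp i \<and> D (Suc i) then 1 else 0))"
  have pc0: "pc 0 = (if D 0 then 1 else 0)" and pcS: "pc (Suc i) = pc i + (if lp i \<and> D (Suc i) then 1 else 0)" for i
    by (simp_all add: pc_def)
  have D_lp: "D i \<Longrightarrow> lp i" for i by (cases i) (auto simp: lp0 lpS)
  \<comment> \<open>Without cuts \<open>lp\<close> would follow the parity of \<open>i\<close>; each
    cut shifts the alternation by one.\<close>
  have par: "lp i \<longleftrightarrow> even (Suc (i + pc i))" for i
    by (induction i) (auto simp: lp0 lpS pc0 pcS)
  have mono: "i \<le> j \<Longrightarrow> pc i \<le> pc j" for i j
    by (induction j rule: dec_induct) (auto simp: pcS)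
  define l where "l = length xs - 1"
  have len: "length xs = Suc l" "odd l" using c xs(3) by (auto simp: l_def)
  \<comment> \<open>If the last vertex is high, it must share the class of \<open>W\<close>, so
    \<open>pc l\<close> has to vanish modulo \<open>m\<close>. If it is low, its edge back to
    \<open>W\<close> is one more step between classes.\<close>
  define m where "m = pc l + (if lp l then 1 else 0)"
  have om: "odd m" using par[of l] len by (auto simp: m_def)
  have lpl: "lp l \<longleftrightarrow> even (pc l)" using par[of l] len by simp
  \<comment> \<open>Both contacts are low, so \<open>pc\<close> is odd at the even position
    \<open>i1\<close> and even at the later odd position \<open>i2\<close>. It thus reaches 2, and
    the rim has at least three classes.\<close>
  have "D i1" "D i2" using c by (auto simp: D_def)
  then have "odd (pc i1)" "even (pc i2)" "pc i1 \<le> pc i2" "pc i2 \<le> pc l"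
    using D_lp par[of i1] par[of i2] c mono len by auto
  then have "pc i1 \<noteq> pc i2" "pc i1 \<noteq> 0" by (metis, metis even_zero)
  then have p2: "2 \<le> pc l" using \<open>pc i1 \<le> pc i2\<close> \<open>pc i2 \<le> pc l\<close> by linarith
  then have m3: "3 \<le> m" using om unfolding m_def lpl by (cases "pc l = 2") auto
  have pm: "i \<le> l \<Longrightarrow> pc i \<le> m" for i using mono[of i l] by (simp add: m_def)
  define Y where "Y = A \<union> W \<union> set xs"
  \<comment> \<open>The hub is the class \<open>None\<close>, and \<open>W\<close> lies in class
    \<open>Some 0\<close>; counting modulo \<open>m\<close> closes the rim there.\<close>
  define \<pi> where "\<pi> v = (if v \<in> A then None else if v \<in> W then Some 0 else Some (pc (pos xs v) mod m))" for v
  define low where "low v = (if v \<in> A then la v else if v \<in> W then lo v else lp (pos xs v))" for v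
  have d: "distinct xs" using xs(1) by (rule ipath_distinct)
  have piA: "v \<in> A \<Longrightarrow> \<pi> v = None" "v \<in> A \<Longrightarrow> low v = la v" for v by (simp_all add: \<pi>_def low_def)
  have piW: "v \<in> W \<Longrightarrow> \<pi> v = Some 0" "v \<in> W \<Longrightarrow> low v = lo v" for v using dis by (auto simp: \<pi>_def low_def)
  have pix: "i < length xs \<Longrightarrow> \<pi> (xs ! i) = Some (pc i mod m)" "i < length xs \<Longrightarrow> low (xs ! i) = lp i" for i 
  proof -
    assume i: "i < length xs"
    then have "xs ! i \<notin> A" "xs ! i \<notin> W" using dis nth_mem by blast+
    then show "\<pi> (xs ! i) = Some (pc i mod m)" "low (xs ! i) = lp i" using pos_nth[OF d i] by (simp_all add: \<pi>_def low_def)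
  qed
  have hd: "hd xs = xs ! 0" "last xs = xs ! l" using len by (auto simp: hd_conv_nth last_conv_nth l_def)
  have xsE: "z \<in> set xs \<Longrightarrow> \<exists>i\<le>l. z = xs ! i" for z using len by (metis in_set_conv_nth less_Suc_eq_le)
  define ok where "ok u v = ((low u \<or> low v) \<and> (low u \<and> low v \<longleftrightarrow> \<pi> u \<noteq> \<pi> v))" for u v
  have ok_sym: "ok u v \<Longrightarrow> ok v u" for u v by (auto simp: ok_def)
  have okAA: "ok u v" if "u \<in> A" "v \<in> A" "E u v" for u v
    using that A(2) by (auto simp: ok_def piA bip_def)
  have okWW: "ok u v" if "u \<in> W" "v \<in> W" "E u v" for u v
    using that W(2) by (auto simp: ok_def piW bip_def)
  have okAW: "ok u v" if "u \<in> A" "v \<in> W" "E u v" for u v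
    using that AW(1)[OF that] by (auto simp: ok_def piW piA)
  have okAx: "ok u v" if as: "u \<in> A" "v \<in> set xs" "E u v" for u v
  proof -
    obtain i where i: "i \<le> l" "v = xs ! i" using xsE[OF as(2)] by blast
    then have "D i" using that by (auto simp: D_def)
    then show ?thesis using Ax[OF that] that D_lp i len by (auto simp: ok_def pix piA)
  qed
  have okWx: "ok u v" if "u \<in> W" "v \<in> set xs" "E u v" for u v
  proof -
    have u: "lo u" "v = xs ! 0 \<or> v = xs ! l" using Wx(1)[OF that] hd by auto
    have "ok u (xs ! 0)" using u len that m3 by (auto simp: ok_def pix piW pc0 lp0)
    moreover have "ok u (xs ! l)"
    proof (cases "lp l")
      case True
      then have "pc l < m" "pc l \<noteq> 0" using p2 by (auto simp: m_def)
      then show ?thesis using True u that len by (auto simp: ok_def pix piW)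
    next
      case False
      then show ?thesis using u that len by (auto simp: ok_def pix piW m_def)
    qed
    ultimately show ?thesis using u by auto
  qed
  have ok1: "ok (xs ! i) (xs ! Suc i)" if "Suc i \<le> l" for i
  proof (cases "lp i \<and> D (Suc i)")
    case True
    have "pc i mod m \<noteq> Suc (pc i) mod m" using m3
      by (simp add: mod_Suc)
    then show ?thesis using True that len by (auto simp: ok_def pix pcS lpS)
  next
    case False
    then show ?thesis using that len D_lp by (auto simp: ok_def pix pcS lpS)
  qed
  have okxx: "ok u v" if as: "u \<in> set xs" "v \<in> set xs" "E u v" for u v
  proof -
    obtain i j where i: "i \<le> l" "u = xs ! i" "j \<le> l" "v = xs ! j" using xsE[OF as(1)] xsE[OF as(2)] by blast
    then have "i = Suc j \<or> j = Suc i" using ipath_nth[OF xs(1), of i j] that len by simp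
    then show ?thesis using ok1[of i] ok1[of j] ok_sym i by auto
  qed
  have ok: "ok u v" if "u \<in> Y" "v \<in> Y" "E u v" for u v
    using that okAA okWW okAW okAx okWx okxx ok_sym symE unfolding Y_def by (smt (verit) UnE)
  have cn: "con {u \<in> Y. \<pi> u = \<pi> v}" if v: "v \<in> Y" for v
  proof -
    have clA: "{u \<in> Y. \<pi> u = None} = A"
      by (auto simp: Y_def \<pi>_def split: if_splits)
    \<comment> \<open>This class is \<open>W\<close> with the path before the first cut and, if the
      last vertex is high, the path after the last cut. The rank counts the steps to the
      corresponding end of the path, where \<open>W\<close> is attached.\<close>
    have cl0: "con {u \<in> Y. \<pi> u = Some 0}"
    proof (rule con_rank[where A = W and f = "\<lambda>v. if pc (pos xs v) = 0 then pos xs v else l - pos xs v"])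
      show "W \<subseteq> {u \<in> Y. \<pi> u = Some 0}" by (auto simp: Y_def piW)
      fix v assume v: "v \<in> {u \<in> Y. \<pi> u = Some 0}" "v \<notin> W"
      then have "v \<in> set xs" using piA by (auto simp: Y_def)
      then obtain i where i: "i \<le> l" "v = xs ! i" using xsE by blast
      then have il: "i < length xs" using len by simp
      have "pc i mod m = 0" using v i pix il by auto
      then have "pc i = 0 \<or> pc i = m" using pm[OF i(1)] by (metis le_neq_implies_less mod_less)
      then show "\<exists>u\<in>{u \<in> Y. \<pi> u = Some 0}. E v u \<and> (u \<in> W \<or>
          (if pc (pos xs u) = 0 then pos xs u else l - pos xs u) < (if pc (pos xs v) = 0 then pos xs v else l - pos xs v))"
      proof
        assume p0: "pc i = 0"
        show ?thesis
        proof (cases i)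
          case 0
          then show ?thesis using Wx(2) i hd symE piW by (auto simp: Y_def)
        next
          case (Suc j)
          then have "pc j = 0" using p0 by (simp add: pcS)
          moreover have "E v (xs ! j)" "j < length xs" using Suc i ipath_nth[OF xs(1)] il by auto
          ultimately show ?thesis using Suc i il p0 pix pos_nth[OF d]
            by (intro bexI[of _ "xs ! j"]) (auto simp: Y_def)
        qed
      next
        assume p0: "pc i = m"
        show ?thesis
        proof (cases "i = l")
          case True
          then show ?thesis using Wx(3) i hd symE piW by (auto simp: Y_def)
        next
          case False
          then have sl: "Suc i \<le> l" using i by simp
          then have "pc (Suc i) = m" using pm[OF sl] mono[of i "Suc i"] p0 by simp
          moreover have "E v (xs ! Suc i)" "Suc i < length xs" using sl i ipath_nth[OF xs(1)] len by auto
          ultimately show ?thesis using i il p0 pix pos_nth[OF d] m3 sl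
            by (intro bexI[of _ "xs ! Suc i"]) (auto simp: Y_def)
        qed
      qed
    qed (use W in auto)
    have clk: "con {u \<in> Y. \<pi> u = Some k}" if k: "k \<noteq> 0" "v \<in> Y" "\<pi> v = Some k" for v k
    proof -
      have vx: "v \<in> set xs" using k piA piW by (auto simp: Y_def)
      have xk: "i \<le> l \<Longrightarrow> \<pi> (xs ! i) = Some k \<longleftrightarrow> pc i = k" for i
        using pix[of i] len pm[of i] k(1) m3 
      proof -
        assume i: "i \<le> l"
        obtain j where j: "j \<le> l" "v = xs ! j" using xsE vx by blast
        have km: "k < m" using k(3) j pix(1)[of j] len m3 by auto
        show ?thesis using pix(1)[of i] i len pm[OF i] k(1) km by (cases "pc i = m") auto
      qed
      obtain j where j: "j \<le> l" "v = xs ! j" using xsE vx by blast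
      then have pj: "pc j = k" using xk k by simp
      define i0 where "i0 = (LEAST i. pc i = k)"
      have i0: "pc i0 = k" "i0 \<le> j" "\<And>i. pc i = k \<Longrightarrow> i0 \<le> i"
        using pj unfolding i0_def by (auto intro: LeastI Least_le)
      show ?thesis
      proof (rule con_rank[where A = "{xs ! i0}" and f = "pos xs"])
        show "{xs ! i0} \<subseteq> {u \<in> Y. \<pi> u = Some k}" using i0 j xk[of i0] len by (auto simp: Y_def)
        fix u assume u: "u \<in> {u \<in> Y. \<pi> u = Some k}" "u \<notin> {xs ! i0}"
        then have "u \<in> set xs" using piA piW k(1) by (auto simp: Y_def)
        then obtain i where i: "i \<le> l" "u = xs ! i" using xsE by blast
        then have "pc i = k" using xk u by auto
        then have "i0 < i" using i0(3)[of i] u i by (cases "i0 = i") auto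
        then obtain i' where i': "i = Suc i'" "i0 \<le> i'" by (cases i) auto
        then have "pc i' = k" using mono[OF i'(2)] mono[of i' i] i0(1) \<open>pc i = k\<close> by simp
        moreover have "E u (xs ! i')" "i' < length xs" using i i' ipath_nth[OF xs(1)] len by auto
        ultimately show "\<exists>w\<in>{u \<in> Y. \<pi> u = Some k}. E u w \<and> (w \<in> {xs ! i0} \<or> pos xs w < pos xs u)"
          using i i' xk[of i'] len pos_nth[OF d] by (intro bexI[of _ "xs ! i'"]) (auto simp: Y_def)
      qed auto
    qed
    show ?thesis
    proof (cases "\<pi> v")
      case None then show ?thesis using clA A by simp
    next
      case (Some k)
      then show ?thesis using cl0 clk[of k v] v by (cases "k = 0") auto
    qed
  qed
  have YV: "Y \<subseteq> V" using A W xs by (auto simp: Y_def)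
  have "\<exists>sel. qsel Y low \<pi> None sel"
    by (rule quotient_selection[OF YV]) (erule (2) ok[unfolded ok_def], erule cn)
  then obtain sel where qs: "qsel Y low \<pi> None sel" by blast
  note sel = qselD[OF qs]
  \<comment> \<open>The class \<open>k\<close> is joined to the hub by a low-low edge, which is the
    triangle condition of \<open>qsel\<close>.\<close>
  define tch where "tch k = (\<exists>a b. a \<in> A \<and> b \<in> Y \<and> low a \<and> low b \<and> E a b \<and> \<pi> b = Some (k mod m))" for k
  have sel': "sel (Some (k mod m)) \<noteq> sel (Some (k' mod m))" if as: "u \<in> Y" "v \<in> Y" "low u" "low v" "E u v"
    "\<pi> u = Some (k mod m)" "\<pi> v = Some (k' mod m)" "tch k" "tch k'" for u v k k'
  proof -
    obtain a b where ab: "a \<in> A" "b \<in> Y" "low a" "low b" "E a b" "\<pi> b = Some (k mod m)" using as(8) unfolding tch_def by blast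
    obtain a' b' where ab': "a' \<in> A" "b' \<in> Y" "low a'" "low b'" "E a' b'" "\<pi> b' = Some (k' mod m)" using as(9) unfolding tch_def by blast
    have "sel (\<pi> u) \<noteq> sel (\<pi> v)"
      by (rule sel[of u v a b a' b']) (use that ab ab' piA in \<open>auto simp: Y_def\<close>)
    then show ?thesis using that by simp
  qed
  have t0: "tch 0"
  proof -
    obtain a w where "a \<in> A" "w \<in> W" "E a w" using AW(2) by blast
    then show ?thesis unfolding tch_def using AW(1)[of a w] piA piW by (intro exI[of _ a] exI[of _ w]) (auto simp: Y_def)
  qed
  have tD: "tch (pc i)" if D: "D i" "i \<le> l" for i
  proof -
    obtain a where "a \<in> A" "E a (xs ! i)" using D by (auto simp: D_def)
    then show ?thesis unfolding tch_def using D len Ax[of a "xs ! i"] piA pix D_lp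
      by (intro exI[of _ a] exI[of _ "xs ! i"]) (auto simp: Y_def)
  qed
  \<comment> \<open>\<open>sel\<close> changes at every cut, so on class \<open>k\<close> it depends
    on the parity of \<open>k\<close>. Closing the rim identifies class \<open>m\<close> with class
    0 although \<open>m\<close> is odd.\<close>
  have main: "tch (pc i) \<and> (\<forall>k\<le>pc i. sel (Some (k mod m)) = (sel (Some 0) = even k))" if "i \<le> l" for i
    using that
  proof (induction i)
    case 0
    show ?case
    proof (cases "D 0")
      case True
      obtain w where w: "w \<in> W" "E w (xs ! 0)" using Wx(2) hd by auto
      have "sel (Some (0 mod m)) \<noteq> sel (Some (1 mod m))"
        by (rule sel'[of w "xs ! 0"])
          (use w Wx(1)[of w "xs ! 0"] True len t0 tD[of 0] piW pix in \<open>auto simp: Y_def pc0 lp0\<close>)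
      then show ?thesis using True tD[of 0] by (auto simp: pc0 le_Suc_eq)
    next
      case False then show ?thesis using t0 by (simp add: pc0)
    qed
  next
    case (Suc i)
    then have il: "i \<le> l" "Suc i < length xs" using len by auto
    note IH = Suc.IH[OF il(1)]
    show ?case
    proof (cases "lp i \<and> D (Suc i)")
      case True
      have pS: "pc (Suc i) = Suc (pc i)" using True by (simp add: pcS)
      have t: "tch (Suc (pc i))" using tD[of "Suc i"] True Suc.prems pS by simp
      have "sel (Some (pc i mod m)) \<noteq> sel (Some (Suc (pc i) mod m))"
        by (rule sel'[of "xs ! i" "xs ! Suc i"])
          (use True il t IH pix[of i] pix[of "Suc i"] pS ipath_nth[OF xs(1)] D_lp in \<open>auto simp: Y_def lpS\<close>)
      then show ?thesis using IH t unfolding pS by (auto simp: le_Suc_eq)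
    next
      case False then show ?thesis using IH by (auto simp: pcS)
    qed
  qed
  have "sel (Some (m mod m)) = (sel (Some 0) = even m)"
  proof (cases "lp l")
    case False
    then have "m = pc l" by (simp add: m_def)
    then show ?thesis using main[of l] by (metis le_refl)
  next
    case True
    then have mm: "m = Suc (pc l)" by (simp add: m_def)
    obtain w where w: "w \<in> W" "E w (xs ! l)" using Wx(3) hd by auto
    have "E (xs ! l) w" using w symE by blast
    moreover have "lo w" using Wx(1)[of w "xs ! l"] w len by simp
    moreover have "\<pi> w = Some (m mod m)" using piW w by simp
    moreover have "tch m" using t0 by (simp add: tch_def)
    moreover have "tch (pc l)" using main[of l] by simp
    moreover have "w \<in> Y" "xs ! l \<in> Y" using w len by (auto simp: Y_def)
    moreover have "low (xs ! l)" "low w" "\<pi> (xs ! l) = Some (pc l mod m)"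
      using pix[of l] piW[OF w(1)] True len \<open>lo w\<close> by simp_all
    ultimately have "sel (Some (pc l mod m)) \<noteq> sel (Some (m mod m))" by (rule_tac sel'[of "xs ! l" w])
    then show ?thesis using main[of l] unfolding mm by (metis even_Suc le_refl)
  qed
  then show False using om by simp
qed

text \<open>Cut the cycle at the first contact, which then plays the part of \<open>W\<close> as a
  singleton. On the remaining path the other two contacts get an even and a later odd
  position.\<close>

lemma no_odd_hub_cycle_contacts:
  assumes A: "con A" "bip A la" "A \<subseteq> V" and cy: "icyc q xs" "set xs \<subseteq> V" "q \<in> V"
    and dis: "A \<inter> set xs = {}" "q \<notin> A"
    and Ax: "\<And>a z. a \<in> A \<Longrightarrow> z \<in> insert q (set xs) \<Longrightarrow> E a z \<Longrightarrow> la a"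
    and c: "c1 < c2" "c2 < c3" "c3 < length xs" "odd (c2 - c1)" "odd (c3 - c2)"
    and t: "\<exists>a\<in>A. E a (xs ! c1)" "\<exists>a\<in>A. E a (xs ! c2)" "\<exists>a\<in>A. E a (xs ! c3)"
  shows False
proof -
  define r where "r = xs ! c1"
  define ys where "ys = drop (Suc c1) xs @ q # take c1 xs"
  have x: "xs = take c1 xs @ r # drop (Suc c1) xs" using c id_take_nth_drop[of c1 xs] by (simp add: r_def)
  have ry: "icyc r ys" unfolding ys_def using icyc_rotate cy(1) x by metis
  have sy: "insert r (set ys) = insert q (set xs)" using arg_cong[OF x, of set] by (auto simp: ys_def)
  have yn: "ys ! (i - Suc c1) = xs ! i" if "c1 < i" "i < length xs" for i
  proof -
    have "i - Suc c1 < length xs - Suc c1" using that by linarith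
    then show ?thesis using that by (simp add: ys_def nth_append)
  qed
  have l: "length ys = length xs" using c by (simp add: ys_def)
  have rx: "r \<in> set xs" using c by (simp add: r_def)
  show False
  proof (rule no_odd_hub_path_contacts[OF A(1,2,3), of "{r}" "\<lambda>_. True" ys "c2 - Suc c1" "c3 - Suc c1"])
    show "ipath ys" "even (length ys)" using ry by (auto simp: icyc_def)
    show "A \<inter> {r} = {}" "A \<inter> set ys = {}" using rx dis sy by auto
    show "{r} \<inter> set ys = {}" using ry by (auto simp: icyc_def)
    show "{r} \<subseteq> V" "set ys \<subseteq> V" using cy rx sy by auto
    show "la a" if "a \<in> A" "z \<in> set ys" "E a z" for a z using Ax[of a z] that sy by blast
    show "la a \<and> True" if "a \<in> A" "w \<in> {r}" "E a w" for a w using Ax[of a w] that sy by blast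
    show "\<exists>a\<in>A. \<exists>w\<in>{r}. E a w" using t by (simp add: r_def)
    show "True \<and> (z = hd ys \<or> z = last ys)" if "w \<in> {r}" "z \<in> set ys" "E w z" for w z
      using ry that by (auto simp: icyc_def)
    show "\<exists>w\<in>{r}. E w (hd ys)" "\<exists>w\<in>{r}. E w (last ys)" using ry by (auto simp: icyc_def)
    show "\<exists>a\<in>A. E a (ys ! (c2 - Suc c1))" "\<exists>a\<in>A. E a (ys ! (c3 - Suc c1))" using t yn c by auto
    show "c2 - Suc c1 < c3 - Suc c1" "c3 - Suc c1 < length ys" "even (c2 - Suc c1)" "odd (c3 - Suc c1)" using c l by auto
  qed (auto simp: con_sing bip_def irrE)
qed

text \<open>Contract the hub and keep every vertex of \<open>X\<close> as a class of its own. Each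
  edge in \<open>X\<close> forms a triangle with the hub, so \<open>sel\<close> is a
  bipartition.\<close>

lemma hub_neighbours_bip:
  assumes H: "con H" "bip H l" "H \<subseteq> V" and X: "X \<subseteq> V" "X \<inter> H = {}" "\<And>x. x \<in> X \<Longrightarrow> \<exists>h\<in>H. E h x"
    and low: "\<And>x h. x \<in> X \<Longrightarrow> h \<in> H \<Longrightarrow> E h x \<Longrightarrow> l h"
  shows "\<exists>f. bip X f"
proof -
  define Y where "Y = H \<union> X"
  define \<pi> where "\<pi> v = (if v \<in> H then None else Some v)" for v
  define lw where "lw v = (if v \<in> H then l v else True)" for v
  have YV: "Y \<subseteq> V" using H X by (auto simp: Y_def)
  have ok: "(lw u \<or> lw v) \<and> (lw u \<and> lw v \<longleftrightarrow> \<pi> u \<noteq> \<pi> v)" if as: "u \<in> Y" "v \<in> Y" "E u v" for u v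
  proof -
    have ne: "u \<noteq> v" using that(3) irrE by blast
    have e: "E v u" using symE[OF that(3)] .
    consider "u \<in> H" "v \<in> H" | "u \<in> H" "v \<in> X" "v \<notin> H" | "u \<in> X" "v \<in> H" "u \<notin> H" | "u \<notin> H" "v \<notin> H"
      using as unfolding Y_def by blast
    then show ?thesis
    proof cases
      case 1 then have "l u \<noteq> l v" using H(2) that(3) unfolding bip_def by blast
      then show ?thesis using 1 by (auto simp: lw_def \<pi>_def)
    next
      case 2 then show ?thesis using low[OF 2(2,1) that(3)] by (simp add: lw_def \<pi>_def)
    next
      case 3 then show ?thesis using low[OF 3(1,2) e] by (simp add: lw_def \<pi>_def)
    next
      case 4 then show ?thesis using ne by (simp add: lw_def \<pi>_def)
    qed
  qed
  have cn: "con {u \<in> Y. \<pi> u = \<pi> v}" if "v \<in> Y" for v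
  proof (cases "v \<in> H")
    case True
    then have "{u \<in> Y. \<pi> u = \<pi> v} = H" by (auto simp: Y_def \<pi>_def)
    then show ?thesis using H by simp
  next
    case False
    then have "{u \<in> Y. \<pi> u = \<pi> v} = {v}" using that by (auto simp: Y_def \<pi>_def)
    then show ?thesis using con_sing by simp
  qed
  have "\<exists>sel. qsel Y lw \<pi> None sel"
    by (rule quotient_selection[OF YV]) (erule (2) ok, erule cn)
  then obtain sel where qs: "qsel Y lw \<pi> None sel" by blast
  note sel = qselD[OF qs]
  have "bip X (\<lambda>x. sel (Some x))" unfolding bip_def
  proof (intro ballI impI)
    fix u v assume uv: "u \<in> X" "v \<in> X" "E u v"
    obtain a where a: "a \<in> H" "E a u" using X uv by blast
    obtain b where b: "b \<in> H" "E b v" using X uv by blast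
    have "u \<notin> H" "v \<notin> H" using X uv by blast+
    then show "sel (Some u) \<noteq> sel (Some v)"
      using sel[of u v a u b v] uv a b low by (auto simp: Y_def \<pi>_def lw_def)
  qed
  then show ?thesis by blast
qed

text \<open>The previous lemma is applied twice. \<open>P\<close> is bipartite, and each of its two
  sides is stable, so adding one side to \<open>H\<close> gives a larger bipartite hub in which the
  new vertices are low and the roles inside \<open>H\<close> are exchanged. The vertices of
  \<open>X\<close> below that side are then bipartite, which makes 2 + 2 colours.\<close>

lemma col_two_below_hub:
  assumes H: "con H" "bip H l" "H \<subseteq> V" and P: "P \<subseteq> V" "P \<inter> H = {}" "\<And>p. p \<in> P \<Longrightarrow> \<exists>h\<in>H. E h p"
    and low: "\<And>p h. p \<in> P \<Longrightarrow> h \<in> H \<Longrightarrow> E h p \<Longrightarrow> l h"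
    and X: "X \<subseteq> V" "anti X H" "X \<inter> H = {}" "X \<inter> P = {}" "\<And>x. x \<in> X \<Longrightarrow> \<exists>p\<in>P. E p x"
  shows "col X 4"
proof -
  have "\<exists>f. bip P f" by (rule hub_neighbours_bip[OF H P(1,2)]) (erule P(3), erule (2) low)
  then obtain f where f: "bip P f" by blast
  have half: "col {x \<in> X. \<exists>p\<in>P. f p = b \<and> E p x} 2" for b
  proof -
    let ?P = "{p \<in> P. f p = b}" and ?X = "{x \<in> X. \<exists>p\<in>P. f p = b \<and> E p x}"
    have st: "\<not> E p p'" if "p \<in> ?P" "p' \<in> ?P" for p p' using f that by (auto simp: bip_def)
    have c: "con (H \<union> ?P)"
    proof (rule con_rank[of H _ "\<lambda>_. 0"])
      fix v assume "v \<in> H \<union> ?P" "v \<notin> H"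
      then obtain h where "h \<in> H" "E h v" using P by blast
      then show "\<exists>u\<in>H \<union> ?P. E v u \<and> (u \<in> H \<or> (0::nat) < 0)" using symE by blast
    qed (use H in auto)
    define l' where "l' v = (if v \<in> H then \<not> l v else True)" for v
    have b: "bip (H \<union> ?P) l'" unfolding bip_def
    proof (intro ballI impI)
      fix u v assume uv: "u \<in> H \<union> ?P" "v \<in> H \<union> ?P" "E u v"
      have e: "E v u" using symE[OF uv(3)] .
      consider "u \<in> H" "v \<in> H" | "u \<in> H" "v \<in> P" "v \<notin> H" | "u \<in> P" "v \<in> H" "u \<notin> H"
        using st[of u v] uv by blast
      then show "l' u \<noteq> l' v"
      proof cases
        case 1 then have "l u \<noteq> l v" using H(2) uv(3) unfolding bip_def by blast
        then show ?thesis using 1 by (simp add: l'_def)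
      next
        case 2 then show ?thesis using low[OF 2(2,1) uv(3)] by (simp add: l'_def)
      next
        case 3 then show ?thesis using low[OF 3(1,2) e] by (simp add: l'_def)
      qed
    qed
    have "\<exists>g. bip ?X g"
    proof (rule hub_neighbours_bip[OF c b])
      show "H \<union> ?P \<subseteq> V" "?X \<subseteq> V" using H P X by auto
      show "?X \<inter> (H \<union> ?P) = {}" using X by auto
      show "\<exists>h\<in>H \<union> ?P. E h x" if "x \<in> ?X" for x using that by blast
      show "l' h" if "x \<in> ?X" "h \<in> H \<union> ?P" "E h x" for x h
        using that X(2) symE[OF that(3)] unfolding l'_def anti_def by auto
    qed
    then show ?thesis using col_bip by blast
  qed
  have "X \<subseteq> {x \<in> X. \<exists>p\<in>P. f p = True \<and> E p x} \<union> {x \<in> X. \<exists>p\<in>P. f p = False \<and> E p x}" using X(5) by blast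
  then show ?thesis using col_mono[OF col_Un[OF half[of True] half[of False]], of X 4] by simp
qed

end

lemma odd_gap: "i < j \<Longrightarrow> even i \<noteq> even j \<Longrightarrow> odd (j - i)" for i j :: nat
  by (simp add: even_diff_nat)

locale hgraph = tgraph +
  assumes og: "\<And>n c. odd n \<Longrightarrow> clw n c \<Longrightarrow> 11 \<le> n"
begin

lemma no_odd_walk:
  assumes "odd n" "n < 11" "\<And>i. i < n \<Longrightarrow> E (c i) (c (Suc i))" "c n = c 0"
  shows False
proof -
  have "clw n c" using assms(3,4) by (simp add: clw_def)
  then show False using og[OF assms(1)] assms(2) by fastforce
qed

lemma no_tri: assumes "E a b" "E b c" "E c a" shows False
proof (rule no_odd_walk[of 3 "\<lambda>i. [a, b, c, a] ! i"])
  fix i :: nat assume "i < 3"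
  then have "i = 0 \<or> i = 1 \<or> i = 2" by linarith
  then show "E ([a, b, c, a] ! i) ([a, b, c, a] ! Suc i)" using assms by auto
qed auto

lemma no_pent: assumes "E a b" "E b c" "E c d" "E d e" "E e a" shows False
proof (rule no_odd_walk[of 5 "\<lambda>i. [a, b, c, d, e, a] ! i"])
  fix i :: nat assume "i < 5"
  then have "i = 0 \<or> i = 1 \<or> i = 2 \<or> i = 3 \<or> i = 4" by linarith
  then show "E ([a, b, c, d, e, a] ! i) ([a, b, c, d, e, a] ! Suc i)" using assms by auto
qed auto

section \<open>Vertices at distance two from odd cycles and thetas\<close>

text \<open>The vertices \<open>x\<close> whose parent \<open>pf x\<close> has only contacts of one parity need 4 colours per parity. Otherwise
  the contacts of \<open>pf x\<close> switch parity exactly once, between \<open>s x\<close> and \<open>e x\<close>. For a fixed parity of the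
  first contact, adjacent vertices have disjoint intervals and vertices with a common neighbour have
  intersecting ones, so 2 colours suffice: a vertex is coloured by whether some adjacent interval lies to its right.\<close>
lemma col_below_cycle_avoiding:
  assumes cy: "icyc q xs" and cV: "set xs \<subseteq> V" "q \<in> V" and X: "X \<subseteq> V" "anti X (insert q (set xs))" "X \<inter> insert q (set xs) = {}"
    and P: "\<And>x. x \<in> X \<Longrightarrow> \<exists>p. p \<notin> insert q (set xs) \<and> E p x \<and> \<not> E p q \<and> (\<exists>z\<in>set xs. E p z)"
  shows "col X 12"
proof -
  have xs: "ipath xs" "xs \<noteq> []" "q \<notin> set xs" using cy by (auto simp: icyc_def)
  have d: "distinct xs" using xs(1) by (rule ipath_distinct)
  obtain pf where pf: "\<And>x. x \<in> X \<Longrightarrow> pf x \<notin> insert q (set xs) \<and> E (pf x) x \<and> (\<exists>z\<in>set xs. E (pf x) z)"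
    using P by metis
  have pC: "x \<in> X \<Longrightarrow> pf x \<notin> set xs" and pq: "x \<in> X \<Longrightarrow> pf x \<noteq> q" and pE: "x \<in> X \<Longrightarrow> E (pf x) x" for x using pf by auto
  have pX: "pf x \<notin> X" if as: "x \<in> X" for x
  proof
    assume "pf x \<in> X"
    moreover obtain z where "z \<in> insert q (set xs)" "E (pf x) z" using pf[OF as] by auto
    ultimately show False using X(2) unfolding anti_def by blast
  qed
  have pV: "x \<in> X \<Longrightarrow> pf x \<in> V" for x using pE inV by blast
  have xa: "\<not> E x (xs ! i)" "\<not> E (xs ! i) x" "x \<noteq> xs ! i" if "x \<in> X" "i < length xs" for x i
    using that X(2,3) symE nth_mem[OF that(2)] unfolding anti_def by blast+
  define C where "C x = {i. i < length xs \<and> E (pf x) (xs ! i)}" for x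
  have finC: "finite (C x)" for x by (simp add: C_def)
  have Cne: "C x \<noteq> {}" if x: "x \<in> X" for x
  proof -
    obtain z where "z \<in> set xs" "E (pf x) z" using pf[OF x] by auto
    then show ?thesis by (auto simp: C_def in_set_conv_nth)
  qed
  define Xu where "Xu e = {x \<in> X. \<forall>i\<in>C x. even i = e}" for e
  have cu: "col (Xu e) 4" for e
  proof (rule col_two_below_hub[where H = "set xs" and l = "\<lambda>v. even (pos xs v) = e" and P = "pf ` Xu e"])
    show "con (set xs)" using xs ipath_con by blast
    show "bip (set xs) (\<lambda>v. even (pos xs v) = e)" using xs by (rule_tac ipath_bip)
    show "pf ` Xu e \<subseteq> V" using pV by (auto simp: Xu_def)
    show "pf ` Xu e \<inter> set xs = {}" using pC by (auto simp: Xu_def)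
    show "\<exists>h\<in>set xs. E h p" if p: "p \<in> pf ` Xu e" for p
    proof -
      obtain x where x: "x \<in> Xu e" "p = pf x" using p by blast
      then obtain i where "i \<in> C x" using Cne[of x] by (auto simp: Xu_def)
      then have "xs ! i \<in> set xs" "E (xs ! i) p" using x symE by (auto simp: C_def)
      then show ?thesis by blast
    qed
    show "even (pos xs h) = e" if p: "p \<in> pf ` Xu e" "h \<in> set xs" "E h p" for p h
    proof -
      obtain x where x: "x \<in> Xu e" "p = pf x" using p by blast
      have "pos xs h \<in> C x" using pos_in[OF d p(2)] p x symE by (auto simp: C_def)
      then show ?thesis using x by (auto simp: Xu_def)
    qed
    show "Xu e \<subseteq> V" using X by (auto simp: Xu_def)
    show "anti (Xu e) (set xs)" using X by (auto simp: Xu_def anti_def)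
    show "Xu e \<inter> set xs = {}" using X by (auto simp: Xu_def)
    show "Xu e \<inter> pf ` Xu e = {}" using pX by (auto simp: Xu_def)
    show "\<exists>p\<in>pf ` Xu e. E p x" if "x \<in> Xu e" for x using that pE by (auto simp: Xu_def)
  qed (use cV in auto)
  define Xm where "Xm L = {x \<in> X. (even (Min (C x)) = L) \<and> (\<exists>i\<in>C x. even i \<noteq> L)}" for L
  define s where "s x = Max {i \<in> C x. even i = even (Min (C x))}" for x
  define e where "e x = Min {i \<in> C x. even i \<noteq> even (Min (C x))}" for x
  \<comment> \<open>If the contacts of a parent switched parity twice, the parent alone would be a
    hub with three contacts at odd distances.\<close>
  have tc1: False if "x \<in> X" "i \<in> C x" "j \<in> C x" "k \<in> C x" "i < j" "j < k" "even i \<noteq> even j" "even j \<noteq> even k" for x i j k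
  proof (rule no_odd_hub_cycle_contacts[of "{pf x}" "\<lambda>_. True" q xs i j k])
    show "odd (j - i)" "odd (k - j)" using that odd_gap by auto
  qed (use that cy cV pC pq pV irrE in \<open>auto simp: con_sing bip_def C_def\<close>)
  have mix: "s x \<in> C x" "even (s x) = L" "e x \<in> C x" "even (e x) \<noteq> L" "\<And>i. i \<in> C x \<Longrightarrow> even i = L \<Longrightarrow> i \<le> s x"
     "\<And>i. i \<in> C x \<Longrightarrow> even i \<noteq> L \<Longrightarrow> e x \<le> i" "s x < e x" "x \<in> X" if x: "x \<in> Xm L" for x L
  proof -
    let ?A = "{i \<in> C x. even i = even (Min (C x))}" and ?B = "{i \<in> C x. even i \<noteq> even (Min (C x))}"
    have L: "even (Min (C x)) = L" using x by (simp add: Xm_def)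
    have f: "finite ?A" "finite ?B" using finC by auto
    have mC: "Min (C x) \<in> C x" using Min_in[OF finC] Cne[of x] x by (auto simp: Xm_def)
    have ne: "?A \<noteq> {}" "?B \<noteq> {}" using mC x L by (auto simp: Xm_def)
    have "s x \<in> ?A" "e x \<in> ?B" unfolding s_def e_def using Max_in[OF f(1) ne(1)] Min_in[OF f(2) ne(2)] by auto
    then show 1: "s x \<in> C x" "even (s x) = L" "e x \<in> C x" "even (e x) \<noteq> L" using L by auto
    show "i \<le> s x" if "i \<in> C x" "even i = L" for i
      unfolding s_def by (rule Max_ge[OF f(1)]) (use that L in auto)
    show "e x \<le> i" if "i \<in> C x" "even i \<noteq> L" for i
      unfolding e_def by (rule Min_le[OF f(2)]) (use that L in auto)
    show xX: "x \<in> X" using x by (simp add: Xm_def)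
    have "Min (C x) \<le> e x" using Min_le[OF finC] 1 by blast
    moreover have "Min (C x) \<noteq> e x" using 1 L by auto
    ultimately have m: "Min (C x) < e x" by simp
    have "\<not> e x < s x" using tc1[OF xX mC 1(3,1) m] 1 L by blast
    moreover have "e x \<noteq> s x" using 1 by auto
    ultimately show "s x < e x" by simp
  qed
  have W: "e x \<le> s y \<or> e y \<le> s x" if x: "x \<in> Xm L" and y: "y \<in> Xm L" and xy: "E x y" for x y L
  proof (rule ccontr)
    assume n: "\<not> ?thesis"
    note mx = mix[OF x] and my = mix[OF y]
    define p p' where "p = pf x" and "p' = pf y"
    \<comment> \<open>If the intervals overlap, cutting the path after \<open>c\<close> puts the
      contacts of parity \<open>L\<close> of both parents before the cut and all others behind it.
      The classes \<open>{p, x, y}\<close>, \<open>{p'}\<close> and the two halves of the path are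
      then pairwise adjacent: a contracted complete graph on four vertices, whose hub
      \<open>p'\<close> sees a triangle.\<close>
    define c where "c = max (s x) (s y)"
    have c: "even c = L" "s x \<le> c" "s y \<le> c" "c < e x" "c < e y" using mx my n by (auto simp: c_def max_def)
    have el: "e x < length xs" "e y < length xs" "s x < length xs" "s y < length xs" using mx my by (auto simp: C_def)
    then have cl: "Suc c < length xs" using c by simp
    have pe: "E p x" "E p' y" using pE mx(8) my(8) by (auto simp: p_def p'_def)
    have yx: "E y x" using symE[OF xy] .
    have npy: "\<not> E p y" "\<not> E y p" using no_tri[OF pe(1) xy] symE by blast+
    have np'x: "\<not> E p' x" "\<not> E x p'" using no_tri[OF pe(2) yx] symE by blast+
    have ne: "p \<noteq> p'" "x \<noteq> y" "p \<noteq> x" "p \<noteq> y" "p' \<noteq> x" "p' \<noteq> y"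
      using npy pe xy irrE pX[OF mx(8)] pX[OF my(8)] mx(8) my(8) by (auto simp: p_def p'_def)
    have nx: "p \<notin> set xs" "p' \<notin> set xs" "x \<notin> set xs" "y \<notin> set xs" using pC mx(8) my(8) X(3) by (auto simp: p_def p'_def)
    define Y where "Y = {p, x, y, p'} \<union> set xs"
    define \<pi> :: "'a \<Rightarrow> nat" where "\<pi> v = (if v \<in> {p, x, y} then 0 else if v = p' then 1 else if pos xs v \<le> c then 2 else 3)" for v
    \<comment> \<open>The low vertices change parity at the cut, so that all contacts of
      \<open>p\<close> and \<open>p'\<close> and both ends of the cut edge are low. Making
      \<open>x\<close> high holds the class \<open>{p, x, y}\<close> together.\<close>
    define low where "low v = (if v = x then False else if v \<in> {p, y, p'} then True else (even (pos xs v) = L) = (pos xs v \<le> c))" for v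
    have v: "\<pi> p = 0" "\<pi> x = 0" "\<pi> y = 0" "\<pi> p' = 1" "low p" "\<not> low x" "low y" "low p'"
      using ne by (auto simp: \<pi>_def low_def)
    have vi: "\<pi> (xs ! i) = (if i \<le> c then 2 else 3)" "low (xs ! i) = ((even i = L) = (i \<le> c))" if i: "i < length xs" for i
    proof -
      have "xs ! i \<notin> {p, x, y, p'}" using nx nth_mem[OF i] by auto
      then show "\<pi> (xs ! i) = (if i \<le> c then 2 else 3)" "low (xs ! i) = ((even i = L) = (i \<le> c))"
        using pos_nth[OF d i] by (auto simp: \<pi>_def low_def)
    qed
    define ok where "ok u v = ((low u \<or> low v) \<and> (low u \<and> low v \<longleftrightarrow> \<pi> u \<noteq> \<pi> v))" for u v
    have ok_sym: "ok u v \<Longrightarrow> ok v u" for u v by (auto simp: ok_def)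
    have okpx: "ok p (xs ! i)" if "i < length xs" "E p (xs ! i)" for i
    proof -
      have iC: "i \<in> C x" using that by (simp add: C_def p_def)
      have "(even i = L) = (i \<le> c)" using mx(5,6)[OF iC] c by force
      then show ?thesis using that by (simp add: ok_def v vi)
    qed
    have okp'x: "ok p' (xs ! i)" if "i < length xs" "E p' (xs ! i)" for i
    proof -
      have iC: "i \<in> C y" using that by (simp add: C_def p'_def)
      have "(even i = L) = (i \<le> c)" using my(5,6)[OF iC] c by force
      then show ?thesis using that by (simp add: ok_def v vi)
    qed
    have ok1: "ok (xs ! i) (xs ! Suc i)" if "Suc i < length xs" for i
      using that c by (cases "i = c") (auto simp: ok_def vi)
    have okxx: "ok (xs ! i) (xs ! j)" if "i < length xs" "j < length xs" "E (xs ! i) (xs ! j)" for i j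
      using ipath_nth[OF xs(1), of i j] that ok1 ok_sym by auto
    have ok0: "ok u v" if "u \<in> {p, x, y, p'}" "v \<in> {p, x, y, p'}" "E u v" for u v
      using that npy np'x irrE by (auto simp: ok_def v)
    have okm: "ok u v" if uv: "u \<in> {p, x, y, p'}" "v \<in> set xs" "E u v" for u v
    proof -
      obtain i where i: "i < length xs" "v = xs ! i" using uv(2) by (auto simp: in_set_conv_nth)
      have "u \<noteq> x" "u \<noteq> y" using uv(3) xa[OF mx(8) i(1)] xa[OF my(8) i(1)] i(2) by auto
      then show ?thesis using okpx okp'x i uv by auto
    qed
    have ok: "ok u v" if uv: "u \<in> Y" "v \<in> Y" "E u v" for u v
    proof -
      consider "u \<in> {p, x, y, p'}" "v \<in> {p, x, y, p'}" | "u \<in> {p, x, y, p'}" "v \<in> set xs" | "u \<in> set xs" "v \<in> {p, x, y, p'}"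
        | "u \<in> set xs" "v \<in> set xs" using uv unfolding Y_def by blast
      then show ?thesis
      proof cases
        case 1 then show ?thesis using ok0 uv by blast
      next
        case 2 then show ?thesis using okm uv by blast
      next
        case 3 then show ?thesis using okm[OF 3(2,1) symE[OF uv(3)]] ok_sym by blast
      next
        case 4
        then obtain i j where "i < length xs" "u = xs ! i" "j < length xs" "v = xs ! j" by (auto simp: in_set_conv_nth)
        then show ?thesis using okxx uv by auto
      qed
    qed
    have ta: "ipath (take (Suc c) xs)" "ipath (drop (Suc c) xs)"
      using xs(1) ipath_append[of "take (Suc c) xs" "drop (Suc c) xs"] by simp_all
    have nn: "take (Suc c) xs \<noteq> []" "drop (Suc c) xs \<noteq> []" using cl by auto
    have k0: "{u \<in> Y. \<pi> u = 0} = insert p (insert x {y})"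
      using v vi by (auto simp: Y_def in_set_conv_nth split: if_splits)
    have k1: "{u \<in> Y. \<pi> u = 1} = {p'}"
      using v vi by (auto simp: Y_def in_set_conv_nth split: if_splits)
    have k2: "{u \<in> Y. \<pi> u = 2} = set (take (Suc c) xs)"
    proof
      show "{u \<in> Y. \<pi> u = 2} \<subseteq> set (take (Suc c) xs)"
      proof
        fix u assume u: "u \<in> {u \<in> Y. \<pi> u = 2}"
        then have "u \<in> set xs" using v by (auto simp: Y_def)
        then obtain i where i: "i < length xs" "u = xs ! i" by (auto simp: in_set_conv_nth)
        then have "i \<le> c" using u vi[of i] by (auto split: if_splits)
        then have "xs ! i = take (Suc c) xs ! i" "i < length (take (Suc c) xs)" using i by auto
        then show "u \<in> set (take (Suc c) xs)" using i nth_mem by metis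
      qed
      show "set (take (Suc c) xs) \<subseteq> {u \<in> Y. \<pi> u = 2}"
      proof
        fix u assume u: "u \<in> set (take (Suc c) xs)"
        then obtain i where "i < Suc c" "i < length xs" "u = xs ! i" by (auto simp: in_set_conv_nth)
        then show "u \<in> {u \<in> Y. \<pi> u = 2}" using vi[of i] by (auto simp: Y_def)
      qed
    qed
    have k3: "{u \<in> Y. \<pi> u = 3} = set (drop (Suc c) xs)"
    proof
      show "{u \<in> Y. \<pi> u = 3} \<subseteq> set (drop (Suc c) xs)"
      proof
        fix u assume u: "u \<in> {u \<in> Y. \<pi> u = 3}"
        then have "u \<in> set xs" using v by (auto simp: Y_def)
        then obtain i where i: "i < length xs" "u = xs ! i" by (auto simp: in_set_conv_nth)
        then have "\<not> i \<le> c" using u vi[of i] by (auto split: if_splits)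
        then have "xs ! i = drop (Suc c) xs ! (i - Suc c)" "i - Suc c < length (drop (Suc c) xs)" using i by auto
        then show "u \<in> set (drop (Suc c) xs)" using i nth_mem by metis
      qed
      show "set (drop (Suc c) xs) \<subseteq> {u \<in> Y. \<pi> u = 3}"
      proof
        fix u assume u: "u \<in> set (drop (Suc c) xs)"
        then obtain i where "i < length xs - Suc c" "u = xs ! (Suc c + i)" by (auto simp: in_set_conv_nth)
        then show "u \<in> {u \<in> Y. \<pi> u = 3}" using vi[of "Suc c + i"] by (auto simp: Y_def)
      qed
    qed
    have cn: "con {u \<in> Y. \<pi> u = \<pi> v}" if "v \<in> Y" for v
    proof -
      have "con (insert x {y})" using con_insert[OF con_sing, of y y x] xy by blast
      then have "con (insert p (insert x {y}))" using con_insert[of "insert x {y}" x p] pe by blast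
      moreover have "\<pi> v \<in> {0, 1, 2, 3}" by (auto simp: \<pi>_def)
      ultimately show ?thesis using k0 k1 k2 k3 con_sing ipath_con[OF ta(1) nn(1)] ipath_con[OF ta(2) nn(2)] by auto
    qed
    have YV: "Y \<subseteq> V" using cV(1) X(1) mx(8) my(8) pV by (auto simp: Y_def p_def p'_def)
    have "\<exists>sel. qsel Y low \<pi> 1 sel"
      by (rule quotient_selection[OF YV]) (erule (2) ok[unfolded ok_def], erule cn)
    then obtain sel where qs: "qsel Y low \<pi> 1 sel" by blast
    note sel = qselD[OF qs]
    have Es: "E p (xs ! s x)" "E p (xs ! e x)" "E p' (xs ! s y)" "E p' (xs ! e y)" using mx my by (auto simp: C_def p_def p'_def)
    have inY: "xs ! s x \<in> Y" "xs ! e x \<in> Y" "xs ! s y \<in> Y" "xs ! e y \<in> Y" "xs ! c \<in> Y" "xs ! Suc c \<in> Y" "p \<in> Y" "p' \<in> Y" "y \<in> Y"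
      using el cl by (auto simp: Y_def)
    have pis: "\<pi> (xs ! s x) = 2" "\<pi> (xs ! e x) = 3" "\<pi> (xs ! s y) = 2" "\<pi> (xs ! e y) = 3" "\<pi> (xs ! c) = 2" "\<pi> (xs ! Suc c) = 3"
      and lows: "low (xs ! s x)" "low (xs ! e x)" "low (xs ! s y)" "low (xs ! e y)" "low (xs ! c)" "low (xs ! Suc c)"
      using el cl c vi mx my by auto
    have "sel (\<pi> p) \<noteq> sel (\<pi> (xs ! s x))"
      by (rule sel[of p "xs ! s x" p' y p' "xs ! s y"]) (simp_all only: inY pis lows v Es pe)
    moreover have "sel (\<pi> p) \<noteq> sel (\<pi> (xs ! e x))"
      by (rule sel[of p "xs ! e x" p' y p' "xs ! e y"]) (simp_all only: inY pis lows v Es pe)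
    moreover have "sel (\<pi> (xs ! c)) \<noteq> sel (\<pi> (xs ! Suc c))"
      by (rule sel[of "xs ! c" "xs ! Suc c" p' "xs ! s y" p' "xs ! e y"])
        (use ipath_nth[OF xs(1), of c "Suc c"] cl in \<open>simp_all add: inY pis lows v Es pe\<close>)
    ultimately show False unfolding v pis by blast
  qed
  have Tr: False if x: "x \<in> Xm L" and y: "y \<in> X" and z: "z \<in> Xm L" and xy: "E x y" "E y z" and le: "e x \<le> s z" for x y z L
  \<comment> \<open>The vertices \<open>pf x\<close>, \<open>x\<close>, \<open>y\<close>,
    \<open>z\<close>, \<open>pf z\<close> form a connected bipartite hub whose two parents are low.
    Its contacts at \<open>s x\<close>, \<open>e x\<close> and \<open>s z\<close> alternate in
    parity.\<close>
  proof -
    note mx = mix[OF x] and mz = mix[OF z]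
    define p p' where "p = pf x" and "p' = pf z"
    have pe: "E p x" "E p' z" using pE mx(8) mz(8) by (auto simp: p_def p'_def)
    have n: "\<not> E p y" "\<not> E y p" "\<not> E p' y" "\<not> E y p'" "\<not> E x z" "\<not> E z x" "\<not> E p p'" "\<not> E p' p"
      using no_tri[OF pe(1) xy(1)] no_tri[OF pe(2) symE[OF xy(2)]] no_tri[OF xy] no_pent[OF pe(1) xy symE[OF pe(2)]] symE by blast+
    let ?A = "{p', z, y, x, p}"
    have "con {p}" by (rule con_sing)
    then have "con {x, p}" using con_insert[of "{p}" p x] symE[OF pe(1)] by blast
    then have "con {y, x, p}" using con_insert[of "{x, p}" x y] symE[OF xy(1)] by blast
    then have "con {z, y, x, p}" using con_insert[of "{y, x, p}" y z] symE[OF xy(2)] by blast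
    then have cA: "con ?A" using con_insert[of "{z, y, x, p}" z p'] pe(2) by blast
    have px: "p \<notin> X" "p' \<notin> X" using pX mx(8) mz(8) by (auto simp: p_def p'_def)
    have "x \<noteq> y" "y \<noteq> z" using xy irrE by auto
    then have bA: "bip ?A (\<lambda>v. v \<in> {p, p', y})"
      using n irrE px mx(8) mz(8) unfolding bip_def by auto
    show False
    proof (rule no_odd_hub_cycle_contacts[OF cA bA, of q xs "s x" "e x" "s z"])
      show "e x < s z" using le mx(4) mz(2) by (cases "e x = s z") auto
      show "odd (e x - s x)" "odd (s z - e x)"
        using odd_gap[OF mx(7)] odd_gap[OF \<open>e x < s z\<close>] mx mz by auto
      show "?A \<inter> set xs = {}" using pC y mx(8) mz(8) X(3) by (auto simp: p_def p'_def)
      show "q \<notin> ?A" using pq[OF mx(8)] pq[OF mz(8)] y mx(8) mz(8) X(3) by (auto simp: p_def p'_def)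
      show "?A \<subseteq> V" using pV y mx(8) mz(8) X(1) by (auto simp: p_def p'_def)
      show "a \<in> {p, p', y}" if "a \<in> ?A" "w \<in> insert q (set xs)" "E a w" for a w
        using that X(2) mx(8) mz(8) unfolding anti_def by blast
      show "\<exists>a\<in>?A. E a (xs ! s x)" "\<exists>a\<in>?A. E a (xs ! e x)" "\<exists>a\<in>?A. E a (xs ! s z)"
        using mx mz by (auto simp: C_def p_def p'_def)
      show "s z < length xs" using mz by (auto simp: C_def)
    qed (use cy cV mx in auto)
  qed
  have cm: "col (Xm L) 2" for L
  proof (rule col_bip[where l = "\<lambda>x. \<exists>y\<in>Xm L. E x y \<and> e x \<le> s y"], unfold bip_def, intro ballI impI notI)
    fix x y assume x: "x \<in> Xm L" and y: "y \<in> Xm L" and xy: "E x y"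
      and eq: "(\<exists>z\<in>Xm L. E x z \<and> e x \<le> s z) = (\<exists>z\<in>Xm L. E y z \<and> e y \<le> s z)"
    have *: False if x: "x \<in> Xm L" and y: "y \<in> Xm L" and xy: "E x y" and le: "e x \<le> s y" and z: "\<exists>z\<in>Xm L. E y z \<and> e y \<le> s z" for x y
    proof -
      obtain z where z: "z \<in> Xm L" "E y z" "e y \<le> s z" using z by blast
      have "e x \<le> s z" using le mix(7)[OF y] z by simp
      then show False using Tr[OF x mix(8)[OF y] z(1) xy z(2)] by blast
    qed
    show False
    proof (cases "e x \<le> s y")
      case True
      then have "\<exists>z\<in>Xm L. E x z \<and> e x \<le> s z" using xy y by blast
      then show False using *[OF x y xy True] eq by blast
    next
      case False
      then have le: "e y \<le> s x" using W[OF x y xy] by blast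
      then have "\<exists>z\<in>Xm L. E y z \<and> e y \<le> s z" using symE[OF xy] x by blast
      then show False using *[OF y x symE[OF xy] le] eq by blast
    qed
  qed
  have "X \<subseteq> (Xu True \<union> Xu False) \<union> (Xm True \<union> Xm False)"
    unfolding Xu_def Xm_def by auto
  moreover have "col ((Xu True \<union> Xu False) \<union> (Xm True \<union> Xm False)) ((4 + 4) + (2 + 2))"
    by (intro col_Un cu cm)
  ultimately show ?thesis by (rule_tac col_mono) auto
qed

text \<open>Two adjacent vertices of this set would lie on a closed walk of length 5 through
  \<open>q\<close>.\<close>

lemma col_two_away: "col {x \<in> X. \<exists>p. E p x \<and> E p q} 1"
proof (rule col_stable, unfold anti_def, intro ballI notI)
  fix x y assume "x \<in> {x \<in> X. \<exists>p. E p x \<and> E p q}" "y \<in> {x \<in> X. \<exists>p. E p x \<and> E p q}" "E x y"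
  then obtain p p' where "E p x" "E p q" "E p' y" "E p' q" "E x y" by blast
  then show False using no_pent[of q p x y p'] symE by blast
qed

text \<open>The vertices with a parent next to \<open>q\<close> cost one colour. For the others the
  contacts of the parents have positions in \<open>xs\<close>.\<close>

lemma col_below_cycle:
  assumes cy: "icyc q xs" and cV: "set xs \<subseteq> V" "q \<in> V" and X: "X \<subseteq> V" "anti X (insert q (set xs))" "X \<inter> insert q (set xs) = {}"
    and P: "\<And>x. x \<in> X \<Longrightarrow> \<exists>p. p \<notin> insert q (set xs) \<and> E p x \<and> (\<exists>z\<in>insert q (set xs). E p z)"
  shows "col X 13"
proof -
  define X0 where "X0 = {x \<in> X. \<exists>p. E p x \<and> E p q}"
  have "col (X - X0) 12"
  proof (rule col_below_cycle_avoiding[OF cy cV])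
    show "X - X0 \<subseteq> V" using X by blast
    show "anti (X - X0) (insert q (set xs))" using X(2) unfolding anti_def by blast
    show "(X - X0) \<inter> insert q (set xs) = {}" using X(3) by blast
    show "\<exists>p. p \<notin> insert q (set xs) \<and> E p x \<and> \<not> E p q \<and> (\<exists>z\<in>set xs. E p z)" if x: "x \<in> X - X0" for x
    proof -
      obtain p where p: "p \<notin> insert q (set xs)" "E p x" "\<exists>z\<in>insert q (set xs). E p z" using P[of x] x by blast
      then have "\<not> E p q" using x unfolding X0_def by blast
      then show ?thesis using p by blast
    qed
  qed
  then have "col (X0 \<union> (X - X0)) (1 + 12)" using col_Un[OF col_two_away[of X q]] unfolding X0_def by blast
  then show ?thesis by (rule_tac col_mono) auto
qed

end

context sgraph begin

lemma ipath_map: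
  assumes "\<And>i k. i < n \<Longrightarrow> k < n \<Longrightarrow> g i = g k \<Longrightarrow> i = k"
    and "\<And>i k. i < n \<Longrightarrow> k < n \<Longrightarrow> E (g i) (g k) \<longleftrightarrow> i = Suc k \<or> k = Suc i"
  shows "ipath (map g [0..<n])"
  unfolding ipath_def using assms by (auto simp: distinct_map inj_on_def)

section \<open>Beads\<close>

text \<open>A path \<open>S\<close> from \<open>s\<close> that splits into two arcs \<open>A1\<close>, \<open>A2\<close> of different parity meeting again in \<open>u\<close>; through the
  exit \<open>n\<close> one enters a set \<open>C\<close> far from the rest that still needs more than \<open>w - 2\<close> colours.\<close>
definition bead where
  "bead s K w S A1 A2 u n C \<longleftrightarrow> S \<noteq> [] \<and> hd S = s \<and> set (tl S) \<union> set A1 \<union> set A2 \<union> {u, n} \<union> C \<subseteq> K \<and>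
   ipath (S @ A1 @ [u]) \<and> ipath (S @ A2 @ [u]) \<and> set A1 \<inter> set A2 = {} \<and> anti (set A1) (set A2) \<and>
   even (length A1) \<and> 2 \<le> length A1 \<and> odd (length A2) \<and> 5 \<le> length A2 \<and>
   E n u \<and> n \<notin> set S \<union> set A1 \<union> set A2 \<union> {u} \<and> anti {n} (set S \<union> set A1 \<union> set A2) \<and>
   con C \<and> C \<inter> (set S \<union> set A1 \<union> set A2 \<union> {u}) = {} \<and> anti C (set S \<union> set A1 \<union> set A2 \<union> {u}) \<and> n \<notin> C \<and>
   (\<exists>c\<in>C. E n c) \<and> \<not> col C (w - 2)"

text \<open>A levelling from \<open>s\<close> with stable layers, so that \<open>A\<close> is a
  connected bipartite hub. Only the layer \<open>j\<close> sees the connected rest \<open>K'\<close>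
  in which the search continues.\<close>

definition layers where
  "layers s K A l j K' \<longleftrightarrow> s \<in> A \<and> A \<subseteq> insert s K \<and> K' \<subseteq> K - A \<and> con K' \<and> (\<forall>v\<in>A. l v \<le> (j::nat)) \<and> (\<forall>v\<in>A. l v = 0 \<longleftrightarrow> v = s) \<and>
   (\<forall>v\<in>A. \<forall>i. l v = Suc i \<longrightarrow> (\<exists>u\<in>A. l u = i \<and> E u v)) \<and>
   (\<forall>u\<in>A. \<forall>v\<in>A. E u v \<longrightarrow> l u = Suc (l v) \<or> l v = Suc (l u)) \<and>
   (\<forall>a\<in>A. \<forall>k\<in>K'. E a k \<longrightarrow> l a = j) \<and> (\<exists>a\<in>A. \<exists>k\<in>K'. E a k)"

lemma layersD:
  assumes "layers s K A l j K'"
  shows "s \<in> A" "A \<subseteq> insert s K" "K' \<subseteq> K - A" "con K'" "\<And>v. v \<in> A \<Longrightarrow> l v \<le> j" "\<And>v. v \<in> A \<Longrightarrow> l v = 0 \<longleftrightarrow> v = s"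
    "\<And>v i. v \<in> A \<Longrightarrow> l v = Suc i \<Longrightarrow> \<exists>u\<in>A. l u = i \<and> E u v"
    "\<And>u v. u \<in> A \<Longrightarrow> v \<in> A \<Longrightarrow> E u v \<Longrightarrow> l u = Suc (l v) \<or> l v = Suc (l u)"
    "\<And>a k. a \<in> A \<Longrightarrow> k \<in> K' \<Longrightarrow> E a k \<Longrightarrow> l a = j" "\<exists>a\<in>A. \<exists>k\<in>K'. E a k"
  by (insert assms[unfolded layers_def], (elim conjE, (simp; fail | blast))+)

definition chain where
  "chain A l j x v \<longleftrightarrow> (\<forall>i\<le>j. x i \<in> A \<and> l (x i) = i \<and> E (x i) (x (Suc i))) \<and> x (Suc j) = v"

lemma chain_exists:
  assumes lay: "layers s K A l j K'" and v: "v \<in> K'" "a \<in> A" "E a v"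
  shows "\<exists>x. chain A l j x v"
proof -
  have "\<exists>x. (\<forall>k\<le>i. x k \<in> A \<and> l (x k) = k) \<and> (\<forall>k<i. E (x k) (x (Suc k))) \<and> x i = b" if "b \<in> A" "l b = i" for i b
    using that
  proof (induction i arbitrary: b)
    case 0 then show ?case by (intro exI[of _ "\<lambda>_. b"]) auto
  next
    case (Suc i)
    then obtain c where c: "c \<in> A" "l c = i" "E c b" using lay unfolding layers_def by blast
    obtain x where x: "\<forall>k\<le>i. x k \<in> A \<and> l (x k) = k" "\<forall>k<i. E (x k) (x (Suc k))" "x i = c"
      using Suc.IH[OF c(1,2)] by blast
    show ?case using x c Suc.prems by (intro exI[of _ "x(Suc i := b)"]) (auto simp: less_Suc_eq le_Suc_eq)
  qed
  moreover have "l a = j" using lay v unfolding layers_def by blast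
  ultimately obtain x where x: "\<forall>k\<le>j. x k \<in> A \<and> l (x k) = k" "\<forall>k<j. E (x k) (x (Suc k))" "x j = a" using v by blast
  have "chain A l j (x(Suc j := v)) v" unfolding chain_def using x v by (auto simp: le_less)
  then show ?thesis by blast
qed

lemma chain_splice:
  assumes "chain A l j x v" "chain A l j y v'" "i \<le> j" "E (x i) (y (Suc i))"
  shows "chain A l j (\<lambda>k. if k \<le> i then x k else y k) v'"
proof -
  let ?f = "\<lambda>k. if k \<le> i then x k else y k"
  have "?f k \<in> A \<and> l (?f k) = k \<and> E (?f k) (?f (Suc k))" if "k \<le> j" for k
  proof -
    consider "k < i" | "k = i" | "i < k" by linarith
    then show ?thesis using assms that unfolding chain_def by cases auto
  qed
  moreover have "?f (Suc j) = v'" using assms unfolding chain_def by auto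
  ultimately show ?thesis unfolding chain_def by blast
qed

end

context hgraph begin

lemma nbhd_col: "col {v \<in> X. E u v} 1"
proof (rule col_stable, unfold anti_def, intro ballI notI)
  fix a b assume "a \<in> {v \<in> X. E u v}" "b \<in> {v \<in> X. E u v}" "E a b"
  then show False using no_tri[of u a b] symE by blast
qed

text \<open>Choose chains to \<open>u\<close> and \<open>v\<close> that meet as late as possible. An
  edge between them beyond the fork would allow a splice with a later meeting point, so the two arcs
  are anticomplete. The arc that reaches \<open>u\<close> through \<open>v\<close> has one vertex
  more, hence the other parity.\<close>

lemma bead_fork:
  assumes lay: "layers s K A l j K'" and KV: "K \<subseteq> V" and u: "u \<in> K'" "a \<in> A" "E a u" and v: "v \<in> K'" "b \<in> A" "E b v" and uv: "E u v"
  obtains S B1 B2 where "S \<noteq> []" "hd S = s" "set S \<union> set B1 \<subseteq> A" "set B2 \<subseteq> insert v A" "set (tl S) \<subseteq> A - {s}"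
    "s \<notin> set B1" "s \<notin> set B2"
    "ipath (S @ B1 @ [u])" "ipath (S @ B2 @ [u])" "set B1 \<inter> set B2 = {}" "anti (set B1) (set B2)" 
    "length B2 = Suc (length B1)" "4 \<le> length B1"
proof -
  have lA: "x \<in> A \<Longrightarrow> l x = 0 \<longleftrightarrow> x = s" for x using layersD(6)[OF lay] .
  have ad: "x \<in> A \<Longrightarrow> y \<in> A \<Longrightarrow> E x y \<Longrightarrow> l x = Suc (l y) \<or> l y = Suc (l x)" for x y using layersD(8)[OF lay] .
  have aK: "x \<in> A \<Longrightarrow> y \<in> K' \<Longrightarrow> E x y \<Longrightarrow> l x = j" for x y using lay unfolding layers_def by blast
  have KA: "K' \<inter> A = {}" using lay unfolding layers_def by blast
  define Q where "Q f = (\<exists>x y. chain A l j x u \<and> chain A l j y v \<and> x f = y f)" for f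
  have Q0: "Q 0"
  proof -
    obtain x y where xy: "chain A l j x u" "chain A l j y v" using chain_exists[OF lay u] chain_exists[OF lay v] by blast
    then have "x 0 \<in> A" "l (x 0) = 0" "y 0 \<in> A" "l (y 0) = 0" unfolding chain_def by auto
    then have "x 0 = y 0" using lA by metis
    then show ?thesis unfolding Q_def using xy by blast
  qed
  define f where "f = (GREATEST f. f \<le> j \<and> Q f)"
  have f: "f \<le> j \<and> Q f" unfolding f_def by (rule GreatestI_nat[of _ 0 j]) (use Q0 in auto)
  have fmax: "\<not> Q i" if "f < i" "i \<le> j" for i
    using Greatest_le_nat[of "\<lambda>f. f \<le> j \<and> Q f" i j] that unfolding f_def by fastforce
  obtain x y0 where x: "chain A l j x u" and y0: "chain A l j y0 v" "x f = y0 f" using f unfolding Q_def by blast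
  \<comment> \<open>Only \<open>x f = y0 f\<close> is known; below the fork the second chain is
    replaced by the first, so that both share the stem.\<close>
  define y where "y k = (if k \<le> f then x k else y0 k)" for k
  have "E (x f) (y0 (Suc f))" using y0 f unfolding chain_def by auto
  then have y: "chain A l j y v" unfolding y_def using chain_splice[OF x y0(1), of f] f by blast
  have xy: "i \<le> f \<Longrightarrow> x i = y i" for i by (simp add: y_def)
  have cx: "i \<le> j \<Longrightarrow> x i \<in> A \<and> l (x i) = i \<and> E (x i) (x (Suc i))" for i using x unfolding chain_def by auto
  have cxe: "x (Suc j) = u" using x unfolding chain_def by auto
  have cy: "i \<le> j \<Longrightarrow> y i \<in> A \<and> l (y i) = i \<and> E (y i) (y (Suc i))" for i using y unfolding chain_def by auto
  have cye: "y (Suc j) = v" using y unfolding chain_def by auto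
  have c1: "\<not> E (x i) (y (Suc i))" if "f < i" "i \<le> j" for i
  proof
    assume "E (x i) (y (Suc i))"
    then have "chain A l j (\<lambda>k. if k \<le> i then x k else y k) v" using chain_splice[OF x y] that by blast
    then have "Q i" unfolding Q_def using x by (intro exI[of _ x] exI) auto
    then show False using fmax that by blast
  qed
  have c2: "\<not> E (y i) (x (Suc i))" if "f < i" "i \<le> j" for i
  proof
    assume "E (y i) (x (Suc i))"
    then have "chain A l j (\<lambda>k. if k \<le> i then y k else x k) u" using chain_splice[OF y x] that by blast
    then have "Q i" unfolding Q_def using y by (intro exI[of _ "\<lambda>k. if k \<le> i then y k else x k"] exI[of _ y]) auto
    then show False using fmax that by blast
  qed
  have c3: "x i \<noteq> y i" if "f < i" "i \<le> j" for i
  proof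
    assume "x i = y i" then have "Q i" unfolding Q_def using x y by blast
    then show False using fmax that by blast
  qed
  have uv': "u \<noteq> v" using uv irrE by blast
  have uA: "u \<notin> A" "v \<notin> A" using KA u v by blast+
  have xu: "E (x i) u \<longleftrightarrow> i = j" "E (y i) v \<longleftrightarrow> i = j" if "i \<le> j" for i
    using cx[OF that] cy[OF that] aK[of "x i" u] aK[of "y i" v] u v cx[of j] cy[of j] cxe cye by auto
  have fj: "f < j"
  proof (rule ccontr)
    assume "\<not> f < j"
    then have "f = j" using f by simp
    then have "E (x j) u" "E (x j) v" using xu[of j] xy[of j] by auto
    then show False using no_tri[of "x j" u v] uv symE by blast
  qed
  have yu: "\<not> E (y i) u" "\<not> E (x i) v" if "i \<le> j" for i
  proof -
    show "\<not> E (y i) u"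
    proof
      assume "E (y i) u"
      moreover have "i = j" using aK[of "y i" u] calculation cy[OF that] u by auto
      ultimately show False using c2[of j] fj cxe by simp
    qed
    show "\<not> E (x i) v"
    proof
      assume "E (x i) v"
      moreover have "i = j" using aK[of "x i" v] calculation cx[OF that] v by auto
      ultimately show False using c1[of j] fj cye by simp
    qed
  qed
  have e1: "E (x i) (x k) \<longleftrightarrow> i = Suc k \<or> k = Suc i" if "i \<le> j" "k \<le> j" for i k
    using ad[of "x i" "x k"] cx[OF that(1)] cx[OF that(2)] symE[of "x k" "x i"] by auto
  have e2: "E (y i) (y k) \<longleftrightarrow> i = Suc k \<or> k = Suc i" if "i \<le> j" "k \<le> j" for i k
    using ad[of "y i" "y k"] cy[OF that(1)] cy[OF that(2)] symE[of "y k" "y i"] by auto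
  have e3: "\<not> E (x i) (y k)" if "f < i" "f < k" "i \<le> j" "k \<le> j" for i k
    using ad[of "x i" "y k"] cx[OF that(3)] cy[OF that(4)] c1[OF that(1,3)] c2[OF that(2,4)] symE[of "x i" "y k"] by auto
  define z where "z k = (if k = Suc (Suc j) then u else y k)" for k
  have p1: "ipath (map x [0..<Suc (Suc j)])"
  proof (rule ipath_map)
    fix i k assume ik: "i < Suc (Suc j)" "k < Suc (Suc j)"
    show "i = k" if "x i = x k"
      using ik that cx cxe uA by (metis less_Suc_eq_le le_SucE)
    show "E (x i) (x k) \<longleftrightarrow> i = Suc k \<or> k = Suc i"
    proof (cases "i = Suc j")
      case True
      then show ?thesis using xu[of k] ik cxe symE irrE by (cases "k = Suc j") (auto simp: less_Suc_eq_le)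
    next
      case False
      then show ?thesis using xu[of i] e1[of i k] ik cxe by (cases "k = Suc j") (auto simp: less_Suc_eq_le)
    qed
  qed
  have zz: "k \<le> j \<Longrightarrow> z k = y k" "z (Suc j) = v" "z (Suc (Suc j)) = u" for k by (auto simp: z_def cye)
  have p2: "ipath (map z [0..<Suc (Suc (Suc j))])"
  proof (rule ipath_map)
    fix i k assume ik: "i < Suc (Suc (Suc j))" "k < Suc (Suc (Suc j))"
    have c: "i \<le> j \<or> i = Suc j \<or> i = Suc (Suc j)" "k \<le> j \<or> k = Suc j \<or> k = Suc (Suc j)" using ik by auto
    show "i = k" if "z i = z k"
      using c that cy uA uv' zz by metis
    have s: "E a b \<longleftrightarrow> E b a" for a b using symE by blast
    show "E (z i) (z k) \<longleftrightarrow> i = Suc k \<or> k = Suc i"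
      using c
    proof (elim disjE)
      assume "i \<le> j" "k \<le> j" then show ?thesis using e2 zz by simp
    next
      assume "i \<le> j" "k = Suc j" then show ?thesis using xu[of i] zz by auto
    next
      assume "i \<le> j" "k = Suc (Suc j)" then show ?thesis using yu[of i] zz by auto
    next
      assume "i = Suc j" "k \<le> j" then show ?thesis using xu[of k] zz s[of v] by auto
    next
      assume "i = Suc (Suc j)" "k \<le> j" then show ?thesis using yu[of k] zz s[of u] by auto
    qed (use zz uv symE irrE in auto)
  qed
  define S where "S = map x [0..<Suc f]"
  define B1 where "B1 = map x [Suc f..<Suc j]"
  define B2 where "B2 = map z [Suc f..<Suc (Suc j)]"
  have q1: "S @ B1 @ [u] = map x [0..<Suc (Suc j)]"
  proof -
    have "[0..<Suc (Suc j)] = [0..<Suc f] @ [Suc f..<Suc j] @ [Suc j]"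
      using upt_add_eq_append[of 0 "Suc f" "j - f"] fj by simp
    then show ?thesis by (simp only: S_def B1_def map_append list.map cxe)
  qed
  have q2: "S @ B2 @ [u] = map z [0..<Suc (Suc (Suc j))]"
  proof -
    have "[0..<Suc (Suc (Suc j))] = [0..<Suc f] @ [Suc f..<Suc (Suc j)] @ [Suc (Suc j)]"
      using upt_add_eq_append[of 0 "Suc f" "Suc j - f"] fj by simp
    moreover have "map z [0..<Suc f] = S" unfolding S_def by (rule map_cong) (use xy zz fj in auto)
    ultimately show ?thesis by (simp only: B2_def map_append list.map zz)
  qed
  have x0: "x 0 = s" using cx[of 0] lA[of "x 0"] by simp
  have xs: "x i \<noteq> s" "y i \<noteq> s" if "0 < i" "i \<le> j" for i
  proof -
    have "l s = 0" using lA lay unfolding layers_def by blast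
    then show "x i \<noteq> s" "y i \<noteq> s" using cx[OF that(2)] cy[OF that(2)] that(1) by auto
  qed
  have vs: "v \<noteq> s" using uA lay unfolding layers_def by blast
  have SB1: "set B1 = x ` {Suc f..j}" and SB2: "set B2 = insert v (y ` {Suc f..j})" 
    using fj zz by (auto simp: B1_def B2_def atLeastLessThanSuc_atLeastAtMost image_iff) (use le_Suc_eq in force)+
  have ccyc: False if "j - f < 4"
  proof -
    \<comment> \<open>Go from the fork along \<open>x\<close> to \<open>u\<close>, cross to
      \<open>v\<close>, and return along \<open>y\<close>. For \<open>j - f < 4\<close> this odd
      closed walk has length at most 9. This is the one place where walks of length 7 and 9 must be
      excluded.\<close>
    define n where "n = 2 * (j - f) + 3"
    define c where "c i = (if i \<le> Suc (j - f) then x (f + i) else z (Suc (Suc j) + Suc (j - f) - i))" for i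
    show False
    proof (rule no_odd_walk[of n c])
      show "odd n" "n < 11" using that by (auto simp: n_def)
      have "Suc (Suc j) + Suc (j - f) - n = f" "\<not> n \<le> Suc (j - f)" using fj by (simp_all add: n_def)
      then have "c n = z f" by (simp only: c_def if_False)
      then show "c n = c 0" using fj xy[of f] zz by (simp add: c_def)
      fix i assume i: "i < n"
      show "E (c i) (c (Suc i))"
      proof (cases "i \<le> j - f")
        case True
        then have "f + i \<le> j" using fj by simp
        then show ?thesis using cx[of "f + i"] True by (simp add: c_def)
      next
        case False
        define k where "k = Suc (Suc j) + Suc (j - f) - Suc i"
        have k: "k \<le> Suc j" "Suc k = Suc (Suc j) + Suc (j - f) - i" using False i fj by (auto simp: k_def n_def)
        have "c (Suc i) = z k" using False by (simp add: c_def k_def)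
        moreover have "c i = z (Suc k)"
        proof (cases "i = Suc (j - f)")
          case True
          then have "c i = u" "k = Suc j" using fj cxe by (auto simp: c_def k_def)
          then show ?thesis using zz by simp
        next
          case F: False
          then show ?thesis using False k by (simp add: c_def)
        qed
        moreover have "E (z (Suc k)) (z k)"
          using cy[of k] symE uv zz k by (cases "k = Suc j") (auto simp: z_def)
        ultimately show ?thesis by simp
      qed
    qed
  qed
  show ?thesis
  proof (rule that[of S B1 B2])
    show "S \<noteq> []" by (simp add: S_def)
    show "hd S = s" using x0 by (simp add: S_def hd_map del: upt_Suc)
    show "set S \<union> set B1 \<subseteq> A" using cx fj SB1 by (auto simp: S_def)
    show "set B2 \<subseteq> insert v A" using cy SB2 by auto
    have "tl S = map x [1..<Suc f]" by (simp add: S_def map_tl[symmetric] tl_upt del: upt_Suc)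
    then have st: "set (tl S) = x ` {1..<Suc f}" by (simp del: upt_Suc)
    have im: "x i \<in> A - {s}" if "i \<in> {1..<Suc f}" for i using cx[of i] xs(1)[of i] fj that by auto
    show "set (tl S) \<subseteq> A - {s}" unfolding st by (rule image_subsetI) (rule im)
    have "s \<notin> x ` {Suc f..j}"
    proof
      assume "s \<in> x ` {Suc f..j}"
      then show False
      proof (rule imageE)
        fix i assume "s = x i" "i \<in> {Suc f..j}"
        then show False using xs(1)[of i] by simp
      qed
    qed
    moreover have "s \<notin> y ` {Suc f..j}"
    proof
      assume "s \<in> y ` {Suc f..j}"
      then show False
      proof (rule imageE)
        fix i assume "s = y i" "i \<in> {Suc f..j}"
        then show False using xs(2)[of i] by simp
      qed
    qed
    ultimately show "s \<notin> set B1" "s \<notin> set B2" using vs unfolding SB1 SB2 by auto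
    show "ipath (S @ B1 @ [u])" "ipath (S @ B2 @ [u])" using p1 p2 by (simp_all only: q1 q2)
    show "set B1 \<inter> set B2 = {}"
    proof -
      have "x i \<noteq> y k" if "f < i" "i \<le> j" "f < k" "k \<le> j" for i k
        using c3[of i] cx[of i] cy[of k] that by metis
      moreover have "x i \<noteq> v" if "i \<le> j" for i using cx[OF that] uA by metis
      ultimately show ?thesis unfolding SB1 SB2 by fastforce
    qed
    show "anti (set B1) (set B2)" unfolding SB1 SB2 anti_def using e3 yu by (auto simp: Suc_le_eq)
    show "length B2 = Suc (length B1)" using fj by (simp add: B1_def B2_def)
    show "4 \<le> length B1" using ccyc by (force simp: B1_def)
  qed
qed

text \<open>The neighbours \<open>M\<close> of the last layer in \<open>K'\<close> are bipartite and get two colours out of 0, 1 or 2, 3 according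
  to the parity of \<open>j\<close>, while parts of \<open>K' - M\<close> with \<open>w\<close> colours are shifted by 4. Hence some part of
  \<open>K' - M\<close> is bad; an edge between \<open>M\<close> and the vertices of \<open>M\<close> attached to it closes a bead, and otherwise these
  vertices form the next layer.\<close>
lemma bead_layers:
  assumes "layers s K A l j K'" "K \<subseteq> V" "s \<in> V" "2 \<le> w"
    and "\<not> (\<exists>c. (\<forall>v\<in>K'. c v < w + 4) \<and> (\<forall>u\<in>K'. \<forall>v\<in>K'. E u v \<longrightarrow> c u \<noteq> (c v :: nat)) \<and>
       (\<forall>v\<in>K'. (\<exists>a\<in>A. E a v) \<longrightarrow> c v div 2 = j mod 2))"
  shows "\<exists>S A1 A2 u n C. bead s K w S A1 A2 u n C"
  using assms
proof (induction "card K'" arbitrary: A l j K' rule: less_induct)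
  case less
  note lay = less.prems(1) and KV = less.prems(2) and sV = less.prems(3) and w2 = less.prems(4) and nc = less.prems(5)
  have A: "s \<in> A" "A \<subseteq> insert s K" and K': "K' \<subseteq> K - A" "con K'" and lj: "\<And>v. v \<in> A \<Longrightarrow> l v \<le> j" and l0: "\<And>v. v \<in> A \<Longrightarrow> l v = 0 \<longleftrightarrow> v = s"
    and lS: "\<And>v i. v \<in> A \<Longrightarrow> l v = Suc i \<Longrightarrow> \<exists>u\<in>A. l u = i \<and> E u v"
    and ad: "\<And>u v. u \<in> A \<Longrightarrow> v \<in> A \<Longrightarrow> E u v \<Longrightarrow> l u = Suc (l v) \<or> l v = Suc (l u)"
    and aK: "\<And>a k. a \<in> A \<Longrightarrow> k \<in> K' \<Longrightarrow> E a k \<Longrightarrow> l a = j" and ex: "\<exists>a\<in>A. \<exists>k\<in>K'. E a k"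
    using layersD[OF lay] by auto
  have fK: "finite K'" using K' KV finV finite_subset by (metis Diff_subset)
  define M where "M = {v \<in> K'. \<exists>a\<in>A. E a v}"
  have cA: "con A"
  proof (rule con_rank[of "{s}" A l])
    fix v assume v: "v \<in> A" "v \<notin> {s}"
    then obtain i where "l v = Suc i" using l0 by (cases "l v") auto
    then obtain u where "u \<in> A" "l u = i" "E u v" using lS v by blast
    then show "\<exists>u\<in>A. E v u \<and> (u \<in> {s} \<or> l u < l v)" using symE \<open>l v = Suc i\<close> by (intro bexI[of _ u]) auto
  qed (use A in auto)
  have bA: "bip A (\<lambda>v. even (l v) = even j)" unfolding bip_def
  proof (intro ballI impI)
    fix u v assume "u \<in> A" "v \<in> A" "E u v"
    then show "(even (l u) = even j) \<noteq> (even (l v) = even j)" using ad by fastforce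
  qed
  have "\<exists>f. bip M f"
  proof (rule hub_neighbours_bip[OF cA bA])
    show "A \<subseteq> V" "M \<subseteq> V" "M \<inter> A = {}" using A K' KV sV by (auto simp: M_def)
    show "\<exists>h\<in>A. E h x" if "x \<in> M" for x using that by (auto simp: M_def)
    show "even (l h) = even j" if "x \<in> M" "h \<in> A" "E h x" for x h using aK[of h x] that by (auto simp: M_def)
  qed
  then obtain f where f: "bip M f" by blast
  \<comment> \<open>\<open>c v div 2\<close> is the pair to which a colour belongs. The pair
    \<open>j mod 2\<close> is reserved for \<open>M\<close>, so vertices with a neighbour in
    \<open>M\<close> have to avoid it.\<close>
  define P where "P Z \<longleftrightarrow> (\<exists>c. (\<forall>v\<in>Z. c v < w + 4) \<and> (\<forall>u\<in>Z. \<forall>v\<in>Z. E u v \<longrightarrow> c u \<noteq> (c v :: nat)) \<and>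
       (\<forall>v\<in>Z. (\<exists>m\<in>M. E m v) \<longrightarrow> c v div 2 \<noteq> j mod 2))" for Z
  have "\<not> P (K' - M)"
  proof
    assume "P (K' - M)"
    then obtain c where c: "\<And>v. v \<in> K' - M \<Longrightarrow> c v < w + 4" "\<And>u v. u \<in> K' - M \<Longrightarrow> v \<in> K' - M \<Longrightarrow> E u v \<Longrightarrow> c u \<noteq> c v"
       "\<And>m v. v \<in> K' - M \<Longrightarrow> m \<in> M \<Longrightarrow> E m v \<Longrightarrow> c v div 2 \<noteq> j mod 2" unfolding P_def by blast
    define d where "d v = (if v \<in> M then 2 * (j mod 2) + (if f v then 1 else 0) else c v)" for v
    have dM: "v \<in> M \<Longrightarrow> d v div 2 = j mod 2" for v by (simp add: d_def)
    have "(\<forall>v\<in>K'. d v < w + 4)" using c(1) by (auto simp: d_def)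
    moreover have "d u \<noteq> d v" if "u \<in> K'" "v \<in> K'" "E u v" for u v
    proof (cases "u \<in> M"; cases "v \<in> M")
      assume "u \<in> M" "v \<in> M" then show ?thesis using f that by (auto simp: d_def bip_def)
    next
      assume uM: "u \<in> M" "v \<notin> M" then have "d v div 2 \<noteq> j mod 2" using c(3)[of v u] that by (auto simp: d_def)
      then show ?thesis using dM[OF uM(1)] by metis
    next
      assume uM: "u \<notin> M" "v \<in> M" then have "d u div 2 \<noteq> j mod 2" using c(3)[of u v] that symE by (auto simp: d_def)
      then show ?thesis using dM[OF uM(2)] by metis
    next
      assume "u \<notin> M" "v \<notin> M" then show ?thesis using c(2)[of u v] that by (auto simp: d_def)
    qed
    moreover have "\<forall>v\<in>K'. (\<exists>a\<in>A. E a v) \<longrightarrow> d v div 2 = j mod 2" using dM by (auto simp: M_def)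
    ultimately show False using nc by blast
  qed
  moreover have "P (Z1 \<union> Z2)" if Z: "P Z1" "P Z2" and dz: "Z1 \<inter> Z2 = {}" and az: "anti Z1 Z2" for Z1 Z2
  proof -
    obtain c where c: "\<forall>v\<in>Z1. c v < w + 4" "\<forall>u\<in>Z1. \<forall>v\<in>Z1. E u v \<longrightarrow> c u \<noteq> c v"
       "\<forall>v\<in>Z1. (\<exists>m\<in>M. E m v) \<longrightarrow> c v div 2 \<noteq> j mod 2" using Z(1) unfolding P_def by (elim exE conjE) (rule that)
    obtain c' where c': "\<forall>v\<in>Z2. c' v < w + 4" "\<forall>u\<in>Z2. \<forall>v\<in>Z2. E u v \<longrightarrow> c' u \<noteq> c' v"
       "\<forall>v\<in>Z2. (\<exists>m\<in>M. E m v) \<longrightarrow> c' v div 2 \<noteq> j mod 2" using Z(2) unfolding P_def by (elim exE conjE) (rule that)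
    define d where "d v = (if v \<in> Z1 then c v else c' v)" for v
    have d: "v \<in> Z1 \<Longrightarrow> d v = c v" "v \<in> Z2 \<Longrightarrow> d v = c' v" for v using dz by (auto simp: d_def)
    have az': "x \<in> Z1 \<Longrightarrow> y \<in> Z2 \<Longrightarrow> \<not> E x y \<and> \<not> E y x" for x y using az symE unfolding anti_def by blast
    have "\<forall>u\<in>Z1 \<union> Z2. \<forall>v\<in>Z1 \<union> Z2. E u v \<longrightarrow> d u \<noteq> d v"
      using c(2) c'(2) az' d by (metis UnE)
    moreover have "\<forall>v\<in>Z1 \<union> Z2. d v < w + 4" using c c' d by (metis UnE)
    moreover have "\<forall>v\<in>Z1 \<union> Z2. (\<exists>m\<in>M. E m v) \<longrightarrow> d v div 2 \<noteq> j mod 2" using c c' d by (metis UnE)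
    ultimately show ?thesis unfolding P_def by blast
  qed
  moreover have "P {}" by (simp add: P_def)
  moreover have "finite (K' - M)" using fK by blast
  ultimately obtain K2 where K2: "K2 \<subseteq> K' - M" "con K2" "\<not> P K2" "anti K2 ((K' - M) - K2)"
    using con_component_pred[of "K' - M" P] by blast
  have ncw: "\<not> col K2 w"
  proof
    assume "col K2 w"
    then obtain c where c: "\<And>v. v \<in> K2 \<Longrightarrow> c v < w" "\<And>u v. u \<in> K2 \<Longrightarrow> v \<in> K2 \<Longrightarrow> E u v \<Longrightarrow> c u \<noteq> c v"
      unfolding col_def by blast
    have "P K2" unfolding P_def by (intro exI[of _ "\<lambda>v. c v + 4"]) (use c in auto)
    then show False using K2 by blast
  qed
  define J where "J = {m \<in> M. \<exists>k\<in>K2. E m k}"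
  have Jne: "J \<noteq> {}"
  proof -
    have "M \<noteq> {}" using ex by (auto simp: M_def)
    then have "K2 \<noteq> K'" using K2(1) by (auto simp: M_def)
    then obtain x y where xy: "x \<in> K2" "y \<in> K' - K2" "E x y" using con_cut[OF K'(2), of K2] con_ne[OF K2(2)] K2(1) by blast
    then have "y \<in> M" using K2(4) unfolding anti_def by blast
    then have "y \<in> J" using xy symE by (auto simp: J_def)
    then show ?thesis by blast
  qed
  show ?case
  proof (cases "\<exists>u\<in>J. \<exists>v\<in>M. E u v")
    case True
    then obtain u v where uv: "u \<in> J" "v \<in> M" "E u v" by blast
    then have uK: "u \<in> K'" "v \<in> K'" "u \<in> M" by (auto simp: J_def M_def)
    obtain a b where ab: "a \<in> A" "E a u" "b \<in> A" "E b v" using uv uK by (auto simp: M_def)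
    obtain S B1 B2 where b: "S \<noteq> []" "hd S = s" "set S \<union> set B1 \<subseteq> A" "set B2 \<subseteq> insert v A" "set (tl S) \<subseteq> A - {s}"
      "s \<notin> set B1" "s \<notin> set B2"
      "ipath (S @ B1 @ [u])" "ipath (S @ B2 @ [u])" "set B1 \<inter> set B2 = {}" "anti (set B1) (set B2)" 
      "length B2 = Suc (length B1)" "4 \<le> length B1"
      by (rule bead_fork[OF lay KV uK(1) ab(1,2) uK(2) ab(3,4) uv(3)]) (rule that)
    \<comment> \<open>The fork is built for both orders of the edge, because the exit
      \<open>n\<close> found below may be a neighbour of either end.\<close>
    obtain S' B1' B2' where b': "S' \<noteq> []" "hd S' = s" "set S' \<union> set B1' \<subseteq> A" "set B2' \<subseteq> insert u A" "set (tl S') \<subseteq> A - {s}"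
      "s \<notin> set B1'" "s \<notin> set B2'"
      "ipath (S' @ B1' @ [v])" "ipath (S' @ B2' @ [v])" "set B1' \<inter> set B2' = {}" "anti (set B1') (set B2')" 
      "length B2' = Suc (length B1')" "4 \<le> length B1'"
      by (rule bead_fork[OF lay KV uK(2) ab(3,4) uK(1) ab(1,2) symE[OF uv(3)]]) (rule that)
    \<comment> \<open>\<open>C\<close> must miss both ends of the edge. Each neighbourhood is
      stable, which turns \<open>w\<close> into \<open>w - 2\<close>.\<close>
    define R where "R = {k \<in> K2. E u k} \<union> {k \<in> K2. E v k}"
    have "col R 2" using col_Un[OF nbhd_col[of K2 u] nbhd_col[of K2 v]] unfolding R_def by (simp add: numeral_2_eq_2)
    then have "\<not> col (K2 - R) (w - 2)" using col_Diff[of K2 "w - 2" 2 R] ncw w2 by (metis le_add_diff_inverse2)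
    moreover have "finite (K2 - R)" using K2(1) fK by (meson Diff_subset finite_subset)
    ultimately obtain C where C: "C \<subseteq> K2 - R" "con C" "\<not> col C (w - 2)" "anti C ((K2 - R) - C)" using con_component by blast
    obtain k0 where "k0 \<in> K2" "E u k0" using uv by (auto simp: J_def)
    then have "C \<noteq> K2" using C(1) by (auto simp: R_def)
    then obtain c n where cn: "c \<in> C" "n \<in> K2 - C" "E c n" using con_cut[OF K2(2), of C] con_ne[OF C(2)] C(1) by blast
    then have nR: "n \<in> R" using C(4) unfolding anti_def by blast
    have K2A: "\<not> E k a" "\<not> E a k" "k \<notin> A" if "k \<in> K2" "a \<in> A" for k a using that K2(1) K' symE unfolding M_def by blast+
    have uA: "u \<notin> A" "v \<notin> A" "u \<in> K" "v \<in> K" using uK K' by auto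
    have K2K: "K2 \<subseteq> K" "u \<notin> K2" "v \<notin> K2" using K2(1) K' uK uv(2) by auto
    have AK: "A - {s} \<subseteq> K" using A by auto
    have gen: "\<exists>S A1 A2 u n C. bead s K w S A1 A2 u n C"
      if b: "S \<noteq> []" "hd S = s" "set S \<union> set B1 \<subseteq> A" "set B2 \<subseteq> insert v A" "set (tl S) \<subseteq> A - {s}"
      "s \<notin> set B1" "s \<notin> set B2"
      "ipath (S @ B1 @ [u])" "ipath (S @ B2 @ [u])" "set B1 \<inter> set B2 = {}" "anti (set B1) (set B2)" 
      "length B2 = Suc (length B1)" "4 \<le> length B1" and n: "E u n" 
      and uA: "u \<notin> A" "v \<notin> A" "u \<in> K" "v \<in> K" and K2u: "u \<notin> K2" "v \<notin> K2" and Cu: "anti C {u, v}" and uv: "E u v" for S B1 B2 u v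
    proof -
      have nv: "\<not> E n v" using no_tri[of u n v] n uv symE by blast
      define A1 where "A1 = (if even (length B1) then B1 else B2)"
      define A2 where "A2 = (if even (length B1) then B2 else B1)"
      have sb: "set B1 \<subseteq> A" "set B2 \<subseteq> insert v A" "set S \<subseteq> A" using b by auto
      have allb: "set S \<union> set B1 \<union> set B2 \<subseteq> insert v A" using sb by blast
      have un: "set A1 \<union> set A2 = set B1 \<union> set B2" by (auto simp: A1_def A2_def)
      then have all: "set S \<union> set A1 \<union> set A2 \<subseteq> insert v A" using allb by blast
      have "bead s K w S A1 A2 u n C"
        unfolding bead_def
      proof (intro conjI)
        show "S \<noteq> []" "hd S = s" using b by auto
        have "set B1 \<subseteq> K" using b sb AK by blast
        moreover have "set B2 \<subseteq> K" using b sb AK uA by blast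
        moreover have "set (tl S) \<subseteq> K" using b AK by blast
        moreover have "C \<subseteq> K" "n \<in> K" using C cn K2K by auto
        ultimately show "set (tl S) \<union> set A1 \<union> set A2 \<union> {u, n} \<union> C \<subseteq> K" using un uA by auto
        show "ipath (S @ A1 @ [u])" "ipath (S @ A2 @ [u])" using b by (auto simp: A1_def A2_def)
        show "set A1 \<inter> set A2 = {}" using b by (auto simp: A1_def A2_def)
        show "anti (set A1) (set A2)" using b anti_sym by (auto simp: A1_def A2_def)
        show "even (length A1)" "odd (length A2)" "2 \<le> length A1" "5 \<le> length A2" using b(12,13) unfolding A1_def A2_def by presburger+
        show "E n u" using n symE by blast
        have nA: "n \<notin> A" "n \<noteq> v" "n \<noteq> u" using cn K2A K2u A(1) by blast+
        then show "n \<notin> set S \<union> set A1 \<union> set A2 \<union> {u}" using all by blast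
        have "\<not> E n a" if "a \<in> insert v A" for a using that nv K2A[of n a] cn by blast
        then show "anti {n} (set S \<union> set A1 \<union> set A2)" using all unfolding anti_def by blast
        show "con C" by fact
        have "C \<inter> insert v A = {}" "u \<notin> C" using C(1) K2A K2u A(1) by blast+
        then show "C \<inter> (set S \<union> set A1 \<union> set A2 \<union> {u}) = {}" using all by blast
        have "anti C (insert u (insert v A))" using C(1) Cu K2A unfolding anti_def by blast
        then show "anti C (set S \<union> set A1 \<union> set A2 \<union> {u})" using all unfolding anti_def by blast
        show "n \<notin> C" "\<exists>c\<in>C. E n c" using cn symE by blast+
        show "\<not> col C (w - 2)" by fact
      qed
      then show ?thesis by blast
    qed
    have Cu: "anti C {u, v}" "anti C {v, u}" using C(1) symE unfolding anti_def R_def by blast+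
    consider "E u n" | "E v n" using nR by (auto simp: R_def)
    then show ?thesis
    proof cases
      case 1 show ?thesis by (rule gen[OF b 1 uA K2K(2,3) Cu(1) uv(3)])
    next
      case 2 show ?thesis by (rule gen[OF b' 2 uA(2,1,4,3) K2K(3,2) Cu(2) symE[OF uv(3)]])
    qed
  next
    case False
    define A' where "A' = A \<union> J"
    define l' where "l' v = (if v \<in> A then l v else Suc j)" for v
    have JK: "J \<subseteq> K'" "J \<inter> A = {}" using K' by (auto simp: J_def M_def)
    have l'J: "v \<in> J \<Longrightarrow> l' v = Suc j" and l'A: "v \<in> A \<Longrightarrow> l' v = l v" for v using JK by (auto simp: l'_def)
    have K2A: "\<not> E a k" "k \<notin> A" if "k \<in> K2" "a \<in> A" for k a using that K2(1) K' unfolding M_def by blast+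
    have JJ: "\<not> E x y" if "x \<in> J" "y \<in> J" for x y using False that unfolding J_def by blast
    have lay': "layers s K A' l' (Suc j) K2" unfolding layers_def
    proof (intro conjI)
      show "s \<in> A'" "A' \<subseteq> insert s K" using A JK K' by (auto simp: A'_def)
      have "K2 \<inter> J = {}" using K2(1) by (auto simp: J_def)
      then show "K2 \<subseteq> K - A'" using K2(1) K'(1) by (auto simp: A'_def)
      show "con K2" by fact
      show "\<forall>v\<in>A'. l' v \<le> Suc j" using lj l'J l'A by (auto simp: A'_def intro: le_SucI)
      show "\<forall>v\<in>A'. (l' v = 0) = (v = s)" using l0 l'J l'A JK A(1) by (auto simp: A'_def)
      show "\<forall>v\<in>A'. \<forall>i. l' v = Suc i \<longrightarrow> (\<exists>u\<in>A'. l' u = i \<and> E u v)"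
      proof (intro ballI allI impI)
        fix v i assume v: "v \<in> A'" "l' v = Suc i"
        show "\<exists>u\<in>A'. l' u = i \<and> E u v"
        proof (cases "v \<in> A")
          case True
          then obtain u where "u \<in> A" "l u = i" "E u v" using lS v l'A by fastforce
          then show ?thesis using l'A by (auto simp: A'_def)
        next
          case False
          then have vJ: "v \<in> J" "i = j" using v l'J by (auto simp: A'_def)
          then obtain a where "a \<in> A" "E a v" by (auto simp: J_def M_def)
          then show ?thesis using aK[of a v] vJ JK l'A by (auto simp: A'_def)
        qed
      qed
      show "\<forall>u\<in>A'. \<forall>v\<in>A'. E u v \<longrightarrow> l' u = Suc (l' v) \<or> l' v = Suc (l' u)"
      proof (intro ballI impI)
        fix u v assume uv: "u \<in> A'" "v \<in> A'" "E u v"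
        consider "u \<in> A" "v \<in> A" | "u \<in> A" "v \<in> J" | "u \<in> J" "v \<in> A" using uv JJ by (auto simp: A'_def)
        then show "l' u = Suc (l' v) \<or> l' v = Suc (l' u)"
        proof cases
          case 1 then show ?thesis using ad uv l'A by simp
        next
          case 2 then show ?thesis using aK[of u v] uv l'A l'J JK by auto
        next
          case 3 then show ?thesis using aK[of v u] symE[OF uv(3)] l'A l'J JK by auto
        qed
      qed
      show "\<forall>a\<in>A'. \<forall>k\<in>K2. E a k \<longrightarrow> l' a = Suc j" using K2A l'J by (auto simp: A'_def)
      show "\<exists>a\<in>A'. \<exists>k\<in>K2. E a k" using Jne by (auto simp: A'_def J_def)
    qed
    have "card K2 < card K'"
    proof (rule psubset_card_mono[OF fK])
      have "M \<noteq> {}" "M \<subseteq> K'" using ex by (auto simp: M_def)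
      then show "K2 \<subset> K'" using K2(1) by blast
    qed
    moreover have "\<not> (\<exists>c. (\<forall>v\<in>K2. c v < w + 4) \<and> (\<forall>u\<in>K2. \<forall>v\<in>K2. E u v \<longrightarrow> c u \<noteq> (c v :: nat)) \<and>
       (\<forall>v\<in>K2. (\<exists>a\<in>A'. E a v) \<longrightarrow> c v div 2 = Suc j mod 2))"
    proof
      assume "\<exists>c. (\<forall>v\<in>K2. c v < w + 4) \<and> (\<forall>u\<in>K2. \<forall>v\<in>K2. E u v \<longrightarrow> c u \<noteq> (c v :: nat)) \<and>
       (\<forall>v\<in>K2. (\<exists>a\<in>A'. E a v) \<longrightarrow> c v div 2 = Suc j mod 2)"
      then obtain c where c: "\<forall>v\<in>K2. c v < w + 4" "\<forall>u\<in>K2. \<forall>v\<in>K2. E u v \<longrightarrow> c u \<noteq> (c v :: nat)"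
       "\<forall>v\<in>K2. (\<exists>a\<in>A'. E a v) \<longrightarrow> c v div 2 = Suc j mod 2" by (elim exE conjE) (rule that)
      \<comment> \<open>Vertices of \<open>K2\<close> with a neighbour in \<open>M\<close> have it
        in the new layer \<open>J\<close> and would get the pair of \<open>Suc j\<close>, which is
        not the pair reserved for \<open>M\<close>.\<close>
      have "Suc j mod 2 \<noteq> j mod 2" by presburger
      moreover have "\<exists>a\<in>A'. E a v" if "v \<in> K2" "m \<in> M" "E m v" for v m using that by (auto simp: A'_def J_def)
      ultimately have "\<forall>v\<in>K2. (\<exists>m\<in>M. E m v) \<longrightarrow> c v div 2 \<noteq> j mod 2" using c(3) by metis
      then have "P K2" unfolding P_def using c(1,2) by blast
      then show False using K2 by blast
    qed
    ultimately show ?thesis using less.hyps[OF _ lay' KV sV w2] by blast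
  qed
qed

text \<open>The search starts with the single layer \<open>{s}\<close>; a colouring that respects
  reserved pairs is in particular a colouring.\<close>

lemma bead_exists:
  assumes "K \<subseteq> V" "con K" "s \<in> V" "s \<notin> K" "\<exists>k\<in>K. E s k" "\<not> col K (w + 4)" "2 \<le> w"
  shows "\<exists>S A1 A2 u n C. bead s K w S A1 A2 u n C"
proof (rule bead_layers[of s K "{s}" "\<lambda>_. 0" 0 K])
  show "layers s K {s} (\<lambda>_. 0) 0 K" using assms irrE by (auto simp: layers_def)
  show "\<not> (\<exists>c. (\<forall>v\<in>K. c v < w + 4) \<and> (\<forall>u\<in>K. \<forall>v\<in>K. E u v \<longrightarrow> c u \<noteq> (c v :: nat)) \<and>
       (\<forall>v\<in>K. (\<exists>a\<in>{s}. E a v) \<longrightarrow> c v div 2 = 0 mod 2))"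
    using assms(6) unfolding col_def by blast
qed (use assms in auto)

end

section \<open>Shortest walks, odd cycles of thetas and bipartite unions\<close>

context sgraph begin

definition wlk where
  "wlk S n T ys \<longleftrightarrow> ys \<noteq> [] \<and> hd ys = n \<and> set ys \<subseteq> S \<and> last ys \<in> T \<and> successively E ys"

text \<open>The target is a set, so a shortest walk meets it in its last vertex only.\<close>

definition geod where
  "geod S n T ys \<longleftrightarrow> wlk S n T ys \<and> (\<forall>zs. wlk S n T zs \<longrightarrow> length ys \<le> length zs)"

lemma wlk_exists: assumes S: "con S" "n \<in> S" "t \<in> S" shows "\<exists>ys. wlk S n {t} ys"
proof (rule ccontr)
  define R where "R = {v \<in> S. \<exists>ys. wlk S n {v} ys}"
  assume "\<not> ?thesis"
  then have "R \<noteq> S" using S by (auto simp: R_def)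
  moreover have "wlk S n {n} [n]" using S by (simp add: wlk_def)
  then have "n \<in> R" using S by (auto simp: R_def)
  moreover have "R \<subseteq> S" by (auto simp: R_def)
  ultimately obtain u v where uv: "u \<in> R" "v \<in> S - R" "E u v" using con_cut[OF S(1), of R] by blast
  then obtain ys where ys: "wlk S n {u} ys" by (auto simp: R_def)
  then have "wlk S n {v} (ys @ [v])" using uv by (auto simp: wlk_def successively_append_iff)
  then show False using uv by (auto simp: R_def)
qed

lemma geod_exists: assumes S: "con S" "n \<in> S" "t \<in> S" "t \<in> T" shows "\<exists>ys. geod S n T ys"
proof -
  obtain ys where "wlk S n {t} ys" using wlk_exists[OF S(1-3)] by blast
  then have "wlk S n T ys" using S(4) by (simp add: wlk_def)
  then have "\<exists>ys. wlk S n T ys \<and> (\<forall>zs. wlk S n T zs \<longrightarrow> length ys \<le> length zs)"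
    using ex_has_least_nat[of "wlk S n T" ys length] by blast
  then show ?thesis unfolding geod_def .
qed

lemma geodD: assumes "geod S n T ys" shows "ys \<noteq> []" "hd ys = n" "set ys \<subseteq> S" "last ys \<in> T" "successively E ys"
  using assms unfolding geod_def wlk_def by auto

lemma successively_parts: "successively R xs \<Longrightarrow> successively R (take k xs) \<and> successively R (drop k xs)"
  using successively_append_iff[of R "take k xs" "drop k xs"] by simp

lemma geod_shortcut:
  assumes g: "geod S n T ys" and i: "i < length ys" "j < length ys" and zs: "set zs \<subseteq> S" "successively E (ys ! i # zs @ [ys ! j])"
  shows "j \<le> i + length zs + 1"
proof -
  have y: "ys \<noteq> []" "hd ys = n" "set ys \<subseteq> S" "last ys \<in> T" "successively E ys" using geodD[OF g] by auto
  have ts: "take (Suc i) ys = take i ys @ [ys ! i]" using i by (simp add: take_Suc_conv_app_nth)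
  have ds: "drop j ys = ys ! j # drop (Suc j) ys" using i by (simp add: Cons_nth_drop_Suc)
  let ?w = "take (Suc i) ys @ zs @ drop j ys"
  have "successively E (take (Suc i) ys)" "successively E (drop j ys)" using successively_parts[OF y(5)] by auto
  moreover have "successively E zs" "zs \<noteq> [] \<Longrightarrow> E (ys ! i) (hd zs) \<and> E (last zs) (ys ! j)" "zs = [] \<Longrightarrow> E (ys ! i) (ys ! j)"
    using zs(2) by (auto simp: successively_Cons successively_append_iff)
  ultimately have "successively E ?w" unfolding successively_append_iff ts ds by (cases "zs = []") auto
  moreover have "hd ?w = n" using y i by (cases ys) auto
  moreover have "last ?w = last ys" using i by simp
  moreover have "set ?w \<subseteq> S" using y(3) zs(1) set_take_subset[of "Suc i" ys] set_drop_subset[of j ys] by auto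
  ultimately have "wlk S n T ?w" using y ts by (simp add: wlk_def)
  then have "length ys \<le> length ?w" using g unfolding geod_def by blast
  then show ?thesis using i by simp
qed

lemma geod_ipath: assumes g: "geod S n T ys" shows "ipath ys"
proof -
  have y: "ys \<noteq> []" "hd ys = n" "set ys \<subseteq> S" "last ys \<in> T" "successively E ys" using geodD[OF g] by auto
  have st: "E (ys ! i) (ys ! Suc i)" if "Suc i < length ys" for i
    using y(5) that by (simp add: successively_conv_nth)
  have nd: "ys ! i \<noteq> ys ! j" if ij: "i < j" "j < length ys" for i j
  proof
    assume eq: "ys ! i = ys ! j"
    let ?w = "take i ys @ drop j ys"
    have hdd: "hd (drop j ys) = ys ! i" using ij eq by (simp add: hd_drop_conv_nth)
    have "successively E (take i ys)" "successively E (drop j ys)" using successively_parts[OF y(5)] by auto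
    moreover have "E (last (take i ys)) (hd (drop j ys))" if i0: "i \<noteq> 0"
    proof -
      obtain k where k: "i = Suc k" using i0 by (cases i) auto
      then have "last (take i ys) = ys ! k" using ij by (simp add: take_Suc_conv_app_nth)
      then show ?thesis using st[of k] k ij hdd by simp
    qed
    ultimately have "successively E ?w" unfolding successively_append_iff by (cases "i = 0") auto
    moreover have "hd ?w = n"
    proof (cases i)
      case 0 then show ?thesis using hdd y(1,2) by (simp add: hd_conv_nth)
    next
      case (Suc k) then show ?thesis using y(1,2) by (cases ys) auto
    qed
    moreover have "last ?w = last ys" "?w \<noteq> []" using ij by simp_all
    moreover have "set ?w \<subseteq> S" using y(3) set_take_subset[of i ys] set_drop_subset[of j ys] by auto
    ultimately have "wlk S n T ?w" using y by (simp add: wlk_def)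
    then have "length ys \<le> length ?w" using g unfolding geod_def by blast
    then show False using ij by simp
  qed
  have lt: "j = Suc i" if "i < j" "j < length ys" "E (ys ! i) (ys ! j)" for i j
    using geod_shortcut[OF g, of i j "[]"] that by simp
  show ?thesis unfolding ipath_def
  proof (intro conjI allI impI)
    show "distinct ys" unfolding distinct_conv_nth
    proof (intro allI impI)
      fix i j assume "i < length ys" "j < length ys" "i \<noteq> j"
      then show "ys ! i \<noteq> ys ! j" using nd[of i j] nd[of j i] by (metis linorder_neqE_nat)
    qed
    fix i j assume ij: "i < length ys" "j < length ys"
    show "E (ys ! i) (ys ! j) \<longleftrightarrow> i = Suc j \<or> j = Suc i"
    proof
      assume e: "E (ys ! i) (ys ! j)"
      then have "i \<noteq> j" using irrE by metis
      then show "i = Suc j \<or> j = Suc i" using lt[of i j] lt[of j i] e symE ij by (metis linorder_neqE_nat)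
    next
      assume "i = Suc j \<or> j = Suc i"
      then show "E (ys ! i) (ys ! j)" using st[of i] st[of j] symE ij by auto
    qed
  qed
qed

lemma geod_only_last: assumes g: "geod S n T ys" and v: "v \<in> set ys" "v \<in> T" shows "v = last ys"
proof (rule ccontr)
  assume n: "v \<noteq> last ys"
  have y: "ys \<noteq> []" "hd ys = n" "set ys \<subseteq> S" "last ys \<in> T" "successively E ys" using geodD[OF g] by auto
  obtain i where i: "i < length ys" "v = ys ! i" using v by (auto simp: in_set_conv_nth)
  have il: "Suc i < length ys"
  proof (rule ccontr)
    assume "\<not> ?thesis"
    then have "i = length ys - 1" using i by simp
    then show False using n i y(1) by (simp add: last_conv_nth)
  qed
  have "hd (take (Suc i) ys) = n" using y(1,2) by (cases ys) auto
  moreover have "last (take (Suc i) ys) = v" using i by (simp add: take_Suc_conv_app_nth)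
  moreover have "set (take (Suc i) ys) \<subseteq> S" using y(3) set_take_subset[of "Suc i" ys] by blast
  ultimately have "wlk S n T (take (Suc i) ys)"
    using y(1) v(2) successively_parts[OF y(5), of "Suc i"] by (simp add: wlk_def)
  then have "length ys \<le> length (take (Suc i) ys)" using g unfolding geod_def by blast
  then show False using il by simp
qed

lemma theta_cyc:
  assumes p: "ipath (R @ A1 @ [u])" "ipath (R @ A2 @ [u])" and ne: "R \<noteq> []" "A1 \<noteq> []" "A2 \<noteq> []"
    and d: "set A1 \<inter> set A2 = {}" "anti (set A1) (set A2)" and odd: "odd (length A1 + length A2)"
  shows "icyc (last R) (A1 @ u # rev A2)"
proof -
  obtain R' q where R: "R = R' @ [q]" using ne by (cases R rule: rev_cases) auto
  have s: "E a b \<longleftrightarrow> E b a" for a b using symE by blast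
  have 1: "ipath (A1 @ [u])" "q \<notin> set A1" "q \<noteq> u" "\<And>y. y \<in> set (A1 @ [u]) \<Longrightarrow> E q y \<longleftrightarrow> y = hd A1"
    using p(1) ne unfolding R ipath_append by auto
  have 2: "ipath (A2 @ [u])" "q \<notin> set A2" "\<And>y. y \<in> set (A2 @ [u]) \<Longrightarrow> E q y \<longleftrightarrow> y = hd A2"
    using p(2) ne unfolding R ipath_append by auto
  have 3: "u \<notin> set A1" "u \<notin> set A2" "\<And>y. y \<in> set A1 \<Longrightarrow> E y u \<longleftrightarrow> y = last A1" "\<And>y. y \<in> set A2 \<Longrightarrow> E y u \<longleftrightarrow> y = last A2"
    "ipath A1" "ipath A2"
    using 1(1) 2(1) unfolding ipath_append by auto
  have "ipath (u # rev A2)" using 2(1) ipath_rev[of "A2 @ [u]"] by simp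
  moreover have "\<forall>x\<in>set A1. \<forall>y\<in>set (u # rev A2). E x y \<longleftrightarrow> x = last A1 \<and> y = u"
    using 3 d unfolding anti_def by auto
  ultimately have ip: "ipath (A1 @ u # rev A2)" unfolding ipath_append using 3 d by auto
  have "last (A1 @ u # rev A2) = hd A2" "hd (A1 @ u # rev A2) = hd A1" using ne by (auto simp: last_rev)
  moreover have "hd A1 \<in> set A1" "hd A2 \<in> set A2" using ne by auto
  ultimately have "\<forall>v\<in>set (A1 @ u # rev A2). E q v \<longleftrightarrow> v = hd (A1 @ u # rev A2) \<or> v = last (A1 @ u # rev A2)"
    using 1(4) 2(3) d(1) 3(1,2) by auto
  then show ?thesis unfolding icyc_def R using ip 1 2 odd by auto
qed

text \<open>At most one edge joins the two sides; flipping the labels of \<open>B\<close> if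
  necessary makes it bichromatic.\<close>

lemma bip_join:
  assumes "bip A la" "bip B lb" "A \<inter> B = {}" "\<And>a b. a \<in> A \<Longrightarrow> b \<in> B \<Longrightarrow> E a b \<Longrightarrow> a = a0 \<and> b = b0"
  shows "\<exists>l. bip (A \<union> B) l"
proof -
  define l where "l v = (if v \<in> A then la v else (if la a0 = lb b0 then \<not> lb v else lb v))" for v
  have lA: "v \<in> A \<Longrightarrow> l v = la v" for v by (simp add: l_def)
  have lB: "v \<in> B \<Longrightarrow> l v = (if la a0 = lb b0 then \<not> lb v else lb v)" for v using assms(3) by (auto simp: l_def)
  have 1: "l a \<noteq> l b" if "a \<in> A" "b \<in> B" "E a b" for a b
    using assms(4)[OF that] lA[OF that(1)] lB[OF that(2)] by auto
  have "bip (A \<union> B) l" unfolding bip_def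
  proof (intro ballI impI)
    fix u v assume uv: "u \<in> A \<union> B" "v \<in> A \<union> B" "E u v"
    consider "u \<in> A" "v \<in> A" | "u \<in> A" "v \<in> B" | "u \<in> B" "v \<in> A" | "u \<in> B" "v \<in> B" using uv by blast
    then show "l u \<noteq> l v"
    proof cases
      case 1 then show ?thesis using assms(1) uv(3) lA unfolding bip_def by auto
    next
      case 2 then show ?thesis using 1 uv by blast
    next
      case 3 then show ?thesis using 1[OF 3(2,1)] symE[OF uv(3)] by metis
    next
      case 4 then show ?thesis using assms(2) uv(3) lB unfolding bip_def by auto
    qed
  qed
  then show ?thesis by blast
qed

lemma bip_flip: "bip S l \<Longrightarrow> bip S (\<lambda>v. l v = b)"
  unfolding bip_def by auto

end

context hgraph begin

text \<open>\<open>29 = 13 + (13 + 1 + 2)\<close>: parents that touch the odd cycle of the theta cost 13. For the others take a parent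
  \<open>p0\<close> whose last contact on the stem \<open>R\<close> comes first and close the stem through \<open>p0\<close>, one of the arcs and a
  geodesic \<open>k\<close> in \<open>C\<close> to an odd cycle that all these parents touch; the neighbours of \<open>p0\<close> and of \<open>k\<close> are coloured
  separately.\<close>
lemma col_below_theta:
  assumes p: "ipath (R @ A1 @ [u])" "ipath (R @ A2 @ [u])" and ne: "R \<noteq> []" "A1 \<noteq> []" "A2 \<noteq> []"
    and d: "set A1 \<inter> set A2 = {}" "anti (set A1) (set A2)" and par: "odd (length A1 + length A2)"
    and V: "set R \<union> set A1 \<union> set A2 \<union> {u} \<subseteq> V" "C \<subseteq> V"
    and n: "E n u" "n \<notin> set R \<union> set A1 \<union> set A2 \<union> {u}" "anti {n} (set R \<union> set A1 \<union> set A2)"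
    and C: "con C" "C \<inter> (set R \<union> set A1 \<union> set A2 \<union> {u}) = {}" "anti C (set R \<union> set A1 \<union> set A2 \<union> {u})" "n \<notin> C" "\<exists>c\<in>C. E n c"
    and P: "P \<inter> (set R \<union> set A1 \<union> set A2 \<union> {u, n} \<union> C) = {}"
  shows "col {x \<in> C. \<exists>p\<in>P. E p x \<and> (\<exists>z\<in>set R \<union> set A1 \<union> set A2 \<union> {u}. E p z)} 29"
proof -
  define q where "q = last R"
  define Z where "Z = insert q (set (A1 @ u # rev A2))"
  have qR: "q \<in> set R" using ne by (simp add: q_def)
  have Z: "Z = insert q (set A1 \<union> set A2 \<union> {u})" by (auto simp: Z_def)
  have cy: "icyc q (A1 @ u # rev A2)" unfolding q_def by (rule theta_cyc[OF p ne d par])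
  have nV: "n \<in> V" using n inV by blast
  have s: "E a b \<longleftrightarrow> E b a" for a b using symE by blast
  define X1 where "X1 = {x \<in> C. \<exists>p\<in>P. E p x \<and> (\<exists>z\<in>Z. E p z)}"
  define X2 where "X2 = {x \<in> C. \<exists>p\<in>P. E p x \<and> (\<forall>z\<in>Z. \<not> E p z) \<and> (\<exists>z\<in>set R. E p z)}"
  have c1: "col X1 13"
  proof (rule col_below_cycle[OF cy])
    show "set (A1 @ u # rev A2) \<subseteq> V" "q \<in> V" using V qR by auto
    show "X1 \<subseteq> V" using V by (auto simp: X1_def)
    show "anti X1 (insert q (set (A1 @ u # rev A2)))" using C(3) qR unfolding anti_def X1_def by auto
    show "X1 \<inter> insert q (set (A1 @ u # rev A2)) = {}" using C(2) qR unfolding X1_def by auto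
    show "\<exists>p. p \<notin> insert q (set (A1 @ u # rev A2)) \<and> E p x \<and> (\<exists>z\<in>insert q (set (A1 @ u # rev A2)). E p z)" if "x \<in> X1" for x
    proof -
      obtain p where "p \<in> P" "E p x" "\<exists>z\<in>Z. E p z" using \<open>x \<in> X1\<close> unfolding X1_def by blast
      moreover have "p \<notin> Z" using P \<open>p \<in> P\<close> qR unfolding Z by blast
      ultimately show ?thesis unfolding Z_def by blast
    qed
  qed
  have c2: "col X2 16"
  proof (cases "X2 = {}")
    case True then show ?thesis using col_empty by simp
  next
    case False
    define P2 where "P2 = {p \<in> P. (\<exists>x\<in>C. E p x) \<and> (\<forall>z\<in>Z. \<not> E p z) \<and> (\<exists>z\<in>set R. E p z)}"
    define zl where "zl p = Max {i. i < length R \<and> E p (R ! i)}" for p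
    have zl: "zl p < length R" "E p (R ! zl p)" "\<And>i. i < length R \<Longrightarrow> E p (R ! i) \<Longrightarrow> i \<le> zl p" if "p \<in> P2" for p
    proof -
      let ?I = "{i. i < length R \<and> E p (R ! i)}"
      have f: "finite ?I" by simp
      have "?I \<noteq> {}" using that by (auto simp: P2_def in_set_conv_nth)
      then have "zl p \<in> ?I" unfolding zl_def using Max_in[OF f] by blast
      then show "zl p < length R" "E p (R ! zl p)" by auto
      show "i \<le> zl p" if "i < length R" "E p (R ! i)" for i unfolding zl_def by (rule Max_ge[OF f]) (use that in simp)
    qed
    have "\<exists>p. p \<in> P2" using False by (auto simp: X2_def P2_def)
    then obtain p0 where p0: "p0 \<in> P2" "\<And>p. p \<in> P2 \<Longrightarrow> zl p0 \<le> zl p"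
      using ex_has_least_nat[of "\<lambda>p. p \<in> P2" _ zl] by blast
    define z0 where "z0 = zl p0"
    have z0: "z0 < length R" "E p0 (R ! z0)" "\<And>i. i < length R \<Longrightarrow> E p0 (R ! i) \<Longrightarrow> i \<le> z0" unfolding z0_def using zl[OF p0(1)] by auto
    have p0P: "p0 \<in> P" "\<And>z. z \<in> Z \<Longrightarrow> \<not> E p0 z" using p0(1) by (auto simp: P2_def)
    obtain x0 where x0: "x0 \<in> C" "E p0 x0" using p0(1) by (auto simp: P2_def)
    have "con (insert n C)" using con_insert C by blast
    then obtain k where k: "geod (insert n C) n {v. E p0 v} k"
      using geod_exists[of "insert n C" n x0 "{v. E p0 v}"] x0 by blast
    have ki: "ipath k" using geod_ipath[OF k] .
    have kn: "k \<noteq> []" "hd k = n" "set k \<subseteq> insert n C" "E p0 (last k)" using geodD[OF k] by auto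
    have kl: "v \<in> set k \<Longrightarrow> E p0 v \<Longrightarrow> v = last k" for v using geod_only_last[OF k] by blast
    define A where "A = (if even (length (drop z0 R @ A1 @ [u] @ k)) then A1 else A2)"
    define Q where "Q = drop z0 R @ A @ [u] @ k"
    have AA: "set A \<subseteq> set A1 \<union> set A2" "A \<noteq> []" "ipath (R @ A @ [u])" using p ne by (auto simp: A_def)
    have evQ: "even (length Q)" using par by (auto simp: Q_def A_def)
    have "ipath (take z0 R @ drop z0 R @ A @ [u])" using AA(3) by (metis append.assoc append_take_drop_id)
    then have iq: "ipath (drop z0 R @ A @ [u])" using ipath_append by blast
    have dR: "set (drop z0 R) \<subseteq> set R" by (rule set_drop_subset)
    have "ipath ((drop z0 R @ A @ [u]) @ k)" unfolding ipath_append[of "drop z0 R @ A @ [u]" k]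
    proof (intro conjI ballI)
      show "set (drop z0 R @ A @ [u]) \<inter> set k = {}" using kn(3) dR AA(1) C(2) n(2) by auto
      fix x y assume x: "x \<in> set (drop z0 R @ A @ [u])" and y: "y \<in> set k"
      have xs: "x \<in> set R \<union> set A1 \<union> set A2 \<union> {u}" using x dR AA(1) by auto
      have "u \<notin> set R \<union> set A1 \<union> set A2" using p d(1) unfolding ipath_append by auto
      then have un: "x \<noteq> u \<Longrightarrow> \<not> E n x" using n(3) xs unfolding anti_def by blast
      have "E x y \<longleftrightarrow> x = u \<and> y = n"
      proof (cases "y = n")
        case True then show ?thesis using un n(1) s by blast
      next
        case False
        then have "y \<in> C" using y kn(3) by blast
        then have "\<not> E y x" using C(3) xs unfolding anti_def by blast
        then show ?thesis using False s by blast
      qed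
      then show "E x y \<longleftrightarrow> x = last (drop z0 R @ A @ [u]) \<and> y = hd k" using kn(2) by simp
    qed (use iq ki in auto)
    then have Qi: "ipath Q" by (simp add: Q_def)
    have Qset: "set Q \<subseteq> set R \<union> set A1 \<union> set A2 \<union> {u, n} \<union> C" using dR AA(1) kn(3) by (auto simp: Q_def)
    have Qh: "hd Q = R ! z0" "last Q = last k" using z0(1) kn(1) by (auto simp: Q_def hd_append hd_drop_conv_nth)
    have Qc: "icyc p0 Q" unfolding icyc_def
    proof (intro conjI ballI)
      show "Q \<noteq> []" by (simp add: Q_def)
      show "p0 \<notin> set Q" using Qset P p0P by blast
      fix v assume v: "v \<in> set Q"
      show "E p0 v \<longleftrightarrow> v = hd Q \<or> v = last Q"
      proof
        assume e: "E p0 v"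
        then have "v \<notin> Z" using p0P by blast
        then have "v \<in> set (drop z0 R) \<or> v \<in> set k" using v AA(1) unfolding Z by (auto simp: Q_def)
        then show "v = hd Q \<or> v = last Q"
        proof
          assume "v \<in> set (drop z0 R)"
          then obtain i where i: "i < length R - z0" "v = R ! (z0 + i)" by (auto simp: in_set_conv_nth)
          then have "z0 + i \<le> z0" using z0(3)[of "z0 + i"] e by simp
          then show ?thesis using i Qh by simp
        next
          assume "v \<in> set k" then show ?thesis using kl e Qh by simp
        qed
      next
        assume "v = hd Q \<or> v = last Q" then show "E p0 v" using Qh z0 kn by auto
      qed
    qed (use evQ Qi in auto)
    define Xa where "Xa = {x \<in> C. E p0 x}"
    define Xb where "Xb = {x \<in> C. x \<in> set k \<or> (\<exists>v\<in>set k. E x v)}"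
    have ca: "col Xa 1" unfolding Xa_def by (rule nbhd_col)
    have nb: "\<exists>i<length k. E x (k ! i)" if x: "x \<in> Xb" for x
    proof (cases "\<exists>v\<in>set k. E x v")
      case True then show ?thesis by (auto simp: in_set_conv_nth)
    next
      case False
      then have "x \<in> set k" "x \<noteq> n" using x C(4) by (auto simp: Xb_def)
      then obtain i where i: "i < length k" "x = k ! i" by (auto simp: in_set_conv_nth)
      have "i \<noteq> 0" using i \<open>x \<noteq> n\<close> kn(1,2) by (metis hd_conv_nth)
      then obtain i' where "i = Suc i'" by (cases i) auto
      then have "E x (k ! i')" "i' < length k" using i ipath_nth[OF ki, of i i'] by auto
      then show ?thesis by blast
    qed
    then obtain f where f: "\<And>x. x \<in> Xb \<Longrightarrow> f x < length k \<and> E x (k ! f x)" by metis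
    \<comment> \<open>The detour through \<open>x\<close> and \<open>y\<close> shows that the two
      positions differ by at most 3. With equal parity the difference is 0, which gives a triangle,
      or 2, which gives a closed walk of length 5.\<close>
    have key: False if x: "x \<in> Xb" and y: "y \<in> Xb" and xy: "E x y" and le: "f x \<le> f y" and ev: "even (f x) = even (f y)" for x y
    proof -
      have xyC: "x \<in> C" "y \<in> C" using x y by (auto simp: Xb_def)
      have fx: "f x < length k" "E x (k ! f x)" and fy: "f y < length k" "E y (k ! f y)" using f x y by auto
      have "f y \<le> f x + length [x, y] + 1"
        by (rule geod_shortcut[OF k fx(1) fy(1)]) (use xyC xy fx fy s in auto)
      then have "f y \<le> f x + 3" by simp
      then have "f y = f x \<or> f y = Suc (Suc (f x))" using le ev by presburger
      then show False
      proof
        assume "f y = f x"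
        then show False using no_tri[of x y "k ! f x"] xy fx fy s by metis
      next
        assume eq: "f y = Suc (Suc (f x))"
        then have "E (k ! f y) (k ! Suc (f x))" "E (k ! Suc (f x)) (k ! f x)"
          using ipath_nth[OF ki] fy(1) by auto
        then show False using no_pent[of x y "k ! f y" "k ! Suc (f x)" "k ! f x"] xy fx fy s by blast
      qed
    qed
    have "bip Xb (\<lambda>x. even (f x))" unfolding bip_def
    proof (intro ballI impI notI)
      fix x y assume "x \<in> Xb" "y \<in> Xb" "E x y" "even (f x) = even (f y)"
      then show False using key[of x y] key[of y x] s by (metis linear)
    qed
    then have cb: "col Xb 2" by (rule col_bip)
    define Xc where "Xc = X2 - Xa - Xb"
    have cc: "col Xc 13"
    proof (rule col_below_cycle[OF Qc])
      show "set Q \<subseteq> V" "p0 \<in> V" using Qset V nV x0 inV by blast+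
      show "Xc \<subseteq> V" using V by (auto simp: Xc_def X2_def)
      have Q2: "set Q \<subseteq> set R \<union> set A1 \<union> set A2 \<union> {u} \<union> set k" using dR AA(1) by (auto simp: Q_def)
      show "anti Xc (insert p0 (set Q))" unfolding anti_def
      proof (intro ballI)
        fix x z assume x: "x \<in> Xc" and z: "z \<in> insert p0 (set Q)"
        have xC: "x \<in> C" "\<not> E p0 x" "x \<notin> Xb" using x by (auto simp: Xc_def X2_def Xa_def)
        consider "z = p0" | "z \<in> set R \<union> set A1 \<union> set A2 \<union> {u}" | "z \<in> set k" using z Q2 by blast
        then show "\<not> E x z"
        proof cases
          case 1 then show ?thesis using xC s by blast
        next
          case 2 then show ?thesis using C(3) xC unfolding anti_def by blast
        next
          case 3 then show ?thesis using xC unfolding Xb_def by blast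
        qed
      qed
      have "x \<notin> set k" "x \<in> C" if "x \<in> Xc" for x using that by (auto simp: Xc_def X2_def Xb_def)
      then show "Xc \<inter> insert p0 (set Q) = {}" using Q2 C(2) P p0P(1) by blast
      show "\<exists>p. p \<notin> insert p0 (set Q) \<and> E p x \<and> (\<exists>z\<in>insert p0 (set Q). E p z)" if x: "x \<in> Xc" for x
      proof -
        have "x \<in> X2" using x by (simp add: Xc_def)
        then obtain p where pp: "p \<in> P" "E p x" "\<forall>z\<in>Z. \<not> E p z" "\<exists>z\<in>set R. E p z" and xC: "x \<in> C" unfolding X2_def by blast
        then have p2: "p \<in> P2" by (auto simp: P2_def)
        have "p \<noteq> p0" using x pp xC by (auto simp: Xc_def Xa_def)
        moreover have "p \<notin> set Q" using Qset P pp(1) by blast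
        moreover have "R ! zl p \<in> set Q"
        proof -
          have "drop z0 R ! (zl p - z0) = R ! zl p" "zl p - z0 < length (drop z0 R)"
            using zl(1)[OF p2] p0(2)[OF p2] by (simp_all add: z0_def)
          then have "R ! zl p \<in> set (drop z0 R)" using nth_mem by metis
          then show ?thesis by (simp add: Q_def)
        qed
        ultimately show ?thesis using pp(2) zl(2)[OF p2] by blast
      qed
    qed
    have "col (Xa \<union> Xb \<union> Xc) (1 + 2 + 13)" by (intro col_Un ca cb cc)
    moreover have "X2 \<subseteq> Xa \<union> Xb \<union> Xc" by (auto simp: Xc_def)
    ultimately show ?thesis by (rule_tac col_mono) auto
  qed
  have "col (X1 \<union> X2) (13 + 16)" by (rule col_Un[OF c1 c2])
  moreover have "{x \<in> C. \<exists>p\<in>P. E p x \<and> (\<exists>z\<in>set R \<union> set A1 \<union> set A2 \<union> {u}. E p z)} \<subseteq> X1 \<union> X2"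
    unfolding X1_def X2_def Z by blast
  ultimately show ?thesis by (rule_tac col_mono) auto
qed

text \<open>Take a shortest path from \<open>pa\<close> to \<open>px\<close>. If \<open>pt\<close>
  sees it at positions of both parities, this is the second alternative; if at one parity only, the
  path serves as \<open>W\<close>. If \<open>pt\<close> does not see it, attach a shortest
  connection from \<open>pt\<close>, ending in a vertex \<open>c\<close> next to the path. When
  \<open>c\<close> has several neighbours on the path, reroute the path through \<open>c\<close>, so
  that the result is an induced tree.\<close>

lemma connecting_tree_or_path:
  assumes U: "con U" and pU: "pa \<notin> U" "px \<notin> U" "pt \<notin> U"
    and ne: "pt \<noteq> pa" "pt \<noteq> px" and nb: "\<exists>u\<in>U. E pa u" "\<exists>u\<in>U. E px u" "\<exists>u\<in>U. E pt u"
  shows "(\<exists>W lo. con W \<and> bip W lo \<and> W \<subseteq> insert pa (insert px U) \<and> pa \<in> W \<and> px \<in> W \<and> (\<exists>w\<in>W. E pt w) \<and> (\<forall>w\<in>W. E pt w \<longrightarrow> lo w)) \<or>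
    (\<exists>m i j. ipath m \<and> m \<noteq> [] \<and> hd m = pa \<and> last m = px \<and> set m \<subseteq> insert pa (insert px U) \<and> i < j \<and> j < length m \<and> odd (j - i) \<and>
       E pt (m ! i) \<and> E pt (m ! j))"
    (is "?A \<or> ?B")
proof -
  have s: "E a b \<longleftrightarrow> E b a" for a b using symE by blast
  have c1: "con (insert px U)" using con_insert[OF U] nb(2) by blast
  obtain ua where ua: "ua \<in> U" "E pa ua" using nb(1) by blast
  have "con (insert pa (insert px U))" using con_insert[OF c1, of ua pa] ua by blast
  then obtain m where m: "geod (insert pa (insert px U)) pa {px} m"
    using geod_exists[of "insert pa (insert px U)" pa px "{px}"] by blast
  have mi: "ipath m" using geod_ipath[OF m] .
  have mm: "m \<noteq> []" "hd m = pa" "set m \<subseteq> insert pa (insert px U)" "last m = px" using geodD[OF m] by auto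
  have mc: "con (set m)" using ipath_con[OF mi mm(1)] .
  have pam: "pa \<in> set m" "px \<in> set m" using mm hd_in_set last_in_set by metis+
  have ptm: "pt \<notin> set m" using mm(3) pU ne by blast
  have dm: "distinct m" using ipath_distinct[OF mi] .
  show ?thesis
  proof (cases "\<exists>v\<in>set m. E pt v")
    case True
    then obtain i where i: "i < length m" "E pt (m ! i)" by (auto simp: in_set_conv_nth)
    show ?thesis
    proof (cases "\<forall>j<length m. E pt (m ! j) \<longrightarrow> even j = even i")
      case T: True
      have "lo" if "w \<in> set m" "E pt w" "lo = (even (pos m w) = even i)" for w lo
        using T pos_in[OF dm that(1)] that by auto
      then have ?A using mc ipath_bip[OF mi, of "even i"] mm pam True
        by (intro exI[of _ "set m"] exI[of _ "\<lambda>v. even (pos m v) = even i"]) auto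
      then show ?thesis by blast
    next
      case False
      then obtain j where j: "j < length m" "E pt (m ! j)" "even j \<noteq> even i" by blast
      have ?B
      proof (cases "i < j")
        case True
        then show ?thesis using mi mm j i odd_gap[of i j] by (intro exI[of _ m] exI[of _ i] exI[of _ j]) auto
      next
        case False
        then have "j < i" using j by (cases "i = j") auto
        then show ?thesis using mi mm j i odd_gap[of j i] by (intro exI[of _ m] exI[of _ j] exI[of _ i]) auto
      qed
      then show ?thesis by blast
    qed
  next
    case False
    define T where "T = {v \<in> U. \<exists>w\<in>set m. E v w}"
    have uaT: "ua \<in> T" using ua s pam by (auto simp: T_def)
    have "con (insert pt U)" using con_insert[OF U] nb(3) by blast
    then obtain k where k: "geod (insert pt U) pt T k" using geod_exists[of "insert pt U" pt ua T] ua uaT by blast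
    have ki: "ipath k" using geod_ipath[OF k] .
    have kk: "k \<noteq> []" "hd k = pt" "set k \<subseteq> insert pt U" "last k \<in> T" using geodD[OF k] by auto
    have kl: "v \<in> set k \<Longrightarrow> v \<in> T \<Longrightarrow> v = last k" for v using geod_only_last[OF k] by blast
    obtain l where kp: "k = pt # l" using kk by (cases k) auto
    have l: "l \<noteq> []" using kk(4) kp pU by (auto simp: T_def)
    have li: "ipath l" "pt \<notin> set l" "\<And>y. y \<in> set l \<Longrightarrow> E pt y \<longleftrightarrow> y = hd l" using ki unfolding kp ipath_Cons by auto
    have lU: "set l \<subseteq> U" using kk(3) li(2) kp by auto
    have lt: "v \<in> set l \<Longrightarrow> v \<in> T \<Longrightarrow> v = last l" for v using kl kp l by auto
    define c where "c = last l"
    have cl: "c \<in> set l" "c \<in> T" "c \<in> U" using l kk(4) kp lU by (auto simp: c_def)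
    have lm: "set l \<inter> set m = {}"
    proof (rule ccontr)
      assume "set l \<inter> set m \<noteq> {}"
      then obtain v where v: "v \<in> set l" "v \<in> set m" by blast
      then obtain i where i: "i < length l" "v = l ! i" by (auto simp: in_set_conv_nth)
      have e: "E (k ! i) v" using ipath_nth[OF ki, of i "Suc i"] i kp by simp
      show False
      proof (cases i)
        case 0
        then show ?thesis using e v False kp by auto
      next
        case (Suc i')
        then have e': "E (l ! i') v" "l ! i' \<in> set l" using e i kp by auto
        then have "l ! i' \<in> T" using v lU by (auto simp: T_def)
        then have "l ! i' = l ! (length l - 1)" using lt e' l by (simp add: last_conv_nth)
        then have "i' = length l - 1" using ipath_distinct[OF li(1)] i Suc by (simp add: nth_eq_iff_index_eq)
        then show False using i Suc by simp
      qed
    qed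
    have bl: "\<not> E v w" if "v \<in> set l" "v \<noteq> c" "w \<in> set m" for v w
      using lt[OF that(1)] that lU unfolding T_def c_def by blast
    define I where "I = {i. i < length m \<and> E c (m ! i)}"
    have fI: "finite I" by (simp add: I_def)
    have neI: "I \<noteq> {}" using cl by (auto simp: T_def I_def in_set_conv_nth)
    define i0 i1 where "i0 = Min I" and "i1 = Max I"
    have i0: "i0 \<in> I" "\<And>i. i \<in> I \<Longrightarrow> i0 \<le> i" and i1: "i1 \<in> I" "\<And>i. i \<in> I \<Longrightarrow> i \<le> i1"
      using fI neI by (auto simp: i0_def i1_def)
    have fin: ?A if W: "con W" "bip W lo" "W \<subseteq> insert pa (insert px U)" "pa \<in> W" "px \<in> W" "hd l \<in> W" "W \<subseteq> set m \<union> set l" for W lo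
    proof -
      have "w = hd l" if "w \<in> W" "E pt w" for w using that W(7) False li(3) by blast
      moreover have "E pt (hd l)" using li(3)[of "hd l"] l by simp
      moreover have "bip W (\<lambda>v. lo v = lo (hd l))" by (rule bip_flip[OF W(2)])
      ultimately have "con W \<and> bip W (\<lambda>v. lo v = lo (hd l)) \<and> W \<subseteq> insert pa (insert px U) \<and> pa \<in> W \<and> px \<in> W \<and> (\<exists>w\<in>W. E pt w) \<and>
          (\<forall>w\<in>W. E pt w \<longrightarrow> lo w = lo (hd l))" using W by metis
      then show ?A by (rule_tac exI[of _ W], rule_tac exI[of _ "\<lambda>v. lo v = lo (hd l)"])
    qed
    have lc: "con (set l)" using ipath_con[OF li(1) l] .
    show ?thesis
    proof (cases "i0 = i1")
      case True
      have e: "a = m ! i0 \<and> b = c" if ab: "a \<in> set m" "b \<in> set l" "E a b" for a b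
      proof -
        have bc: "b = c" using bl[of b a] ab s by blast
        obtain i where i: "i < length m" "a = m ! i" using ab(1) by (auto simp: in_set_conv_nth)
        then have "i \<in> I" using ab bc s by (auto simp: I_def)
        then have "i = i0" using i0(2) i1(2) True by (metis le_antisym)
        then show ?thesis using bc i by simp
      qed
      have "\<exists>lo. bip (set m \<union> set l) lo"
        by (rule bip_join[OF ipath_bip[OF mi] ipath_bip[OF li(1)]]) (use lm e in auto)
      then obtain lo where lo: "bip (set m \<union> set l) lo" by blast
      have "con (set m \<union> set l)"
        by (rule con_Un[OF mc lc, of "m ! i0" c]) (use i0 cl s in \<open>auto simp: I_def\<close>)
      then have ?A by (rule fin[OF _ lo]) (use mm pam lU l in auto)
      then show ?thesis by blast
    next
      case F: False
      have i01: "i0 < i1" "i1 < length m" using F i0(2)[OF i1(1)] i1(1) by (auto simp: I_def)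
      have ec: "E c (m ! i0)" "E c (m ! i1)" using i0 i1 by (auto simp: I_def)
      \<comment> \<open>Consecutive first and last neighbours of \<open>c\<close> would form a
        triangle with it. The gap makes the rerouted path through \<open>c\<close> induced.\<close>
      have i2: "Suc i0 < i1"
      proof (rule ccontr)
        assume "\<not> ?thesis"
        then have "i1 = Suc i0" using i01 by simp
        then have "E (m ! i0) (m ! i1)" using ipath_nth[OF mi, of i0 i1] i01 by simp
        then show False using no_tri[of c "m ! i0" "m ! i1"] ec s by blast
      qed
      define L where "L = take (Suc i0) m"
      define R where "R = drop i1 m"
      have Ln: "L \<noteq> []" "last L = m ! i0" using i01 by (auto simp: L_def take_Suc_conv_app_nth)
      have Rn: "R \<noteq> []" "hd R = m ! i1" using i01 by (auto simp: R_def hd_drop_conv_nth)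
      have LR: "set L \<subseteq> set m" "set R \<subseteq> set m" by (auto simp: L_def R_def dest: in_set_takeD in_set_dropD)
      have Li: "ipath L" "ipath R" 
        using mi ipath_append[of "take (Suc i0) m" "drop (Suc i0) m"] ipath_append[of "take i1 m" "drop i1 m"] by (auto simp: L_def R_def)
      have Lx: "\<exists>i\<le>i0. v = m ! i" if "v \<in> set L" for v using that by (auto simp: L_def in_set_conv_nth less_Suc_eq_le)
      have Rx: "\<exists>i\<ge>i1. i < length m \<and> v = m ! i" if v: "v \<in> set R" for v
      proof -
        obtain i where "i < length m - i1" "v = m ! (i1 + i)" using v by (auto simp: R_def in_set_conv_nth)
        then show ?thesis by (intro exI[of _ "i1 + i"]) auto
      qed
      have cm: "c \<notin> set m" using lm cl by blast
      have Rc: "E c v \<longleftrightarrow> v = hd R" if v: "v \<in> set R" for v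
      proof -
        obtain i where i: "i1 \<le> i" "i < length m" "v = m ! i" using Rx[OF v] by blast
        show ?thesis
        proof
          assume "E c v"
          then have "i \<in> I" using i by (simp add: I_def)
          then have "i = i1" using i(1) i1(2) by (metis le_antisym)
          then show "v = hd R" using i Rn by simp
        next
          assume "v = hd R" then show "E c v" using ec Rn by simp
        qed
      qed
      have Lc: "E v c \<longleftrightarrow> v = last L" if v: "v \<in> set L" for v
      proof -
        obtain i where i: "i \<le> i0" "v = m ! i" using Lx[OF v] by blast
        then have "i < length m" using i01 by simp
        show ?thesis
        proof
          assume "E v c"
          then have "i \<in> I" using i s \<open>i < length m\<close> by (simp add: I_def)
          then have "i = i0" using i(1) i0(2) by (metis le_antisym)
          then show "v = last L" using i Ln by simp
        next
          assume "v = last L" then show "E v c" using ec Ln s by simp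
        qed
      qed
      have LRe: "\<not> E v w \<and> v \<noteq> w" if v: "v \<in> set L" and w: "w \<in> set R" for v w
      proof -
        obtain i where i: "i \<le> i0" "v = m ! i" using Lx[OF v] by blast
        obtain j where j: "i1 \<le> j" "j < length m" "w = m ! j" using Rx[OF w] by blast
        show ?thesis using ipath_nth[OF mi, of i j] i j i2 dm by (auto simp: nth_eq_iff_index_eq)
      qed
      have cR: "ipath (c # R)" using Li Rc cm LR by (auto simp: ipath_Cons)
      have mu: "ipath (L @ c # R)" unfolding ipath_append
        using Li(1) cR LRe Lc cm LR by auto
      have pL: "pa \<in> set L" "px \<in> set R"
      proof -
        have "L = hd m # take i0 (tl m)" using mm(1) by (cases m) (auto simp: L_def)
        then show "pa \<in> set L" using mm(2) by simp
        have "last R = last m" using i01 by (simp add: R_def)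
        then show "px \<in> set R" using mm(4) Rn(1) last_in_set by metis
      qed
      have mus: "set (L @ c # R) \<subseteq> insert pa (insert px U)" "set (L @ c # R) \<subseteq> set m \<union> set l" using LR mm(3) cl by auto
      have muc: "con (set (L @ c # R))" using ipath_con[OF mu] by simp
      obtain l' where l': "l = l' @ [c]" using l by (cases l rule: rev_cases) (auto simp: c_def)
      have l'i: "ipath l'" "c \<notin> set l'" "\<And>y. y \<in> set l' \<Longrightarrow> E y c \<longleftrightarrow> y = last l'" using li(1) unfolding l' ipath_append by auto
      show ?thesis
      proof (cases "l' = []")
        case True
        then have "?A" using fin[OF muc ipath_bip[OF mu]] mus pL l' by auto
        then show ?thesis by blast
      next
        case Fl: False
        have e: "a = c \<and> b = last l'" if ab: "a \<in> set (L @ c # R)" "b \<in> set l'" "E a b" for a b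
        proof (cases "a = c")
          case True then show ?thesis using l'i(3)[OF ab(2)] ab s by blast
        next
          case False
          then have "a \<in> set m" using ab(1) LR by auto
          moreover have "b \<in> set l" "b \<noteq> c" using ab(2) l' l'i(2) by auto
          ultimately show ?thesis using bl ab(3) s by blast
        qed
        have dj: "set (L @ c # R) \<inter> set l' = {}" using lm LR l' l'i(2) by auto
        have "\<exists>lo. bip (set (L @ c # R) \<union> set l') lo"
          by (rule bip_join[OF ipath_bip[OF mu] ipath_bip[OF l'i(1)] dj]) (rule e)
        then obtain lo where lo: "bip (set (L @ c # R) \<union> set l') lo" by blast
        have "E c (last l')" using l'i(3)[of "last l'"] Fl s by simp
        then have cn: "con (set (L @ c # R) \<union> set l')"
          by (rule_tac con_Un[OF muc ipath_con[OF l'i(1) Fl], of c "last l'"]) (use Fl in auto)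
        have "hd l \<in> set l'" using l' Fl by simp
        then have ?A by (rule_tac fin[OF cn lo]) (use mus pL l' lU in auto)
        then show ?thesis by blast
      qed
    qed
  qed
qed

end

section \<open>Ropes\<close>

text \<open>The rope is \<open>B e, Q1, A1 or A2, Q2, F d\<close>, with arcs of free parity at both ends. Its ends are joined
  through \<open>W\<close>, and \<open>pt\<close> has a contact on the arc \<open>A2\<close> at an even position and touches \<open>W\<close>.\<close>
locale rope = hgraph V E for V :: "'a set" and E +
  fixes W :: "'a set" and lo pt and B F :: "bool \<Rightarrow> 'a list" and Q1 A1 A2 Q2 :: "'a list" and k :: nat
  assumes W: "con W" "bip W lo" "W \<subseteq> V"
    and pt: "pt \<in> V" "pt \<notin> W" "\<exists>w\<in>W. E pt w" "\<And>w. w \<in> W \<Longrightarrow> E pt w \<Longrightarrow> lo w"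
    and r1: "\<And>e d. ipath (B e @ Q1 @ A1 @ Q2 @ F d)" and r2: "\<And>e d. ipath (B e @ Q1 @ A2 @ Q2 @ F d)"
    and ne: "\<And>e. B e \<noteq> []" "\<And>d. F d \<noteq> []" "Q1 \<noteq> []" "Q2 \<noteq> []" "A1 \<noteq> []"
    and parB: "even (length (B True)) \<noteq> even (length (B False))" and parF: "even (length (F True)) \<noteq> even (length (F False))"
    and parA: "even (length A1)" "odd (length A2)"
    and A12: "set A1 \<inter> set A2 = {}" "anti (set A1) (set A2)"
    and sV: "\<And>e. set (B e) \<subseteq> V" "\<And>d. set (F d) \<subseteq> V" "set Q1 \<union> set A1 \<union> set A2 \<union> set Q2 \<subseteq> V"
    and ptn: "\<And>e. pt \<notin> set (B e)" "\<And>d. pt \<notin> set (F d)" "pt \<notin> set Q1 \<union> set A1 \<union> set A2 \<union> set Q2"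
    and ptB: "\<And>e z. z \<in> set (B e) \<Longrightarrow> \<not> E pt z" and ptF: "\<And>d z. z \<in> set (F d) \<Longrightarrow> \<not> E pt z"
    and WD: "\<And>e. W \<inter> set (B e) = {}" "\<And>d. W \<inter> set (F d) = {}" "W \<inter> (set Q1 \<union> set A1 \<union> set A2 \<union> set Q2) = {}"
    and WB: "\<And>w z e. w \<in> W \<Longrightarrow> z \<in> set (B e) \<Longrightarrow> E w z \<Longrightarrow> lo w \<and> z = hd (B e)"
    and WF: "\<And>w z d. w \<in> W \<Longrightarrow> z \<in> set (F d) \<Longrightarrow> E w z \<Longrightarrow> lo w \<and> z = last (F d)"
    and WM: "\<And>w z. w \<in> W \<Longrightarrow> z \<in> set Q1 \<union> set A1 \<union> set A2 \<union> set Q2 \<Longrightarrow> \<not> E w z"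
    and Wt: "\<And>e. \<exists>w\<in>W. E w (hd (B e))" "\<And>d. \<exists>w\<in>W. E w (last (F d))"
    and k: "even k" "2 \<le> k" "k + 2 < length A2" "E pt (A2 ! k)"
begin

lemma parB_choose: "\<exists>e. even (length (B e)) = b"
  using parB by (cases b) (metis (full_types))+

lemma parF_choose: "\<exists>d. even (length (F d)) = b"
  using parF by (cases b) (metis (full_types))+

text \<open>The free arc in \<open>B\<close> brings the first contact to an even position, and the
  free arc in \<open>F\<close> makes the whole path even. Then \<open>pt\<close> alone is a
  forbidden hub for the rim closed through \<open>W\<close>.\<close>

lemma no_parity_switch:
  assumes A: "A = A1 \<or> A = A2" and ij: "i < j" "j < length (Q1 @ A @ Q2)" "odd (j - i)"
    and c: "E pt ((Q1 @ A @ Q2) ! i)" "E pt ((Q1 @ A @ Q2) ! j)"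
  shows False
proof -
  obtain e where e: "even (length (B e)) = even i" using parB_choose by blast
  obtain d where d: "even (length (F d)) = even (length (B e @ Q1 @ A @ Q2))" using parF_choose by blast
  define xs where "xs = B e @ (Q1 @ A @ Q2) @ F d"
  have xi: "ipath xs" using A r1[of e d] r2[of e d] by (auto simp: xs_def)
  have hl: "hd xs = hd (B e)" "last xs = last (F d)" using ne(1)[of e] ne(2)[of d] by (auto simp: xs_def)
  have As: "set A \<subseteq> set A1 \<union> set A2" using A by blast
  have xset: "set xs = set (B e) \<union> (set Q1 \<union> set A \<union> set Q2) \<union> set (F d)" by (auto simp: xs_def)
  have xn: "xs ! (length (B e) + i) = (Q1 @ A @ Q2) ! i" if "i < length (Q1 @ A @ Q2)" for i
    unfolding xs_def by (subst nth_append_length_plus, subst nth_append) (use that in auto)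
  show False
  proof (rule no_odd_hub_path_contacts[of "{pt}" "\<lambda>_. True" W lo xs "length (B e) + i" "length (B e) + j"])
    show "set xs \<subseteq> V" using sV(1)[of e] sV(2)[of d] sV(3) As unfolding xset by blast
    show "even (length xs)" using d by (auto simp: xs_def)
    show "{pt} \<inter> set xs = {}" using ptn(1)[of e] ptn(2)[of d] ptn(3) As unfolding xset by blast
    show "W \<inter> set xs = {}" using WD(1)[of e] WD(2)[of d] WD(3) As unfolding xset by blast
    show "lo w \<and> (z = hd xs \<or> z = last xs)" if "w \<in> W" "z \<in> set xs" "E w z" for w z
    proof -
      have "z \<in> set (B e) \<or> z \<in> set (F d)" using that WM[of w z] As unfolding xset by blast
      then show ?thesis using WB[of w z e] WF[of w z d] that hl by auto
    qed
    show "\<exists>w\<in>W. E w (hd xs)" "\<exists>w\<in>W. E w (last xs)" using Wt(1)[of e] Wt(2)[of d] hl by auto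
    show "\<exists>a\<in>{pt}. E a (xs ! (length (B e) + i))" "\<exists>a\<in>{pt}. E a (xs ! (length (B e) + j))" using c xn ij by auto
    show "even (length (B e) + i)" "odd (length (B e) + j)" using e ij by (auto simp: even_diff_nat)
    show "length (B e) + j < length xs" using ij by (auto simp: xs_def)
  qed (use W pt ij xi in \<open>auto simp: con_sing bip_def irrE\<close>)
qed

lemma contacts_same_parity:
  assumes A: "A = A1 \<or> A = A2" and ij: "i < length (Q1 @ A @ Q2)" "j < length (Q1 @ A @ Q2)"
    and c: "E pt ((Q1 @ A @ Q2) ! i)" "E pt ((Q1 @ A @ Q2) ! j)"
  shows "even i = even j"
proof (rule ccontr)
  assume n: "even i \<noteq> even j"
  consider "i < j" | "j < i" using n by (metis linorder_neqE_nat)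
  then show False
  proof cases
    case 1 then show ?thesis using no_parity_switch[OF A 1 ij(2) odd_gap[OF 1 n] c] by blast
  next
    case 2
    have "odd (i - j)" using odd_gap[OF 2] n by auto
    then show ?thesis using no_parity_switch[OF A 2 ij(1) _ c(2,1)] by blast
  qed
qed

text \<open>Otherwise everything except the odd cycle formed by \<open>A1\<close>, \<open>A2\<close>, the last vertex \<open>q\<close> of \<open>Q1\<close> and the first vertex
  \<open>u\<close> of \<open>Q2\<close> is one hub with contacts at \<open>u\<close>, \<open>q\<close> and in between.\<close>
lemma contact_outside_arcs:
  assumes no: "\<And>z. z \<in> set Q1 \<union> set Q2 \<Longrightarrow> \<not> E pt z" shows False
proof -
  obtain Q1' q where Q1: "Q1 = Q1' @ [q]" using ne(3) by (cases Q1 rule: rev_cases) auto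
  obtain u Q2' where Q2: "Q2 = u # Q2'" using ne(4) by (cases Q2) auto
  \<comment> \<open>With these choices \<open>D\<close> and \<open>G\<close> have an odd number of
    vertices, so their ends at the odd cycle get the same label as their ends at
    \<open>W\<close>.\<close>
  obtain e where e: "even (length (B e)) = even (length Q1)" using parB_choose by blast
  obtain d where d: "even (length (F d)) = even (length Q2)" using parF_choose by blast
  define D where "D = B e @ Q1'"
  define G where "G = Q2' @ F d"
  have s: "E a b \<longleftrightarrow> E b a" for a b using symE by blast
  have DG: "D \<noteq> []" "G \<noteq> []" using ne(1)[of e] ne(2)[of d] by (auto simp: D_def G_def)
  have p1: "ipath (D @ q # A1 @ u # G)" and p2: "ipath (D @ q # A2 @ u # G)"
    using r1[of e d] r2[of e d] by (simp_all add: Q1 Q2 D_def G_def)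
  have Dx: "E x y \<longleftrightarrow> x = last D \<and> y = q" if x: "x \<in> set D" and y: "y \<in> insert q (insert u (set A1 \<union> set A2 \<union> set G))" for x y
  proof (cases "y \<in> set (q # A1 @ u # G)")
    case True then show ?thesis using p1 x unfolding ipath_append[of D "q # A1 @ u # G"] by auto
  next
    case False
    then have "y \<in> set (q # A2 @ u # G)" using y by auto
    then show ?thesis using p2 x unfolding ipath_append[of D "q # A2 @ u # G"] by auto
  qed
  have q1: "ipath ((D @ q # A1 @ [u]) @ G)" "ipath ((D @ q # A2 @ [u]) @ G)" using p1 p2 by simp_all
  have Gx: "E x y \<longleftrightarrow> x = u \<and> y = hd G" if y: "y \<in> set G" and x: "x \<in> insert q (insert u (set A1 \<union> set A2 \<union> set D))" for x y
  proof (cases "x \<in> set (D @ q # A1 @ [u])")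
    case True then show ?thesis using q1(1) y unfolding ipath_append[of "D @ q # A1 @ [u]" G] by auto
  next
    case False
    then have "x \<in> set (D @ q # A2 @ [u])" using x by auto
    then show ?thesis using q1(2) y unfolding ipath_append[of "D @ q # A2 @ [u]" G] by auto
  qed
  have Di: "ipath D" "ipath G" using p1 q1 ipath_append by blast+
  have "ipath (D @ q # A1 @ [u])" "ipath (D @ q # A2 @ [u])"
    using q1 unfolding ipath_append[of "D @ q # A1 @ [u]" G] ipath_append[of "D @ q # A2 @ [u]" G] by blast+
  then have "ipath ((D @ [q]) @ A1 @ [u])" "ipath ((D @ [q]) @ A2 @ [u])" by simp_all
  then have "icyc (last (D @ [q])) (A1 @ u # rev A2)"
    by (rule theta_cyc) (use ne A12 parA k in auto)
  then have cy0: "icyc q (A1 @ u # rev A2)" by simp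
  \<comment> \<open>The cycle is cut at a vertex that is not one of the intended contacts, so that
    \<open>u\<close>, \<open>A2 ! k\<close> and \<open>q\<close> all get positions.\<close>
  define o1 where "o1 = hd A1"
  define xs where "xs = tl A1 @ u # rev A2 @ [q]"
  have A1o: "A1 = o1 # tl A1" using ne(5) by (simp add: o1_def)
  have "icyc q ([] @ o1 # (tl A1 @ u # rev A2))" using cy0 A1o by (metis append_Cons append_Nil)
  from icyc_rotate[OF this] have cy: "icyc o1 xs" by (simp add: xs_def)
  have rim: "insert o1 (set xs) = insert q (insert u (set A1 \<union> set A2))"
    using arg_cong[OF A1o, of set] by (auto simp: xs_def)
  have dis: "set D \<inter> insert q (insert u (set A1 \<union> set A2)) = {}" "set G \<inter> insert q (insert u (set A1 \<union> set A2)) = {}" "set D \<inter> set G = {}"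
    using p1 p2 q1 unfolding ipath_append[of D "q # A1 @ u # G"] ipath_append[of D "q # A2 @ u # G"] ipath_append[of "D @ q # A1 @ [u]" G] ipath_append[of "D @ q # A2 @ [u]" G] by auto
  define H where "H = insert pt (W \<union> set D \<union> set G)"
  \<comment> \<open>The labels of \<open>W\<close> are reversed: its \<open>lo\<close> vertices are
    those that see \<open>pt\<close> and the ends of the rope, and these neighbours have to be low
    in the new hub.\<close>
  define la where "la v = (if v = pt then True else if v \<in> W then \<not> lo v else if v \<in> set D then even (pos D v) else even (pos (rev G) v))" for v
  have Dset: "set D \<subseteq> set (B e) \<union> set Q1" "set G \<subseteq> set Q2 \<union> set (F d)" by (auto simp: D_def G_def Q1 Q2)
  have WDG: "W \<inter> set D = {}" "W \<inter> set G = {}" using WD(1)[of e] WD(2)[of d] WD(3) Dset by blast+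
  have ptDG: "pt \<notin> set D" "pt \<notin> set G" using ptn(1)[of e] ptn(2)[of d] ptn(3) Dset by blast+
  have ptno: "\<not> E pt z" if "z \<in> set D \<union> set G" for z using that ptB ptF no Dset by blast
  have laW: "v \<in> W \<Longrightarrow> la v = (\<not> lo v)" for v using pt by (auto simp: la_def)
  have laD: "v \<in> set D \<Longrightarrow> la v = even (pos D v)" for v using WDG ptDG by (auto simp: la_def)
  have laG: "v \<in> set G \<Longrightarrow> la v = even (pos (rev G) v)" for v using WDG ptDG dis by (auto simp: la_def)
  have lap: "la pt" by (simp add: la_def)
  have dd: "distinct D" "distinct (rev G)" using Di ipath_distinct by auto
  have "pos D (D ! 0) = 0" "pos D (D ! (length D - 1)) = length D - 1" using pos_nth[OF dd(1)] DG by auto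
  then have pD: "pos D (hd D) = 0" "pos D (last D) = length D - 1" using DG by (simp_all add: hd_conv_nth last_conv_nth)
  have "rev G \<noteq> []" using DG by simp
  then have "pos (rev G) (hd (rev G)) = 0" "pos (rev G) (last (rev G)) = length (rev G) - 1"
    using pos_nth[OF dd(2), of 0] pos_nth[OF dd(2), of "length (rev G) - 1"] by (simp_all add: hd_conv_nth last_conv_nth del: rev_is_Nil_conv length_rev)
  then have pG: "pos (rev G) (last G) = 0" "pos (rev G) (hd G) = length G - 1" using DG by (simp_all add: hd_rev last_rev)
  have lpar: "even (length D - 1)" "even (length G - 1)"
  proof -
    have "length D - 1 + 2 = length (B e) + length Q1" using ne(1)[of e] by (cases "B e") (auto simp: D_def Q1)
    then have "even (length D - 1 + 2)" using e by simp
    then show "even (length D - 1)" by simp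
    have "length G - 1 + 2 = length (F d) + length Q2" using ne(2)[of d] by (cases "F d") (auto simp: G_def Q2)
    then have "even (length G - 1 + 2)" using d by simp
    then show "even (length G - 1)" by simp
  qed
  have hdD: "hd D = hd (B e)" "last G = last (F d)" using ne(1)[of e] ne(2)[of d] by (auto simp: D_def G_def)
  have WDe: "lo w \<and> z = hd D" if "w \<in> W" "z \<in> set D" "E w z" for w z
  proof -
    have "z \<in> set (B e)" using that WM[of w z] Dset by blast
    then show ?thesis using WB[OF that(1) _ that(3)] hdD by simp
  qed
  have WGe: "lo w \<and> z = last G" if "w \<in> W" "z \<in> set G" "E w z" for w z
  proof -
    have "z \<in> set (F d)" using that WM[of w z] Dset by blast
    then show ?thesis using WF[OF that(1) _ that(3)] hdD by simp
  qed
  have bH: "bip H la"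
  proof -
    have f1: "la u \<noteq> la v" if "u \<in> W" "v \<in> W" "E u v" for u v using W(2) that laW unfolding bip_def by auto
    have f2: "la u \<noteq> la v" if "u \<in> set D" "v \<in> set D" "E u v" for u v
      using ipath_bip[OF Di(1), of True] that laD unfolding bip_def by auto
    have f3: "la u \<noteq> la v" if "u \<in> set G" "v \<in> set G" "E u v" for u v
    proof -
      have "bip (set (rev G)) (\<lambda>v. even (pos (rev G) v) = True)" by (rule ipath_bip) (use Di ipath_rev in blast)
      then show ?thesis using that laG unfolding bip_def by auto
    qed
    have f4: "la u \<noteq> la v" if "u \<in> W" "v \<in> set D" "E u v" for u v using WDe[OF that] laW laD that pD by auto
    have f5: "la u \<noteq> la v" if "u \<in> W" "v \<in> set G" "E u v" for u v using WGe[OF that] laW laG that pG by auto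
    have f6: "\<not> E u v" if "u \<in> set D" "v \<in> set G" for u v using Dx[of u v] that dis by auto
    have f7: "la pt \<noteq> la v" if "v \<in> W" "E pt v" for v using pt that laW lap by auto
    have fp: "la pt \<noteq> la v" if "v \<in> H" "E pt v" for v using that f7 ptno irrE unfolding H_def by blast
    have fr: "la u \<noteq> la v" if "u \<in> W \<union> set D \<union> set G" "v \<in> W \<union> set D \<union> set G" "E u v" for u v
      using that by (elim UnE) (metis f1 f2 f3 f4 f5 f6 symE)+
    show ?thesis unfolding bip_def
    proof (intro ballI impI)
      fix u v assume uv: "u \<in> H" "v \<in> H" "E u v"
      show "la u \<noteq> la v"
      proof (cases "u = pt \<or> v = pt")
        case True then show ?thesis using fp[of v] fp[of u] uv symE[OF uv(3)] by metis
      next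
        case False then show ?thesis using fr[of u v] uv unfolding H_def by blast
      qed
    qed
  qed
  have cH: "con H"
  proof -
    obtain w1 where w1: "w1 \<in> W" "E w1 (hd D)" using Wt(1)[of e] hdD by auto
    obtain w2 where w2: "w2 \<in> W" "E w2 (last G)" using Wt(2)[of d] hdD by auto
    obtain w3 where w3: "w3 \<in> W" "E pt w3" using pt by blast
    have "con (W \<union> set D)" by (rule con_Un[OF W(1) ipath_con[OF Di(1) DG(1)] w1(1), of "hd D"]) (use w1 DG in auto)
    then have "con ((W \<union> set D) \<union> set G)" by (rule con_Un[OF _ ipath_con[OF Di(2) DG(2)], of _ w2 "last G"]) (use w2 DG in auto)
    then show ?thesis unfolding H_def using con_insert w3 by blast
  qed
  \<comment> \<open>The three positions are those of \<open>u\<close>, \<open>A2 ! k\<close> and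
    \<open>q\<close>. The gaps are \<open>length A2 - k\<close> and \<open>k + 1\<close>, both
    odd.\<close>
  show False
  proof (rule no_odd_hub_cycle_contacts[OF cH bH _ cy, of "length A1 - 1" "length A1 + (length A2 - 1 - k)" "length A1 + length A2"])
    have l1: "1 \<le> length A1" using ne(5) by (cases A1) auto
    have dl: "length (tl A1) = length A1 - 1" by simp
    have x1: "xs ! (length A1 - 1) = u" unfolding xs_def by (metis dl nth_append_length)
    have "xs = (tl A1 @ [u]) @ rev A2 @ [q]" "length (tl A1 @ [u]) = length A1" using l1 by (auto simp: xs_def)
    then have xn: "xs ! (length A1 + i) = (rev A2 @ [q]) ! i" for i by (metis nth_append_length_plus)
    have kl: "length A2 - 1 - k < length A2" "length A2 - Suc (length A2 - 1 - k) = k" using k by auto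
    have x2: "xs ! (length A1 + (length A2 - 1 - k)) = A2 ! k" unfolding xn using kl by (simp add: nth_append rev_nth)
    have x3: "xs ! (length A1 + length A2) = q" unfolding xn by (metis length_rev nth_append_length)
    have "E u (hd G)" "E (last D) q" using Gx[of "hd G" u] Dx[of "last D" q] DG by auto
    then show "\<exists>a\<in>H. E a (xs ! (length A1 - 1))" "\<exists>a\<in>H. E a (xs ! (length A1 + (length A2 - 1 - k)))" "\<exists>a\<in>H. E a (xs ! (length A1 + length A2))"
      unfolding x1 x2 x3 using DG k s unfolding H_def by auto
    show "odd (length A1 + (length A2 - 1 - k) - (length A1 - 1))"
      "odd (length A1 + length A2 - (length A1 + (length A2 - 1 - k)))" using l1 k parA by presburger+
    show "length A1 - 1 < length A1 + (length A2 - 1 - k)" "length A1 + (length A2 - 1 - k) < length A1 + length A2" using l1 k by auto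
    show "length A1 + length A2 < length xs" using l1 by (simp add: xs_def)
    have "u \<in> V" "q \<in> V" using sV(3) by (auto simp: Q1 Q2)
    then have rV: "insert o1 (set xs) \<subseteq> V" unfolding rim using sV(3) by auto
    then show "set xs \<subseteq> V" "o1 \<in> V" by auto
    show "H \<subseteq> V" using W pt sV(1)[of e] sV(2)[of d] sV(3) Dset unfolding H_def by blast
    have "q \<in> set Q1" "u \<in> set Q2" by (auto simp: Q1 Q2)
    then have "H \<inter> insert q (insert u (set A1 \<union> set A2)) = {}" unfolding H_def using dis WD(3) ptn(3) by auto
    then show "H \<inter> set xs = {}" "o1 \<notin> H" using rim by blast+
    show "la a" if as: "a \<in> H" "z \<in> insert o1 (set xs)" "E a z" for a z
    proof -
      have z: "z \<in> insert q (insert u (set A1 \<union> set A2))" using as rim by blast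
      consider "a = pt" | "a \<in> W" | "a \<in> set D" | "a \<in> set G" using as unfolding H_def by blast
      then show ?thesis
      proof cases
        case 1 then show ?thesis using lap by simp
      next
        case 2 then show ?thesis using WM[of a z] z as \<open>q \<in> set Q1\<close> \<open>u \<in> set Q2\<close> by auto
      next
        case 3
        then have "a = last D" using Dx[of a z] z as by auto
        then show ?thesis using laD[OF 3] pD lpar by simp
      next
        case 4
        then have "a = hd G" using Gx[of a z] z as s by auto
        then show ?thesis using laG[OF 4] pG lpar by simp
      qed
    qed
  qed
qed

text \<open>Otherwise \<open>pt\<close>, \<open>W\<close>, the rope \<open>D\<close> through \<open>A1\<close> up to its last vertex \<open>e\<close>, and \<open>e\<close> with the rope \<open>G\<close> from the last
  contact on \<open>A2\<close> form a contracted complete graph on four vertices.\<close>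
lemma contact_on_right:
  assumes cl: "a < length Q1" "E pt (Q1 ! a)" and no: "\<And>z. z \<in> set Q2 \<Longrightarrow> \<not> E pt z" shows False
proof -
  obtain A1' e where A1: "A1 = A1' @ [e]" using ne(5) by (cases A1 rule: rev_cases) auto
  obtain u Q2' where Q2: "Q2 = u # Q2'" using ne(4) by (cases Q2) auto
  have s: "E a b \<longleftrightarrow> E b a" for a b using symE by blast
  have Q1_nth: "(Q1 @ A @ Q2) ! i = Q1 ! i" if "i < length Q1" for i A using that by (simp add: nth_append)
  have A_nth: "(Q1 @ A @ Q2) ! (length Q1 + i) = A ! i" if "i < length A" for i A using that by (simp add: nth_append)
  have ea: "even a = even (length Q1 + k)"
    by (rule contacts_same_parity[of A2]) (use cl k Q1_nth[OF cl(1)] A_nth[of k A2] in auto)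
  have par1: "even i = even (length Q1)" if "i < length (Q1 @ A1 @ Q2)" "E pt ((Q1 @ A1 @ Q2) ! i)" for i
    using contacts_same_parity[of A1 i a] that cl Q1_nth[OF cl(1)] ea k by auto
  \<comment> \<open>Starting \<open>G\<close> at the last contact on \<open>A2\<close> makes
    \<open>hd G\<close> the only contact on \<open>G\<close>. From \<open>2 \<le> k\<close> this
    contact is not the first vertex of the arc, so \<open>G\<close> is not attached to
    \<open>Q1\<close>.\<close>
  define I where "I = {i. i < length A2 \<and> E pt (A2 ! i)}"
  define m where "m = Max I"
  have fI: "finite I" "k \<in> I" using k by (auto simp: I_def)
  have m: "m \<in> I" "\<And>i. i \<in> I \<Longrightarrow> i \<le> m" unfolding m_def using Max_in[of I] Max_ge[of I] fI by blast+
  have mk: "k \<le> m" "m < length A2" "E pt (A2 ! m)" using m fI by (auto simp: I_def)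
  have "even (length Q1 + m) = even a"
    by (rule contacts_same_parity[of A2]) (use cl mk Q1_nth[OF cl(1)] A_nth[of m A2] in auto)
  then have em: "even m" using ea k by auto
  \<comment> \<open>These parities make both ends of \<open>D\<close> and of \<open>G\<close> low,
    and \<open>u\<close>, at an odd position of \<open>G\<close>, high. The edge \<open>e u\<close>
    is then low-high, and \<open>e\<close> joins the class of \<open>G\<close>.\<close>
  obtain ee where ee: "even (length (B ee)) = even (length Q1)" using parB_choose by blast
  obtain d where d: "even (length (F d)) = even (length Q2)" using parF_choose by blast
  define D where "D = B ee @ Q1 @ A1'"
  define G where "G = drop m A2 @ Q2 @ F d"
  have DG: "D \<noteq> []" "G \<noteq> []" using ne(1)[of ee] ne(2)[of d] by (auto simp: D_def G_def)
  have p1: "ipath (B ee @ Q1 @ A1 @ Q2 @ F d)" and p2: "ipath (B ee @ Q1 @ A2 @ Q2 @ F d)" using r1 r2 by auto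
  have p1': "ipath (D @ [e] @ Q2 @ F d)" using p1 by (simp add: D_def A1)
  have "ipath ((B ee @ Q1 @ take m A2) @ G)" unfolding G_def using p2 by (metis append.assoc append_take_drop_id)
  then have Gi: "ipath G" using ipath_append by blast
  have Di: "ipath D" using p1' ipath_append by blast
  have De: "E x e \<longleftrightarrow> x = last D" if "x \<in> set D" for x using p1' that unfolding ipath_append[of D] by auto
  have DR: "\<not> E x y" if "x \<in> set D" "y \<in> set Q2 \<union> set (F d)" for x y
    using p1' that unfolding ipath_append[of D] ipath_Cons append_Cons append_Nil by auto
  have p1'': "ipath ((D @ [e]) @ Q2 @ F d)" using p1' by simp
  have eR: "E e y \<longleftrightarrow> y = u" if "y \<in> set Q2 \<union> set (F d)" for y
    using p1'' that unfolding ipath_append[of "D @ [e]"] by (auto simp: Q2)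
  have eD: "e \<notin> set D" "e \<notin> set Q2 \<union> set (F d)" "set D \<inter> (set Q2 \<union> set (F d)) = {}"
    using p1' p1'' unfolding ipath_append[of D] ipath_append[of "D @ [e]"] by auto
  have p2': "ipath ((B ee @ Q1) @ A2 @ Q2 @ F d)" using p2 by simp
  have dA2: "distinct A2" using p2 ipath_distinct by force
  have hdA2: "hd A2 \<notin> set (drop m A2)"
  proof
    assume "hd A2 \<in> set (drop m A2)"
    then obtain i where "i < length A2 - m" "A2 ! (m + i) = hd A2" by (auto simp: in_set_conv_nth)
    moreover have "hd A2 = A2 ! 0" using k by (cases A2) auto
    ultimately have "A2 ! (m + i) = A2 ! 0" "m + i < length A2" by simp_all
    moreover have "0 < length A2" using k(3) by linarith
    ultimately have "m + i = 0" using nth_eq_iff_index_eq[OF dA2, of "m + i" 0] by simp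
    then show False using mk k by simp
  qed
  have dsub: "set (drop m A2) \<subseteq> set A2" by (rule set_drop_subset)
  have k0: "A2 \<noteq> []" using k by auto
  have BLA: "\<not> E x y" "x \<noteq> y" if "x \<in> set (B ee) \<union> set Q1" "y \<in> set (drop m A2)" for x y
    using p2' that hdA2 dsub k0 unfolding ipath_append[of "B ee @ Q1"] by auto
  have DGe: "\<not> E x y \<and> x \<noteq> y" if x: "x \<in> set D" and y: "y \<in> set G" for x y
  proof -
    consider "y \<in> set Q2 \<union> set (F d)" | "y \<in> set (drop m A2)" "x \<in> set (B ee) \<union> set Q1" | "y \<in> set (drop m A2)" "x \<in> set A1'"
      using x y unfolding D_def G_def by auto
    then show ?thesis
    proof cases
      case 1 then show ?thesis using DR x eD by blast
    next
      case 2 then show ?thesis using BLA by blast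
    next
      case 3 then show ?thesis using A12 dsub unfolding A1 anti_def by auto
    qed
  qed
  have eG: "E e y \<longleftrightarrow> y = u" "y \<noteq> e" if y: "y \<in> set G" for y
  proof -
    have uM: "u \<in> set Q2" by (simp add: Q2)
    have uA: "u \<notin> set A2" using p2 uM unfolding ipath_append by auto
    consider "y \<in> set Q2 \<union> set (F d)" | "y \<in> set A2" using y dsub unfolding G_def by auto
    then have "(E e y \<longleftrightarrow> y = u) \<and> y \<noteq> e"
    proof cases
      case 1 then show ?thesis using eR eD by blast
    next
      case 2 then show ?thesis using A12 uA unfolding A1 anti_def by auto
    qed
    then show "E e y \<longleftrightarrow> y = u" "y \<noteq> e" by auto
  qed
  define Y where "Y = insert pt (W \<union> set D \<union> insert e (set G))"
  define \<pi> :: "'a \<Rightarrow> nat" where "\<pi> v = (if v = pt then 0 else if v \<in> W then 1 else if v \<in> set D then 2 else 3)" for v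
  define low where "low v = (if v = pt \<or> v = e then True else if v \<in> W then lo v else if v \<in> set D then even (pos D v) else even (pos G v))" for v
  have Dset: "set D \<subseteq> set (B ee) \<union> set Q1 \<union> set A1" "set G \<subseteq> set A2 \<union> set Q2 \<union> set (F d)" "e \<in> set A1" using dsub by (auto simp: D_def G_def A1)
  have WDG: "W \<inter> set D = {}" "W \<inter> set G = {}" "e \<notin> W" using WD(1)[of ee] WD(2)[of d] WD(3) Dset by blast+
  have ptDG: "pt \<notin> set D" "pt \<notin> set G" "pt \<noteq> e" using ptn(1)[of ee] ptn(2)[of d] ptn(3) Dset by blast+
  have v: "\<pi> pt = 0" "low pt" "\<pi> e = 3" "low e" using ptDG WDG eD by (auto simp: \<pi>_def low_def)
  have vW: "\<pi> v = 1" "low v = lo v" if "v \<in> W" for v using that pt WDG by (auto simp: \<pi>_def low_def)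
  have vD: "\<pi> v = 2" "low v = even (pos D v)" if "v \<in> set D" for v using that ptDG WDG eD by (auto simp: \<pi>_def low_def)
  have vG: "\<pi> v = 3" "low v = even (pos G v)" if g: "v \<in> set G" for v
  proof -
    have "v \<noteq> pt" "v \<notin> W" "v \<notin> set D" "v \<noteq> e" using g ptDG WDG DGe eG by blast+
    then show "\<pi> v = 3" "low v = even (pos G v)" by (auto simp: \<pi>_def low_def)
  qed
  have dd: "distinct D" "distinct G" using Di Gi ipath_distinct by auto
  have pD: "pos D (hd D) = 0" "pos D (last D) = length D - 1" using DG pos_nth[OF dd(1), of 0] pos_nth[OF dd(1), of "length D - 1"] by (simp_all add: hd_conv_nth last_conv_nth)
  have pG: "pos G (hd G) = 0" "pos G (last G) = length G - 1" using DG pos_nth[OF dd(2), of 0] pos_nth[OF dd(2), of "length G - 1"] by (simp_all add: hd_conv_nth last_conv_nth)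
  have eveD: "even (length D - 1)"
  proof -
    have "length D - 1 + 2 = length (B ee) + length Q1 + length A1" using ne(1)[of ee] by (cases "B ee") (auto simp: D_def A1)
    then have "even (length D - 1 + 2)" using ee parA by simp
    then show ?thesis by simp
  qed
  have eveG: "even (length G - 1)"
  proof -
    have "length G - 1 + 1 = (length A2 - m) + length Q2 + length (F d)" using ne(2)[of d] by (cases "F d") (auto simp: G_def)
    then show ?thesis using d parA em mk by presburger
  qed
  have posu: "odd (pos G u)" "u \<in> set G"
  proof -
    have "G ! (length A2 - m) = u" "length A2 - m < length G" by (auto simp: G_def nth_append Q2)
    then have "pos G u = length A2 - m" using pos_nth[OF dd(2)] by metis
    then show "odd (pos G u)" using parA em mk by (simp add: even_diff_nat)
    show "u \<in> set G" by (simp add: G_def Q2)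
  qed
  have hdG: "hd G = A2 ! m" using mk by (simp add: G_def hd_append hd_drop_conv_nth)
  have hdD: "hd D = hd (B ee)" "last G = last (F d)" using ne(1)[of ee] ne(2)[of d] by (auto simp: D_def G_def)
  have ptD: "even (pos D z)" if z: "z \<in> set D" "E pt z" for z
  proof -
    define i where "i = pos D z"
    have i: "i < length D" "D ! i = z" using pos_in[OF dd(1) z(1)] by (auto simp: i_def)
    have "\<not> i < length (B ee)" using i z ptB[of "z" ee] by (auto simp: D_def nth_append)
    define i' where "i' = i - length (B ee)"
    have ii: "i = length (B ee) + i'" using \<open>\<not> i < length (B ee)\<close> by (simp add: i'_def)
    have "i' < length (Q1 @ A1')" using i ii by (simp add: D_def)
    moreover have "(Q1 @ A1') ! i' = z" using i(2) unfolding ii D_def by simp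
    ultimately have "(Q1 @ A1 @ Q2) ! i' = z" "i' < length (Q1 @ A1 @ Q2)"
      using nth_append[of "Q1 @ A1'" "[e] @ Q2" i'] by (auto simp: A1)
    then have "even i' = even (length Q1)" using par1[of i'] z by simp
    then show ?thesis using ee ii i_def by simp
  qed
  have ptG: "z = hd G" if z: "z \<in> set G" "E pt z" for z
  proof -
    have "z \<in> set (drop m A2)" using z no ptF unfolding G_def by auto
    then obtain i where i: "i < length A2 - m" "z = A2 ! (m + i)" by (auto simp: in_set_conv_nth)
    then have "m + i \<in> I" using z by (auto simp: I_def)
    then have "i = 0" using m(2)[of "m + i"] by simp
    then show ?thesis using i hdG by simp
  qed
  define ok where "ok u v = ((low u \<or> low v) \<and> (low u \<and> low v \<longleftrightarrow> \<pi> u \<noteq> \<pi> v))" for u v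
  have ok_sym: "ok u v \<Longrightarrow> ok v u" for u v by (auto simp: ok_def)
  have g1: "ok x y" if "x \<in> W" "y \<in> W" "E x y" for x y using W(2) that vW unfolding bip_def ok_def by auto
  have g2: "ok x y" if "x \<in> set D" "y \<in> set D" "E x y" for x y
    using ipath_bip[OF Di, of True] that vD unfolding bip_def ok_def by auto
  have g3: "ok x y" if "x \<in> set G" "y \<in> set G" "E x y" for x y
    using ipath_bip[OF Gi, of True] that vG unfolding bip_def ok_def by auto
  have g4: "ok pt y" if "y \<in> W" "E pt y" for y using that pt vW v unfolding ok_def by auto
  have g5: "ok pt y" if "y \<in> set D" "E pt y" for y using that ptD vD v unfolding ok_def by auto
  have g6: "ok pt y" if "y \<in> set G" "E pt y" for y using ptG[OF that] that vG v pG unfolding ok_def by auto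
  have g7: "ok pt e" using v unfolding ok_def by auto
  have g8: "ok x y" if "x \<in> W" "y \<in> set D" "E x y" for x y
  proof -
    have "y \<in> set (B ee)" using that WM[of x y] Dset by blast
    then have "lo x" "y = hd D" using WB[OF that(1) _ that(3)] hdD by auto
    then show ?thesis using that vW vD pD unfolding ok_def by auto
  qed
  have g9: "ok x y" if "x \<in> W" "y \<in> set G" "E x y" for x y
  proof -
    have "y \<in> set (F d)" using that WM[of x y] Dset by blast
    then have "lo x" "y = last G" using WF[OF that(1) _ that(3)] hdD by auto
    then show ?thesis using that vW vG pG eveG unfolding ok_def by auto
  qed
  have g10: "\<not> E x e" if "x \<in> W" for x using that WM[of x e] Dset by blast
  have g11: "ok x e" if "x \<in> set D" "E x e" for x
    using De[OF that(1)] that vD v pD eveD unfolding ok_def by auto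
  have g12: "ok e x" if "x \<in> set G" "E e x" for x
    using eG(1)[OF that(1)] that vG v posu unfolding ok_def by auto
  have ok: "ok x y" if xy: "x \<in> Y" "y \<in> Y" "E x y" for x y
  proof -
    have yx: "E y x" using xy s by blast
    have cs: "x = pt \<or> x \<in> W \<or> x \<in> set D \<or> x = e \<or> x \<in> set G" "y = pt \<or> y \<in> W \<or> y \<in> set D \<or> y = e \<or> y \<in> set G"
      using xy by (auto simp: Y_def)
    have half: "ok x y" if "x = pt \<or> (x \<in> W \<and> y \<noteq> pt) \<or> (x \<in> set D \<and> y \<noteq> pt \<and> y \<notin> W) \<or> (x = e \<and> y \<in> set G \<union> {e}) \<or> (x \<in> set G \<and> y \<in> set G)"
      "y = pt \<or> y \<in> W \<or> y \<in> set D \<or> y = e \<or> y \<in> set G" "E x y" for x y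
      using that g1 g2 g3 g4 g5 g6 g7 g8 g9 g10 g11 g12 DGe irrE by (elim disjE conjE) auto
    show ?thesis
    proof (cases "x = pt \<or> (x \<in> W \<and> y \<noteq> pt) \<or> (x \<in> set D \<and> y \<noteq> pt \<and> y \<notin> W) \<or> (x = e \<and> y \<in> set G \<union> {e}) \<or> (x \<in> set G \<and> y \<in> set G)")
      case True then show ?thesis using half[OF True cs(2) xy(3)] by blast
    next
      case False
      then have "y = pt \<or> (y \<in> W \<and> x \<noteq> pt) \<or> (y \<in> set D \<and> x \<noteq> pt \<and> x \<notin> W) \<or> (y = e \<and> x \<in> set G \<union> {e}) \<or> (y \<in> set G \<and> x \<in> set G)"
        using cs by blast
      then show ?thesis using half[OF _ cs(1) yx] ok_sym by blast
    qed
  qed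
  have kk: "{u \<in> Y. \<pi> u = 0} = {pt}" "{u \<in> Y. \<pi> u = 1} = W" "{u \<in> Y. \<pi> u = 2} = set D" "{u \<in> Y. \<pi> u = 3} = insert e (set G)"
    using v vW vD vG unfolding Y_def by force+
  have cD: "con (set D)" and cG: "con (set G)" using ipath_con Di Gi DG by auto
  have eu: "E e u" using eG(1) posu by blast
  have ceG: "con (insert e (set G))" by (rule con_insert[OF cG posu(2) eu])
  have cn: "con {u \<in> Y. \<pi> u = \<pi> x}" if "x \<in> Y" for x
  proof -
    have "\<pi> x \<in> {0, 1, 2, 3}" by (auto simp: \<pi>_def)
    then show ?thesis using kk con_sing[of pt] W(1) cD ceG by auto
  qed
  have YV: "Y \<subseteq> V" using W pt sV(1)[of ee] sV(2)[of d] sV(3) Dset unfolding Y_def by blast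
  have "\<exists>sel. qsel Y low \<pi> 0 sel"
    by (rule quotient_selection[OF YV]) (erule (2) ok[unfolded ok_def], erule cn)
  then obtain sel where qs: "qsel Y low \<pi> 0 sel" by blast
  note sel = qselD[OF qs]
  obtain w0 where w0: "w0 \<in> W" "E pt w0" "lo w0" using pt by blast
  obtain w1 where w1: "w1 \<in> W" "E w1 (hd D)" "lo w1"
  proof -
    obtain w where "w \<in> W" "E w (hd (B ee))" using Wt(1)[of ee] by blast
    moreover have "hd (B ee) \<in> set (B ee)" using ne(1)[of ee] by simp
    ultimately show thesis using WB[of w "hd (B ee)" ee] that[of w] hdD by simp
  qed
  obtain w2 where w2: "w2 \<in> W" "E w2 (last G)" "lo w2"
  proof -
    obtain w where "w \<in> W" "E w (last (F d))" using Wt(2)[of d] by blast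
    moreover have "last (F d) \<in> set (F d)" using ne(2)[of d] by simp
    ultimately show thesis using WF[of w "last (F d)" d] that[of w] hdD by simp
  qed
  define x0 where "x0 = Q1 ! a"
  have x0: "x0 \<in> set D" "E pt x0" using cl by (auto simp: x0_def D_def)
  have inY: "pt \<in> Y" "w0 \<in> Y" "w1 \<in> Y" "w2 \<in> Y" "hd D \<in> Y" "last D \<in> Y" "hd G \<in> Y" "last G \<in> Y" "e \<in> Y" "x0 \<in> Y"
    using w0 w1 w2 DG x0 by (auto simp: Y_def)
  have hl: "hd D \<in> set D" "last D \<in> set D" "hd G \<in> set G" "last G \<in> set G" using DG by auto
  have lows: "low w0" "low w1" "low w2" "low (hd D)" "low (last D)" "low (hd G)" "low (last G)" "low x0"
    using vW w0 w1 w2 vD vG hl pD pG eveD eveG x0 ptD by auto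
  have pis: "\<pi> w0 = 1" "\<pi> w1 = 1" "\<pi> w2 = 1" "\<pi> (hd D) = 2" "\<pi> (last D) = 2" "\<pi> (hd G) = 3" "\<pi> (last G) = 3" "\<pi> x0 = 2"
    using vW w0 w1 w2 vD vG hl x0 by auto
  have ph: "E pt (hd G)" using mk hdG by simp
  have De': "E (last D) e" using De hl by blast
  have "sel (\<pi> w1) \<noteq> sel (\<pi> (hd D))"
    by (rule sel[of w1 "hd D" pt w0 pt x0]) (simp_all only: inY lows pis v w0 w1 x0)
  moreover have "sel (\<pi> w2) \<noteq> sel (\<pi> (last G))"
    by (rule sel[of w2 "last G" pt w0 pt "hd G"]) (simp_all only: inY lows pis v w0 w2 ph)
  moreover have "sel (\<pi> (last D)) \<noteq> sel (\<pi> e)"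
    by (rule sel[of "last D" e pt x0 pt "hd G"]) (simp_all only: inY lows pis v x0 ph De')
  ultimately show False unfolding pis v by blast
qed

text \<open>Reading the rope backwards sends position \<open>k\<close> to
  \<open>length A2 - 1 - k\<close>, which is even since \<open>A2\<close> has odd length.\<close>

lemma rope_rev: "rope V E W lo pt (\<lambda>d. rev (F d)) (\<lambda>e. rev (B e)) (rev Q2) (rev A1) (rev A2) (rev Q1) (length A2 - 1 - k)"
proof unfold_locales
  show "ipath (rev (F e) @ rev Q2 @ rev A1 @ rev Q1 @ rev (B d))" for e d
    using r1[of d e] ipath_rev[of "B d @ Q1 @ A1 @ Q2 @ F e"] by simp
  show "ipath (rev (F e) @ rev Q2 @ rev A2 @ rev Q1 @ rev (B d))" for e d
    using r2[of d e] ipath_rev[of "B d @ Q1 @ A2 @ Q2 @ F e"] by simp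
  show "even (length A2 - 1 - k)" "2 \<le> length A2 - 1 - k" "length A2 - 1 - k + 2 < length (rev A2)"
    using k parA by (simp_all add: even_diff_nat)
  show "E pt (rev A2 ! (length A2 - 1 - k))" using k by (simp add: rev_nth)
  show "lo w \<and> z = hd (rev (F e))" if "w \<in> W" "z \<in> set (rev (F e))" "E w z" for w z e
    using WF[of w z e] that ne(2)[of e] by (simp add: hd_rev)
  show "lo w \<and> z = last (rev (B e))" if "w \<in> W" "z \<in> set (rev (B e))" "E w z" for w z e
    using WB[of w z e] that ne(1)[of e] by (simp add: last_rev)
  show "\<exists>w\<in>W. E w (hd (rev (F e)))" for e using Wt(2)[of e] by (simp add: hd_rev)
  show "\<exists>w\<in>W. E w (last (rev (B e)))" for e using Wt(1)[of e] by (simp add: last_rev)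
  show "\<not> E w z" if "w \<in> W" "z \<in> set (rev Q2) \<union> set (rev A1) \<union> set (rev A2) \<union> set (rev Q1)" for w z
    using WM[of w z] that by auto
qed (use W pt ne parB parF parA A12 sV ptn ptB ptF WD in \<open>auto simp: Int_Un_distrib\<close>)

text \<open>A contact on \<open>Q1\<close> and one on \<open>Q2\<close> would have distances of both
  parities, along \<open>A1\<close> and along \<open>A2\<close>. Contacts on one side only are
  \<open>contact_on_right\<close> up to reversal, and otherwise \<open>contact_outside_arcs\<close>
  applies.\<close>

lemma rope_False: False
proof (cases "\<exists>a<length Q1. E pt (Q1 ! a)")
  case Q1: True
  then obtain a where a: "a < length Q1" "E pt (Q1 ! a)" by blast
  show False
  proof (cases "\<exists>z\<in>set Q2. E pt z")
    case True
    then obtain b where b: "b < length Q2" "E pt (Q2 ! b)" by (auto simp: in_set_conv_nth)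
    have "even a = even (length Q1 + length A + b)" if "A = A1 \<or> A = A2" for A
      by (rule contacts_same_parity[OF that]) (use a b in \<open>auto simp: nth_append\<close>)
    from this[of A1] this[of A2] show False using parA by auto
  next
    case False then show ?thesis using contact_on_right[OF a] by blast
  qed
next
  case False
  then have noL: "z \<in> set Q1 \<Longrightarrow> \<not> E pt z" for z by (auto simp: in_set_conv_nth)
  show False
  proof (cases "\<exists>z\<in>set Q2. E pt z")
    case True
    interpret R: rope V E W lo pt "\<lambda>d. rev (F d)" "\<lambda>e. rev (B e)" "rev Q2" "rev A1" "rev A2" "rev Q1" "length A2 - 1 - k"
      by (rule rope_rev)
    obtain z where "z \<in> set (rev Q2)" "E pt z" using True by auto
    then obtain b where "b < length (rev Q2)" "E pt (rev Q2 ! b)" unfolding in_set_conv_nth by blast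
    then show False using R.contact_on_right[of b] noL by auto
  next
    case False then show ?thesis using contact_outside_arcs noL by blast
  qed
qed

end

context hgraph begin

text \<open>If the connection through \<open>U\<close> has an end \<open>pa\<close> (or \<open>px\<close>) that is not low, the neighbour \<open>b\<close> (or \<open>f\<close>) on the rope
  is moved to the connection.\<close>
lemma no_closed_rope:
  fixes B F :: "bool \<Rightarrow> 'a list"
  assumes U: "con U" "U \<subseteq> V" and pU: "pa \<notin> U" "px \<notin> U" "pt \<notin> U"
    and nb: "\<exists>u\<in>U. E pa u" "\<exists>u\<in>U. E px u" "\<exists>u\<in>U. E pt u"
    and r: "\<And>e d A. A = A1 \<or> A = A2 \<Longrightarrow> ipath ((pa # b # B e) @ Q1 @ A @ Q2 @ (F d @ [f, px]))"
    and ne: "\<And>e. B e \<noteq> []" "\<And>d. F d \<noteq> []" "Q1 \<noteq> []" "Q2 \<noteq> []" "A1 \<noteq> []"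
    and parB: "even (length (B True)) \<noteq> even (length (B False))" and parF: "even (length (F True)) \<noteq> even (length (F False))"
    and parA: "even (length A1)" "odd (length A2)"
    and A12: "set A1 \<inter> set A2 = {}" "anti (set A1) (set A2)"
    and sV: "pa \<in> V" "px \<in> V" "pt \<in> V" "\<And>e. set (b # B e) \<subseteq> V" "\<And>d. set (F d @ [f]) \<subseteq> V" "set Q1 \<union> set A1 \<union> set A2 \<union> set Q2 \<subseteq> V"
    and ptn: "\<And>e. pt \<notin> set (pa # b # B e)" "\<And>d. pt \<notin> set (F d @ [f, px])" "pt \<notin> set Q1 \<union> set A1 \<union> set A2 \<union> set Q2"
    and ptB: "\<And>e z. z \<in> set (pa # b # B e) \<Longrightarrow> \<not> E pt z" and ptF: "\<And>d z. z \<in> set (F d @ [f, px]) \<Longrightarrow> \<not> E pt z"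
    and UD: "\<And>e. U \<inter> set (b # B e) = {}" "\<And>d. U \<inter> set (F d @ [f]) = {}" "U \<inter> (set Q1 \<union> set A1 \<union> set A2 \<union> set Q2) = {}"
    and UE: "\<And>e. anti U (set (b # B e))" "\<And>d. anti U (set (F d @ [f]))" "anti U (set Q1 \<union> set A1 \<union> set A2 \<union> set Q2)"
    and k: "even k" "2 \<le> k" "k + 2 < length A2" "E pt (A2 ! k)"
  shows False
proof -
  have s: "E x y \<longleftrightarrow> E y x" for x y using symE by blast
  have PB: "\<exists>e. even (length (B e)) = c" for c using parB by (cases c) (metis (full_types))+
  have PF: "\<exists>d. even (length (F d)) = c" for c using parF by (cases c) (metis (full_types))+
  have ptne: "pt \<noteq> pa" "pt \<noteq> px" using ptn(1)[of True] ptn(2)[of True] by auto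
  define Z where "Z e d = set (B e) \<union> set Q1 \<union> set A1 \<union> set A2 \<union> set Q2 \<union> set (F d)" for e d
  have rl: "ipath (pa # b # (B e @ Q1 @ A @ Q2 @ F d @ [f, px]))" if "A = A1 \<or> A = A2" for e d A using r[OF that, of e d] by simp
  have rr: "ipath ((pa # b # B e @ Q1 @ A @ Q2 @ F d) @ [f, px])" if "A = A1 \<or> A = A2" for e d A using r[OF that, of e d] by simp
  have Zr: "\<exists>A. (A = A1 \<or> A = A2) \<and> z \<in> set (B e @ Q1 @ A @ Q2 @ F d)" if "z \<in> Z e d" for z e d using that unfolding Z_def by auto
  have kpa: "E pa z \<longleftrightarrow> z = b" "z \<noteq> pa" if z: "z = b \<or> z = f \<or> z = px \<or> z \<in> Z e d" for z e d
  proof -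
    have "\<exists>A. (A = A1 \<or> A = A2) \<and> z \<in> set (b # B e @ Q1 @ A @ Q2 @ F d @ [f, px])" using z Zr[of z e d] by auto
    then obtain A where A: "A = A1 \<or> A = A2" "z \<in> set (b # B e @ Q1 @ A @ Q2 @ F d @ [f, px])" by blast
    have q: "pa \<notin> set (b # B e @ Q1 @ A @ Q2 @ F d @ [f, px])" "\<forall>y\<in>set (b # B e @ Q1 @ A @ Q2 @ F d @ [f, px]). E pa y \<longleftrightarrow> y = hd (b # B e @ Q1 @ A @ Q2 @ F d @ [f, px])"
      using rl[OF A(1), of e d] unfolding ipath_Cons[of pa] by blast+
    show "E pa z \<longleftrightarrow> z = b" "z \<noteq> pa" using q A(2) by auto
  qed
  have kb: "E b z \<longleftrightarrow> z = hd (B e)" "z \<noteq> b" if z: "z = f \<or> z = px \<or> z \<in> Z e d" for z e d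
  proof -
    have "\<exists>A. (A = A1 \<or> A = A2) \<and> z \<in> set (B e @ Q1 @ A @ Q2 @ F d @ [f, px])" using z Zr[of z e d] by auto
    then obtain A where A: "A = A1 \<or> A = A2" "z \<in> set (B e @ Q1 @ A @ Q2 @ F d @ [f, px])" by blast
    have q: "b \<notin> set (B e @ Q1 @ A @ Q2 @ F d @ [f, px])" "\<forall>y\<in>set (B e @ Q1 @ A @ Q2 @ F d @ [f, px]). E b y \<longleftrightarrow> y = hd (B e @ Q1 @ A @ Q2 @ F d @ [f, px])"
      using rl[OF A(1), of e d] unfolding ipath_Cons[of pa] ipath_Cons[of b] by blast+
    show "E b z \<longleftrightarrow> z = hd (B e)" "z \<noteq> b" using q A(2) ne(1)[of e] by auto
  qed
  have kpx: "E px z \<longleftrightarrow> z = f" "z \<noteq> px" if z: "z = f \<or> z = b \<or> z = pa \<or> z \<in> Z e d" for z e d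
  proof -
    have "\<exists>A. (A = A1 \<or> A = A2) \<and> z \<in> set (pa # b # B e @ Q1 @ A @ Q2 @ F d @ [f])" using z Zr[of z e d] by auto
    then obtain A where A: "A = A1 \<or> A = A2" "z \<in> set (pa # b # B e @ Q1 @ A @ Q2 @ F d @ [f])" by blast
    have "ipath ((pa # b # B e @ Q1 @ A @ Q2 @ F d @ [f]) @ [px])" using rr[OF A(1), of e d] by simp
    then have q: "px \<notin> set (pa # b # B e @ Q1 @ A @ Q2 @ F d @ [f])" "\<forall>y\<in>set (pa # b # B e @ Q1 @ A @ Q2 @ F d @ [f]). E y px \<longleftrightarrow> y = last (pa # b # B e @ Q1 @ A @ Q2 @ F d @ [f])"
      unfolding ipath_append[of "pa # b # B e @ Q1 @ A @ Q2 @ F d @ [f]"] by auto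
    have "last (pa # b # B e @ Q1 @ A @ Q2 @ F d @ [f]) = f" by simp
    then show "E px z \<longleftrightarrow> z = f" using q(2) A(2) s[of px z] by metis
    show "z \<noteq> px" using q(1) A(2) by blast
  qed
  have kf: "E f z \<longleftrightarrow> z = last (F d)" "z \<noteq> f" if z: "z = b \<or> z = pa \<or> z \<in> Z e d" for z e d
  proof -
    have "\<exists>A. (A = A1 \<or> A = A2) \<and> z \<in> set (pa # b # B e @ Q1 @ A @ Q2 @ F d)" using z Zr[of z e d] by auto
    then obtain A where A: "A = A1 \<or> A = A2" "z \<in> set (pa # b # B e @ Q1 @ A @ Q2 @ F d)" by blast
    have q: "f \<notin> set (pa # b # B e @ Q1 @ A @ Q2 @ F d)" "\<forall>y\<in>set (pa # b # B e @ Q1 @ A @ Q2 @ F d). E y f \<longleftrightarrow> y = last (pa # b # B e @ Q1 @ A @ Q2 @ F d)"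
      using rr[OF A(1), of e d] unfolding ipath_append[of "pa # b # B e @ Q1 @ A @ Q2 @ F d"] by auto
    have "last (pa # b # B e @ Q1 @ A @ Q2 @ F d) = last (F d)" using ne(2)[of d] by simp
    then show "E f z \<longleftrightarrow> z = last (F d)" using q(2) A(2) s[of f z] by metis
    show "z \<noteq> f" using q(1) A(2) by blast
  qed
  have dj: "set (B e) \<inter> (set Q1 \<union> set A1 \<union> set A2 \<union> set Q2 \<union> set (F d)) = {}"
     "set (F d) \<inter> (set Q1 \<union> set A1 \<union> set A2 \<union> set Q2 \<union> set (B e)) = {}" for e d
  proof -
    have x: "set (B e) \<inter> (set Q1 \<union> set A \<union> set Q2 \<union> set (F d)) = {} \<and> set (F d) \<inter> (set Q1 \<union> set A \<union> set Q2) = {}"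
      if "A = A1 \<or> A = A2" for A
    proof -
      have "distinct (B e @ (Q1 @ A @ Q2 @ F d @ [f, px]))" "distinct ((Q1 @ A @ Q2) @ (F d @ [f, px]))"
        using ipath_distinct[OF rl[OF that, of e d]] by simp_all
      then have "set (B e) \<inter> set (Q1 @ A @ Q2 @ F d @ [f, px]) = {}" "set (Q1 @ A @ Q2) \<inter> set (F d @ [f, px]) = {}"
        unfolding distinct_append[of "B e"] distinct_append[of "Q1 @ A @ Q2"] by blast+
      then show ?thesis by auto
    qed
    show "set (B e) \<inter> (set Q1 \<union> set A1 \<union> set A2 \<union> set Q2 \<union> set (F d)) = {}"
     "set (F d) \<inter> (set Q1 \<union> set A1 \<union> set A2 \<union> set Q2 \<union> set (B e)) = {}" using x[of A1] x[of A2] by blast+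
  qed
  have ZU: "Z e d \<inter> U = {}" "anti U (Z e d)" for e d
    using UD(1)[of e] UD(2)[of d] UD(3) UE(1)[of e] UE(2)[of d] UE(3) unfolding Z_def anti_def by auto
  have bfU: "b \<notin> U" "f \<notin> U" "\<And>u. u \<in> U \<Longrightarrow> \<not> E u b" "\<And>u. u \<in> U \<Longrightarrow> \<not> E u f"
    using UD(1,2)[of True] UE(1,2)[of True] unfolding anti_def by auto
  have Zin: "set (B e) \<subseteq> Z e d" "set (F d) \<subseteq> Z e d" "set Q1 \<union> set A1 \<union> set A2 \<union> set Q2 \<subseteq> Z e d" for e d by (auto simp: Z_def)
  have hB: "hd (B e) \<in> Z e d" "last (F d) \<in> Z e d" for e d using ne(1)[of e] ne(2)[of d] unfolding Z_def by auto
  from connecting_tree_or_path[OF U(1) pU ptne nb] show False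
  proof (elim disjE)
    assume "\<exists>W lo. con W \<and> bip W lo \<and> W \<subseteq> insert pa (insert px U) \<and> pa \<in> W \<and> px \<in> W \<and> (\<exists>w\<in>W. E pt w) \<and> (\<forall>w\<in>W. E pt w \<longrightarrow> lo w)"
    then obtain W lo where W: "con W" "bip W lo" "W \<subseteq> insert pa (insert px U)" "pa \<in> W" "px \<in> W" "\<exists>w\<in>W. E pt w" "\<And>w. w \<in> W \<Longrightarrow> E pt w \<Longrightarrow> lo w" by blast
    define W1 where "W1 = (if lo pa then W else insert b W)"
    define W2 where "W2 = (if lo px then W1 else insert f W1)"
    define lo2 where "lo2 v = (if v = b \<or> v = f then True else lo v)" for v
    define B2 where "B2 e = (if lo pa then b # B e else B e)" for e
    define F2 where "F2 d = (if lo px then F d @ [f] else F d)" for d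
    have bW: "b \<notin> W" "f \<notin> W" "b \<noteq> f" using W(3) bfU kpa(2)[of b True True] kpa(2)[of f True True] kpx(2)[of b True True] kpx(2)[of f True True] kb(2)[of f True True] by auto
    have loW: "w \<in> W \<Longrightarrow> lo2 w = lo w" for w using bW by (auto simp: lo2_def)
    have Wb: "E w b \<longleftrightarrow> w = pa" if "w \<in> W" for w
      using that W(3) bfU(3) kpa(1)[of b True True] kpx(1)[of b True True] bW(3) by blast
    have Wf: "E w f \<longleftrightarrow> w = px" if "w \<in> W" for w
      using that W(3) bfU(4) kpa(1)[of f True True] kpx(1)[of f True True] bW(3) by blast
    have bf: "\<not> E b f" "\<not> E f b"
    proof -
      have "f \<noteq> hd (B True)" using kf(2)[OF disjI2[OF disjI2[OF hB(1)[of True True]]]] by blast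
      then show "\<not> E b f" using kb(1)[of f True True] by blast
      then show "\<not> E f b" using s by blast
    qed
    have WZ: "\<not> E w z" "z \<notin> W" if "w \<in> W" "z \<in> Z e d" for w z e d
    proof -
      have zn: "z \<noteq> b" "z \<noteq> f" "z \<noteq> pa" "z \<noteq> px" using kb(2)[of z e d] kf(2)[of z e d] kpa(2)[of z e d] kpx(2)[of z e d] that(2) by blast+
      then show "\<not> E w z" using that W(3) ZU(2)[of e d] kpa(1)[of z e d] kpx(1)[of z e d] unfolding anti_def by blast
      show "z \<notin> W" using zn W(3) ZU(1)[of e d] that by blast
    qed
    have bZ: "b \<notin> Z e d" "f \<notin> Z e d" for e d using kb(2)[of _ e d] kf(2)[of _ e d] by blast+
    have W2s: "W2 \<subseteq> insert b (insert f W)" by (auto simp: W2_def W1_def)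
    have W2c: "w \<in> W2 \<longleftrightarrow> w \<in> W \<or> (w = b \<and> \<not> lo pa) \<or> (w = f \<and> \<not> lo px)" for w by (auto simp: W2_def W1_def)
    interpret rope V E W2 lo2 pt B2 F2 Q1 A1 A2 Q2 k
    proof unfold_locales
      have "con W1" using W(1,4) con_insert[OF W(1) W(4), of b] kpa(1)[of b True True] s by (simp add: W1_def)
      moreover have "px \<in> W1" using W by (simp add: W1_def)
      ultimately show "con W2" using con_insert[of W1 px f] kpx(1)[of f True True] s by (simp add: W2_def)
      have bipc: "lo2 u \<noteq> lo2 v" if as: "u \<in> W2" "v \<in> W" "E u v" for u v
      proof (cases "u \<in> W")
        case True then show ?thesis using W(2) that loW unfolding bip_def by auto
      next
        case False
        then consider "u = b" "\<not> lo pa" | "u = f" "\<not> lo px" using as W2c by blast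
        then show ?thesis
        proof cases
          case 1
          then have "v = pa" using Wb[OF that(2)] that(3) s by blast
          then show ?thesis using 1 loW[OF W(4)] by (simp add: lo2_def)
        next
          case 2
          then have "v = px" using Wf[OF that(2)] that(3) s by blast
          then show ?thesis using 2 loW[OF W(5)] by (simp add: lo2_def)
        qed
      qed
      show "bip W2 lo2" unfolding bip_def
      proof (intro ballI impI)
        fix u v assume uv: "u \<in> W2" "v \<in> W2" "E u v"
        show "lo2 u \<noteq> lo2 v"
        proof (cases "v \<in> W")
          case True then show ?thesis using bipc uv by blast
        next
          case vW: False
          show ?thesis
          proof (cases "u \<in> W")
            case True then show ?thesis using bipc[OF uv(2) True] s[of u v] uv(3) by metis
          next
            case False then show ?thesis using vW uv bf irrE W2s by blast
          qed
        qed
      qed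
      show "W2 \<subseteq> V" using W2s W(3) U(2) sV(1,2) sV(4)[of True] sV(5)[of True] by auto
      show "pt \<in> V" by fact
      show "pt \<notin> W2" using W2s W(3) pU(3) ptne ptn(1)[of True] ptn(2)[of True] by auto
      show "\<exists>w\<in>W2. E pt w" using W(6) W2c by blast
      show "lo2 w" if "w \<in> W2" "E pt w" for w using that W2c W(7) loW by (auto simp: lo2_def)
      have sub1: "ipath (B2 e @ Q1 @ A @ Q2 @ F2 d)" if A: "A = A1 \<or> A = A2" for A e d
      proof -
        have "ipath (b # B e @ Q1 @ A @ Q2 @ F d @ [f, px])" using rl[OF A, of e d] unfolding ipath_Cons[of pa] by blast
        then have "ipath ((b # B e @ Q1 @ A @ Q2 @ F d @ [f]) @ [px])" by simp
        then have i1: "ipath (b # B e @ Q1 @ A @ Q2 @ F d @ [f])" unfolding ipath_append[of "b # B e @ Q1 @ A @ Q2 @ F d @ [f]"] by blast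
        then have "ipath ((b # B e @ Q1 @ A @ Q2 @ F d) @ [f])" by simp
        then have i2: "ipath (b # B e @ Q1 @ A @ Q2 @ F d)" unfolding ipath_append[of "b # B e @ Q1 @ A @ Q2 @ F d"] by blast
        have i3: "ipath (B e @ Q1 @ A @ Q2 @ F d)" "ipath (B e @ Q1 @ A @ Q2 @ F d @ [f])" using i1 i2 unfolding ipath_Cons[of b] by blast+
        show ?thesis unfolding B2_def F2_def using i1 i2 i3 by (cases "lo pa"; cases "lo px") simp_all
      qed
      show "ipath (B2 e @ Q1 @ A1 @ Q2 @ F2 d)" "ipath (B2 e @ Q1 @ A2 @ Q2 @ F2 d)" for e d using sub1 by auto
      show "B2 e \<noteq> []" "F2 e \<noteq> []" for e using ne by (auto simp: B2_def F2_def)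
      show "even (length (B2 True)) \<noteq> even (length (B2 False))" using parB by (auto simp: B2_def)
      show "even (length (F2 True)) \<noteq> even (length (F2 False))" using parF by (auto simp: F2_def)
      have B2s: "set (B2 e) \<subseteq> insert b (set (B e))" "set (F2 e) \<subseteq> insert f (set (F e))" for e by (auto simp: B2_def F2_def)
      show "set (B2 e) \<subseteq> V" "set (F2 e) \<subseteq> V" for e using B2s[of e] sV(4)[of e] sV(5)[of e] by auto
      show "pt \<notin> set (B2 e)" "pt \<notin> set (F2 e)" for e using B2s[of e] ptn(1)[of e] ptn(2)[of e] by auto
      show "\<not> E pt z" if "z \<in> set (B2 e)" for e z using ptB[of z e] B2s(1)[of e] that by auto
      show "\<not> E pt z" if "z \<in> set (F2 e)" for e z using ptF[of z e] B2s(2)[of e] that by auto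
      have fB: "f \<notin> set (B e)" "b \<notin> set (F e)" "b \<notin> set (B e)" "f \<notin> set (F e)" for e using bZ Zin by blast+
      have B2b: "b \<in> set (B2 e) \<Longrightarrow> lo pa" "f \<in> set (F2 e) \<Longrightarrow> lo px" for e using fB by (auto simp: B2_def F2_def split: if_splits)
      have WB0: "W \<inter> set (B e) = {}" "W \<inter> set (F e) = {}" for e using WZ(2)[OF W(4)] Zin by blast+
      show "W2 \<inter> set (B2 e) = {}" for e
      proof -
        have "w \<notin> set (B2 e)" if "w \<in> W2" for w
        proof
          assume w: "w \<in> set (B2 e)"
          then have "w = b \<or> w \<in> set (B e)" using B2s by blast
          then show False using that w W2c[of w] WB0[of e] bW fB[of e] B2b[of e] by blast
        qed
        then show ?thesis by blast
      qed
      show "W2 \<inter> set (F2 e) = {}" for e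
      proof -
        have "w \<notin> set (F2 e)" if "w \<in> W2" for w
        proof
          assume w: "w \<in> set (F2 e)"
          then have "w = f \<or> w \<in> set (F e)" using B2s by blast
          then show False using that w W2c[of w] WB0[of e] bW fB[of e] B2b[of e] by blast
        qed
        then show ?thesis by blast
      qed
      show "W2 \<inter> (set Q1 \<union> set A1 \<union> set A2 \<union> set Q2) = {}"
        using W2s WZ(2)[OF W(4), of _ True True] Zin(3)[of True True] bZ[of True True] by blast
      have hdB: "hd (B e) \<in> set (B e)" "last (F e) \<in> set (F e)" for e using ne by auto
      show "lo2 w \<and> z = hd (B2 e)" if as: "w \<in> W2" "z \<in> set (B2 e)" "E w z" for w z e
      proof (cases "z \<in> set (B e)")
        case True
        then have zZ: "z \<in> Z e True" using Zin by blast
        then have "w \<notin> W" using WZ(1) as by blast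
        then consider "w = b" "\<not> lo pa" | "w = f" using as W2c by blast
        then show ?thesis
        proof cases
          case 1 then show ?thesis using kb(1)[of z e True] zZ as by (simp add: lo2_def B2_def)
        next
          case 2
          then have "z = last (F True)" using kf(1)[of z e True] zZ as by blast
          then show ?thesis using dj(1)[of e True] hdB[of True] True by blast
        qed
      next
        case False
        then have z: "z = b" "lo pa" using as B2s[of e] B2b[of e] by auto
        then have "w \<in> W" using as W2c bf irrE by blast
        then have "w = pa" using Wb as z by blast
        then show ?thesis using z loW[OF W(4)] by (simp add: B2_def)
      qed
      show "lo2 w \<and> z = last (F2 e)" if as: "w \<in> W2" "z \<in> set (F2 e)" "E w z" for w z e
      proof (cases "z \<in> set (F e)")
        case True
        then have zZ: "z \<in> Z True e" using Zin by blast
        then have "w \<notin> W" using WZ(1) as by blast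
        then consider "w = b" | "w = f" "\<not> lo px" using as W2c by blast
        then show ?thesis
        proof cases
          case 1
          then have "z = hd (B True)" using kb(1)[of z True e] zZ as by blast
          then show ?thesis using dj(1)[of True e] hdB[of True] True by blast
        next
          case 2
          then have "z = last (F e)" using kf(1)[of z True e] zZ as by blast
          then show ?thesis using 2 by (simp add: lo2_def F2_def)
        qed
      next
        case False
        then have z: "z = f" "lo px" using as B2s[of e] B2b[of e] by auto
        then have "w \<in> W" using as W2c bf irrE by blast
        then have "w = px" using Wf as z by blast
        then show ?thesis using z loW[OF W(5)] by (simp add: F2_def)
      qed
      show "\<not> E w z" if as: "w \<in> W2" "z \<in> set Q1 \<union> set A1 \<union> set A2 \<union> set Q2" for w z
      proof
        assume e: "E w z"
        have zZ: "z \<in> Z True True" using Zin(3) as by blast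
        then have "w \<notin> W" using WZ(1) e by blast
        then have "w = b \<or> w = f" using as W2c by blast
        then have "z = hd (B True) \<or> z = last (F True)" using kb(1)[of z True True] kf(1)[of z True True] zZ e by blast
        then show False using dj[of True True] hdB[of True] as by blast
      qed
      show "\<exists>w\<in>W2. E w (hd (B2 e))" for e
      proof (cases "lo pa")
        case True
        then show ?thesis using kpa(1)[of b True True] W2c W(4) by (auto simp: B2_def)
      next
        case False
        then have "E b (hd (B e))" using kb(1)[of "hd (B e)" e True] hB by blast
        then show ?thesis using False W2c by (auto simp: B2_def)
      qed
      show "\<exists>w\<in>W2. E w (last (F2 e))" for e
      proof (cases "lo px")
        case True
        then show ?thesis using kpx(1)[of f True True] W2c W(5) by (auto simp: F2_def)
      next
        case False
        then have "E f (last (F e))" using kf(1)[of "last (F e)" True e] hB by blast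
        then show ?thesis using False W2c by (auto simp: F2_def)
      qed
    qed (use ne parA A12 sV ptn k in auto)
    show False by (rule rope_False)
  next
    assume "\<exists>m i j. ipath m \<and> m \<noteq> [] \<and> hd m = pa \<and> last m = px \<and> set m \<subseteq> insert pa (insert px U) \<and> i < j \<and> j < length m \<and> odd (j - i) \<and>
       E pt (m ! i) \<and> E pt (m ! j)"
    then obtain m i j where m: "ipath m" "m \<noteq> []" "hd m = pa" "last m = px" "set m \<subseteq> insert pa (insert px U)"
      and ij: "i < j" "j < length m" "odd (j - i)" "E pt (m ! i)" "E pt (m ! j)" by (elim exE conjE) (rule that)
    have i0: "0 < i"
    proof (rule ccontr)
      assume "\<not> 0 < i"
      then have "m ! i = pa" using m by (simp add: hd_conv_nth)
      then show False using ij ptB[of pa True] by simp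
    qed
    obtain m1 where m1: "m = pa # m1" using m by (cases m) auto
    have "m1 \<noteq> []" using ij m1 by auto
    then obtain m' where m': "m1 = m' @ [px]" using m m1 by (cases m1 rule: rev_cases) auto
    have mm: "m = pa # m' @ [px]" using m1 m' by simp
    have jl: "j \<le> length m'"
    proof (rule ccontr)
      assume "\<not> ?thesis"
      then have "j = Suc (length m')" using ij mm by simp
      then have "m ! j = px" by (simp add: mm nth_append)
      then show False using ij ptF[of px True] by simp
    qed
    have mi: "E pa y \<longleftrightarrow> y = hd (m' @ [px])" "y \<noteq> pa" if "y \<in> set (m' @ [px])" for y using m(1) that unfolding mm ipath_Cons[of pa] by blast+
    have "ipath (m' @ [px])" using m(1) unfolding mm ipath_Cons[of pa] by blast
    then have mip: "ipath m'" "px \<notin> set m'" "\<And>y. y \<in> set m' \<Longrightarrow> E y px \<longleftrightarrow> y = last m'" unfolding ipath_append by auto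
    have m'U: "set m' \<subseteq> U" using m(5) mip(2) mi(2) mm by auto
    have mne: "m' \<noteq> []" using jl ij by auto
    \<comment> \<open>Close the rope along \<open>m\<close> to a cycle cut at \<open>pa\<close>, on
      which the contacts come in the order \<open>A2 ! k\<close>, \<open>m ! j\<close>,
      \<open>m ! i\<close>. The arc in \<open>F\<close> makes the first gap odd, and the arc in
      \<open>B\<close>, which lies before all contacts, makes the cycle odd.\<close>
    obtain d where d: "even (length (F d)) = odd ((length A2 - k) + length Q2 + (length m' - j))" using PF by blast
    obtain e where e: "even (length (B e)) = odd (length Q1 + length A2 + length Q2 + length (F d) + length m')" using PB by blast
    define R where "R = b # B e @ Q1 @ A2 @ Q2 @ F d @ [f, px]"
    define xs where "xs = R @ rev m'"
    have R: "ipath R" "pa \<notin> set R" "\<And>z. z \<in> set R \<Longrightarrow> E pa z \<longleftrightarrow> z = b" using rl[of A2 e d] unfolding R_def ipath_Cons[of pa] by auto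
    have Rs: "set R = insert b (insert f (insert px (set (B e) \<union> set Q1 \<union> set A2 \<union> set Q2 \<union> set (F d))))" by (auto simp: R_def)
    have Rl: "last R = px" "hd R = b" "R \<noteq> []" by (auto simp: R_def)
    have RU: "z \<notin> U" "z \<noteq> px \<Longrightarrow> u \<in> U \<Longrightarrow> \<not> E z u" if "z \<in> set R" for z u
    proof -
      have z: "z = b \<or> z = f \<or> z = px \<or> z \<in> Z e d" using that unfolding Rs Z_def by blast
      then show "z \<notin> U" using bfU pU ZU(1)[of e d] by blast
      show "\<not> E z u" if "z \<noteq> px" "u \<in> U" using z that bfU ZU(2)[of e d] s unfolding anti_def by blast
    qed
    have cyc: "icyc pa xs" unfolding icyc_def
    proof (intro conjI ballI)
      show "xs \<noteq> []" by (simp add: xs_def R_def)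
      show "even (length xs)" using e by (auto simp: xs_def R_def)
      show "pa \<notin> set xs" using R(2) m'U pU by (auto simp: xs_def)
      show "ipath xs" unfolding xs_def ipath_append
      proof (intro conjI ballI)
        show "ipath R" "ipath (rev m')" using R mip ipath_rev by auto
        show "set R \<inter> set (rev m') = {}" using RU(1) m'U by auto
        fix x y assume x: "x \<in> set R" and y: "y \<in> set (rev m')"
        have yU: "y \<in> U" "y \<in> set m'" using y m'U by auto
        show "E x y \<longleftrightarrow> x = last R \<and> y = hd (rev m')"
        proof (cases "x = px")
          case True then show ?thesis using mip(3)[OF yU(2)] s[of px y] Rl mne by (simp add: hd_rev)
        next
          case False then show ?thesis using RU(2)[OF x False yU(1)] Rl by simp
        qed
      qed
      fix v assume v: "v \<in> set xs"
      have hx: "hd xs = b" "last xs = hd m'" using mne by (auto simp: xs_def Rl last_rev)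
      have hm: "hd m' \<in> U" "b \<notin> U" using mne m'U bfU by auto
      show "E pa v \<longleftrightarrow> v = hd xs \<or> v = last xs"
      proof (cases "v \<in> set R")
        case True
        then have "v \<noteq> hd m'" using RU(1) hm by blast
        then show ?thesis using R(3)[OF True] hx by simp
      next
        case False
        then have "v \<in> set m'" using v by (auto simp: xs_def)
        then have "v \<noteq> b" "E pa v \<longleftrightarrow> v = hd m'" using mi(1)[of v] m'U hm mne by auto
        then show ?thesis using hx by simp
      qed
    qed
    define c1 where "c1 = Suc (length (B e) + length Q1 + k)"
    define c2 where "c2 = length R + (length m' - j)"
    define c3 where "c3 = length R + (length m' - i)"
    have "xs = (b # B e @ Q1) @ A2 @ Q2 @ F d @ [f, px] @ rev m'" by (simp add: xs_def R_def)
    then have "xs ! (length (b # B e @ Q1) + k) = (A2 @ Q2 @ F d @ [f, px] @ rev m') ! k" by (metis nth_append_length_plus)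
    then have x1: "xs ! c1 = A2 ! k" using k by (simp add: c1_def nth_append)
    have xm: "xs ! (length R + (length m' - l)) = m ! l" if l: "0 < l" "l \<le> length m'" for l
    proof -
      have "xs ! (length R + (length m' - l)) = rev m' ! (length m' - l)" unfolding xs_def by (rule nth_append_length_plus)
      also have "\<dots> = m' ! (l - 1)" using l by (simp add: rev_nth)
      also have "\<dots> = m ! l" using l by (cases l) (auto simp: mm nth_append)
      finally show ?thesis .
    qed
    have x2: "xs ! c2 = m ! j" "xs ! c3 = m ! i" unfolding c2_def c3_def using xm[of j] xm[of i] i0 ij jl by auto
    have Rlen: "length R = Suc (length (B e) + length Q1 + length A2 + length Q2 + length (F d) + 2)" by (simp add: R_def)
    show False
    proof (rule no_odd_hub_cycle_contacts[of "{pt}" "\<lambda>_. True" pa xs c1 c2 c3])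
      show "icyc pa xs" by (rule cyc)
      have RV: "set R \<subseteq> V" unfolding Rs using sV(2) sV(4)[of e] sV(5)[of d] sV(6) by auto
      then show "set xs \<subseteq> V" using m'U U(2) by (auto simp: xs_def)
      have "pt \<notin> set R" unfolding Rs using ptn(1)[of e] ptn(2)[of d] ptn(3) by auto
      then show "{pt} \<inter> set xs = {}" using m'U pU(3) by (auto simp: xs_def)
      show "c1 < c2" using k Rlen by (simp add: c1_def c2_def)
      show "c2 < c3" using ij jl by (simp add: c2_def c3_def)
      show "c3 < length xs" using i0 mne by (simp add: c3_def xs_def)
      have "c2 - c1 = (length A2 - k) + length Q2 + length (F d) + (length m' - j) + 2" unfolding c1_def c2_def Rlen using k by simp
      then show "odd (c2 - c1)" using d by auto
      have "c3 - c2 = j - i" using ij jl by (simp add: c3_def c2_def)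
      then show "odd (c3 - c2)" using ij by simp
      show "\<exists>a\<in>{pt}. E a (xs ! c1)" "\<exists>a\<in>{pt}. E a (xs ! c2)" "\<exists>a\<in>{pt}. E a (xs ! c3)" using x1 x2 k ij by auto
    qed (use sV ptne in \<open>auto simp: con_sing bip_def irrE\<close>)
  qed
qed


lemma ipath_glue:
  assumes "ipath (xs @ [s])" "ipath (s # ys)" "set xs \<inter> set ys = {}" "anti (set xs) (set ys)"
  shows "ipath (xs @ s # ys)"
  using assms unfolding ipath_append ipath_Cons anti_def by auto

text \<open>The neighbourhood of \<open>p\<close> is stable and costs one colour. By connectivity of
  \<open>C\<close>, an expensive component of the rest is attached to a removed vertex
  \<open>s\<close>, through which a rope starting in \<open>p\<close> can enter it.\<close>

lemma cut_step:
  assumes C: "con C" "\<not> col C (m + 1)" "C \<subseteq> V"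
  shows "\<exists>K. K \<subseteq> C \<and> con K \<and> \<not> col K m \<and> (\<forall>x\<in>K. \<not> E p x) \<and> ((\<exists>v\<in>C. E p v) \<longrightarrow> (\<exists>s\<in>C. s \<notin> K \<and> E p s \<and> (\<exists>k\<in>K. E s k)))"
proof -
  have "\<not> col (C - {v \<in> C. E p v}) m" using col_Diff[OF C(2) nbhd_col[of C p]] .
  moreover have "finite (C - {v \<in> C. E p v})" using C(3) finV finite_subset by blast
  ultimately obtain K where K: "K \<subseteq> C - {v \<in> C. E p v}" "con K" "\<not> col K m" "anti K ((C - {v \<in> C. E p v}) - K)"
    using con_component by blast
  have "\<exists>s\<in>C. s \<notin> K \<and> E p s \<and> (\<exists>k\<in>K. E s k)" if v: "v \<in> C" "E p v" for v
  proof -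
    have "K \<noteq> C" using K(1) v by blast
    then obtain x y where xy: "x \<in> K" "y \<in> C - K" "E x y" using con_cut[OF C(1), of K] K(1) con_ne[OF K(2)] by blast
    then have "E p y" using K(4) unfolding anti_def by blast
    then show ?thesis using xy symE by blast
  qed
  moreover have "K \<subseteq> C" "\<forall>x\<in>K. \<not> E p x" using K(1) by blast+
  ultimately show ?thesis using K(2,3) by (intro exI[of _ K] conjI impI) blast+
qed

text \<open>Since the path is a shortest one to the neighbours of \<open>K\<close>, only its last
  vertex sees \<open>K\<close>.\<close>

lemma approach_path:
  assumes C: "con (insert n C)" and K: "K \<subseteq> C" "K \<noteq> {}" "n \<notin> K"
  shows "\<exists>ms. ipath ms \<and> ms \<noteq> [] \<and> hd ms = n \<and> set ms \<subseteq> insert n C \<and> set ms \<inter> K = {} \<and> (\<exists>k\<in>K. E (last ms) k) \<and>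
    (\<forall>v\<in>set (butlast ms). \<forall>k\<in>K. \<not> E v k)"
proof -
  define T where "T = {v. \<exists>k\<in>K. E v k}"
  have s: "E a b \<longleftrightarrow> E b a" for a b using symE by blast
  obtain x y where "x \<in> K" "y \<in> insert n C - K" "E x y" using con_cut[OF C, of K] K by blast
  then have "y \<in> insert n C" "y \<in> T" using s by (auto simp: T_def)
  then obtain ms where ms: "geod (insert n C) n T ms" using geod_exists[OF C, of n y T] by blast
  have mi: "ipath ms" using geod_ipath[OF ms] .
  have mm: "ms \<noteq> []" "hd ms = n" "set ms \<subseteq> insert n C" "last ms \<in> T" using geodD[OF ms] by auto
  have ml: "v \<in> set ms \<Longrightarrow> v \<in> T \<Longrightarrow> v = last ms" for v using geod_only_last[OF ms] by blast
  have dm: "distinct ms" using ipath_distinct[OF mi] .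
  have dK: "set ms \<inter> K = {}"
  proof (rule ccontr)
    assume "set ms \<inter> K \<noteq> {}"
    then obtain v where v: "v \<in> set ms" "v \<in> K" by blast
    then obtain i where i: "i < length ms" "v = ms ! i" by (auto simp: in_set_conv_nth)
    have "i \<noteq> 0" using i v K(3) mm(1,2) by (metis hd_conv_nth)
    then obtain i' where i': "i = Suc i'" by (cases i) auto
    then have "E (ms ! i') v" "ms ! i' \<in> set ms" using i ipath_nth[OF mi, of i' i] by auto
    then have "ms ! i' = last ms" using ml v by (auto simp: T_def)
    then have "ms ! i' = ms ! (length ms - 1)" using mm(1) by (simp add: last_conv_nth)
    then have "i' = length ms - 1" using i i' nth_eq_iff_index_eq[OF dm, of i' "length ms - 1"] by simp
    then show False using i i' by simp
  qed
  have "\<not> E v k" if v: "v \<in> set (butlast ms)" and k: "k \<in> K" for v k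
  proof
    assume "E v k"
    then have "v = last ms" using ml[of v] v k by (auto simp: T_def dest: in_set_butlastD)
    moreover have "ms = butlast ms @ [last ms]" using mm(1) by simp
    then have "last ms \<notin> set (butlast ms)" using dm by (metis distinct_append disjoint_insert(1) list.set_intros(1) disjoint_iff)
    ultimately show False using v by simp
  qed
  moreover have "\<exists>k\<in>K. E (last ms) k" using mm(4) by (simp add: T_def)
  ultimately show ?thesis using mi mm dK by blast
qed

section \<open>Breadth first search levels\<close>

text \<open>The invariant of the rope construction: the part built so far sees the set reserved for
  its continuation through its end only.\<close>

definition trail where
  "trail G K \<longleftrightarrow> ipath G \<and> G \<noteq> [] \<and> last G \<notin> K \<and> (\<forall>v\<in>set (butlast G). v \<notin> K \<and> (\<forall>k\<in>K. \<not> E v k))"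

lemma beadD:
  assumes "bead s K w S A1 A2 u n C"
  shows "S \<noteq> []" "hd S = s" "set (tl S) \<subseteq> K" "set A1 \<subseteq> K" "set A2 \<subseteq> K" "u \<in> K" "n \<in> K" "C \<subseteq> K"
   "ipath (S @ A1 @ [u])" "ipath (S @ A2 @ [u])" "set A1 \<inter> set A2 = {}" "anti (set A1) (set A2)"
   "even (length A1)" "2 \<le> length A1" "odd (length A2)" "5 \<le> length A2"
   "E n u" "n \<notin> set S \<union> set A1 \<union> set A2 \<union> {u}" "anti {n} (set S \<union> set A1 \<union> set A2)"
   "con C" "C \<inter> (set S \<union> set A1 \<union> set A2 \<union> {u}) = {}" "anti C (set S \<union> set A1 \<union> set A2 \<union> {u})" "n \<notin> C"
   "\<exists>c\<in>C. E n c" "\<not> col C (w - 2)"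
  by (insert assms[unfolded bead_def], (elim conjE, (simp; fail | blast))+)

lemma trail_bead:
  assumes G: "trail G K" and b: "bead (last G) K w S A1 A2 u n C" and A: "A = A1 \<or> A = A2"
  shows "ipath ((G @ tl S) @ A @ [u])" "set (G @ tl S) = set G \<union> set S"
proof -
  note bd = beadD[OF b]
  obtain G' s where G': "G = G' @ [s]" using G by (cases G rule: rev_cases) (auto simp: trail_def)
  have S: "S = s # tl S" using bd(1,2) G' by (cases S) auto
  have "ipath (s # (tl S @ A @ [u]))" using bd(9,10) A S by (metis append_Cons)
  moreover have sub: "set (tl S @ A @ [u]) \<subseteq> K" using bd A by auto
  have "ipath (G' @ [s])" using G G' by (simp add: trail_def)
  ultimately have "ipath (G' @ s # (tl S @ A @ [u]))"
  proof (rule_tac ipath_glue)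
    show "set G' \<inter> set (tl S @ A @ [u]) = {}" "anti (set G') (set (tl S @ A @ [u]))"
      using G sub unfolding trail_def G' anti_def by auto
  qed auto
  then show "ipath ((G @ tl S) @ A @ [u])" by (simp add: G')
  show "set (G @ tl S) = set G \<union> set S" using arg_cong[OF S, of set] G' by auto
qed

lemma trail_out:
  assumes G: "trail G K" and b: "bead (last G) K w S A1 A2 u n C" 
  shows "C \<inter> (set G \<union> set S \<union> set A1 \<union> set A2 \<union> {u}) = {}" "anti C (set G \<union> set S \<union> set A1 \<union> set A2 \<union> {u})"
    "n \<notin> set G \<union> set S \<union> set A1 \<union> set A2 \<union> {u}" "anti {n} (set G \<union> set S \<union> set A1 \<union> set A2)"
proof -
  note bd = beadD[OF b]
  obtain G' s where G': "G = G' @ [s]" using G by (cases G rule: rev_cases) (auto simp: trail_def)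
  have S: "s \<in> set S" using bd(1,2) G' by (cases S) auto
  have g: "v \<notin> K" "k \<in> K \<Longrightarrow> \<not> E v k" if "v \<in> set G'" for v k using G that unfolding trail_def G' by auto
  have Gs: "set G \<subseteq> set G' \<union> set S" using S by (auto simp: G')
  show "C \<inter> (set G \<union> set S \<union> set A1 \<union> set A2 \<union> {u}) = {}" using bd(21,8) g Gs by blast
  show "anti C (set G \<union> set S \<union> set A1 \<union> set A2 \<union> {u})" using bd(22,8) g Gs symE unfolding anti_def by blast
  show "n \<notin> set G \<union> set S \<union> set A1 \<union> set A2 \<union> {u}" using bd(18,7) g Gs by blast
  show "anti {n} (set G \<union> set S \<union> set A1 \<union> set A2)" using bd(19,7) g Gs symE unfolding anti_def by blast
qed

text \<open>Either arc may be used with the same exit and the same approach to \<open>K'\<close>.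
  This independence is what turns a bead into a parity switch.\<close>

lemma trail_step:
  assumes G: "trail G K" and b: "bead (last G) K w S A1 A2 u n C" and A: "A = A1 \<or> A = A2"
    and K': "K' \<subseteq> C" and ms: "ipath ms" "ms \<noteq> []" "hd ms = n" "set ms \<subseteq> insert n C" "set ms \<inter> K' = {}"
      "\<forall>v\<in>set (butlast ms). \<forall>k\<in>K'. \<not> E v k"
  shows "trail (G @ tl S @ A @ [u] @ ms) K'"
proof -
  note bd = beadD[OF b]
  note out = trail_out[OF G b]
  have s: "E a b \<longleftrightarrow> E b a" for a b using symE by blast
  define R where "R = (G @ tl S) @ A @ [u]"
  have Ri: "ipath R" unfolding R_def by (rule trail_bead[OF G b A])
  have Rs: "set R \<subseteq> set G \<union> set S \<union> set A1 \<union> set A2 \<union> {u}" using trail_bead(2)[OF G b A] A by (auto simp: R_def)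
  have Rl: "last R = u" "R \<noteq> []" by (auto simp: R_def)
  have "ipath (R @ ms)" unfolding ipath_append
  proof (intro conjI ballI)
    show "set R \<inter> set ms = {}" using Rs ms(4) out(1,3) by blast
    fix x y assume x: "x \<in> set R" and y: "y \<in> set ms"
    have "E x y \<longleftrightarrow> x = u \<and> y = n"
    proof (cases "y = n")
      case True
      show ?thesis
      proof (cases "x = u")
        case True then show ?thesis using \<open>y = n\<close> bd(17) s by blast
      next
        case False
        then have "x \<in> set G \<union> set S \<union> set A1 \<union> set A2" using x Rs by blast
        then show ?thesis using False True out(4) s unfolding anti_def by blast
      qed
    next
      case False
      then have "y \<in> C" using y ms(4) by blast
      then show ?thesis using False out(2) x Rs s unfolding anti_def by blast
    qed
    then show "E x y \<longleftrightarrow> x = last R \<and> y = hd ms" using Rl ms(3) by simp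
  qed (use Ri ms in auto)
  moreover have eq: "G @ tl S @ A @ [u] @ ms = R @ ms" by (simp add: R_def)
  moreover have "last (R @ ms) = last ms" using ms(2) by simp
  then have "last (R @ ms) \<notin> K'" using ms(5) last_in_set[OF ms(2)] by auto
  moreover have "v \<notin> K' \<and> (\<forall>k\<in>K'. \<not> E v k)" if v: "v \<in> set (butlast (R @ ms))" for v
  proof -
    have "v \<in> set R \<or> v \<in> set (butlast ms)" using v ms(2) by (simp add: butlast_append)
    then show ?thesis
    proof
      assume "v \<in> set R"
      then have "v \<in> set G \<union> set S \<union> set A1 \<union> set A2 \<union> {u}" using Rs by blast
      then show ?thesis using out(1,2) K' s unfolding anti_def by blast
    next
      assume v: "v \<in> set (butlast ms)"
      then have "v \<in> set ms" by (rule in_set_butlastD)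
      then show ?thesis using ms(5,6) v by blast
    qed
  qed
  ultimately show ?thesis unfolding trail_def eq using Rl by simp
qed

text \<open>The stem of the theta is the whole trail up to the fork, so parents that touch an
  earlier part of the trail are paid for together with those that touch the new bead.\<close>

lemma trail_clean:
  assumes G: "trail G K" and b: "bead (last G) K w S A1 A2 u n C" and V: "set G \<subseteq> V" "K \<subseteq> V"
    and P: "P \<inter> (set G \<union> K) = {}"
  shows "col {x \<in> C. \<exists>p\<in>P. E p x \<and> (\<exists>z\<in>set G \<union> set S \<union> set A1 \<union> set A2 \<union> {u}. E p z)} 29"
proof -
  note bd = beadD[OF b]
  note out = trail_out[OF G b]
  have R: "set (G @ tl S) = set G \<union> set S" using trail_bead(2)[OF G b, of A1] by simp
  have SK: "set S \<subseteq> set G \<union> K"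
  proof -
    have "last G \<in> set G" using G by (simp add: trail_def)
    moreover have "set S \<subseteq> insert (last G) (set (tl S))" using bd(1,2) by (cases S) auto
    ultimately show ?thesis using bd(3) by blast
  qed
  have "col {x \<in> C. \<exists>p\<in>P. E p x \<and> (\<exists>z\<in>set (G @ tl S) \<union> set A1 \<union> set A2 \<union> {u}. E p z)} 29"
  proof (rule col_below_theta[where n = n])
    show "ipath ((G @ tl S) @ A1 @ [u])" "ipath ((G @ tl S) @ A2 @ [u])" using trail_bead(1)[OF G b] by auto
    show "G @ tl S \<noteq> []" using G by (simp add: trail_def)
    show "A1 \<noteq> []" "A2 \<noteq> []" using bd(14,16) by auto
    show "odd (length A1 + length A2)" using bd(13,15) by simp
    show "set (G @ tl S) \<union> set A1 \<union> set A2 \<union> {u} \<subseteq> V" "C \<subseteq> V" unfolding R using V SK bd(3-8) by blast+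
    show "E n u" "n \<notin> set (G @ tl S) \<union> set A1 \<union> set A2 \<union> {u}" "anti {n} (set (G @ tl S) \<union> set A1 \<union> set A2)"
      unfolding R using bd(17) out by blast+
    show "C \<inter> (set (G @ tl S) \<union> set A1 \<union> set A2 \<union> {u}) = {}" "anti C (set (G @ tl S) \<union> set A1 \<union> set A2 \<union> {u})"
      unfolding R using out by blast+
    show "P \<inter> (set (G @ tl S) \<union> set A1 \<union> set A2 \<union> {u, n} \<union> C) = {}" unfolding R using P SK bd(3-8) by blast
  qed (use bd in auto)
  then show ?thesis unfolding R by simp
qed

text \<open>The thresholds are consumed as follows: \<open>91 = 1 + 4 + 2 + 29 + 4 + 2 + 1 + 4 + 2 + 42\<close> with
  \<open>42 = 29 + 12 + 1\<close>. A neighbourhood costs 1, finding a bead 4, passing its exit 2, and making the parents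
  of the remaining vertices miss what was built so far 29.\<close>
lemma col_next_level:
  assumes U: "con U" "U \<subseteq> V" and X: "X \<subseteq> V" "anti U X" "U \<inter> X = {}" and P: "P \<inter> U = {}" "P \<inter> X = {}"
    and XP: "\<And>x. x \<in> X \<Longrightarrow> \<exists>p\<in>P. E p x" and PU: "\<And>p. p \<in> P \<Longrightarrow> \<exists>u\<in>U. E p u"
  shows "col X 91"
proof (rule ccontr)
  assume nc: "\<not> col X 91"
  have s: "E a b \<longleftrightarrow> E b a" for a b using symE by blast
  have PV: "p \<in> P \<Longrightarrow> p \<in> V" for p using PU inV by blast
  have "finite X" using X finV finite_subset by blast
  then obtain H where H: "H \<subseteq> X" "con H" "\<not> col H 91" using con_component nc by metis
  obtain v0 where v0: "v0 \<in> H" using con_ne[OF H(2)] by blast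
  obtain pa where pa: "pa \<in> P" "E pa v0" using XP v0 H by blast
  have HV: "H \<subseteq> V" using H X by blast
  have n90: "\<not> col H (90 + 1)" using H(3) by simp
  \<comment> \<open>\<open>pa\<close> is the left end of the rope. Removing its neighbours leaves
    \<open>a\<close> as the way from \<open>pa\<close> into \<open>K0\<close>.\<close>
  obtain K0 a where K0: "K0 \<subseteq> H" "con K0" "\<not> col K0 90" "\<And>x. x \<in> K0 \<Longrightarrow> \<not> E pa x" and a: "a \<in> H" "a \<notin> K0" "E pa a" "\<exists>k\<in>K0. E a k"
    using cut_step[OF H(2) n90 HV, of pa] v0 pa by blast
  have paH: "pa \<notin> X" "pa \<notin> H" using pa P H by blast+
  have K0V: "K0 \<subseteq> V" using K0 HV by blast
  have aV: "a \<in> V" "pa \<in> V" using a HV PV pa by auto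
  have n86: "\<not> col K0 (86 + 4)" using K0(3) by simp
  obtain S0 A10 A20 u0 n0 C0 where b0: "bead a K0 86 S0 A10 A20 u0 n0 C0"
    using bead_exists[OF K0V K0(2) aV(1) a(2) a(4) n86] by auto
  note d0 = beadD[OF b0]
  define G0 where "G0 = [pa, a]"
  have t0: "trail G0 K0" using a K0 paH irrE unfolding trail_def G0_def by (auto simp: ipath_Cons)
  have l0: "last G0 = a" by (simp add: G0_def)
  note b0' = b0[folded l0]
  note o0 = trail_out[OF t0 b0']
  \<comment> \<open>Cleaning needs parents off the trail. Vertices of \<open>K0\<close> are not
    adjacent to \<open>pa\<close>, so all their parents remain.\<close>
  define P' where "P' = P - {pa}"
  have P'X: "P' \<inter> X = {}" "pa \<notin> P'" "P' \<subseteq> P" using P by (auto simp: P'_def)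
  have P'p: "p \<in> P'" if "p \<in> P" "E p x" "x \<in> K0" for p x using that K0(4) by (auto simp: P'_def)
  define bad0 where "bad0 = {x \<in> C0. \<exists>p\<in>P'. E p x \<and> (\<exists>z\<in>set G0 \<union> set S0 \<union> set A10 \<union> set A20 \<union> {u0}. E p z)}"
  have G0V: "set G0 \<subseteq> V" using aV by (simp add: G0_def)
  have "col bad0 29" unfolding bad0_def
    by (rule trail_clean[OF t0 b0' G0V K0V]) (use P'X a H(1) K0(1) in \<open>auto simp: G0_def\<close>)
  then have "\<not> col (C0 - bad0) 55" using col_Diff[of C0 55 29 bad0] d0(25) by simp
  moreover have "finite (C0 - bad0)" using d0(8) K0V finV by (meson Diff_subset finite_subset)
  ultimately obtain D0 where D0: "D0 \<subseteq> C0 - bad0" "con D0" "\<not> col D0 55" using con_component by metis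
  have D0s: "D0 \<subseteq> C0" "D0 \<subseteq> K0" "n0 \<notin> D0" using D0(1) d0(8,23) by auto
  have clean0: "\<not> E p z" if "x \<in> D0" "p \<in> P" "E p x" "z \<in> set G0 \<union> set S0 \<union> set A10 \<union> set A20 \<union> {u0}" for x p z
    using that D0(1) P'p[of p x] D0s unfolding bad0_def by blast
  obtain c0 where "c0 \<in> C0" "E n0 c0" using d0(24) by blast
  then have "con (insert n0 C0)" using con_insert[OF d0(20)] by blast
  then obtain ms where ms: "ipath ms" "ms \<noteq> []" "hd ms = n0" "set ms \<subseteq> insert n0 C0" "set ms \<inter> D0 = {}" "\<exists>k\<in>D0. E (last ms) k"
    "\<forall>v\<in>set (butlast ms). \<forall>k\<in>D0. \<not> E v k" using approach_path[of n0 C0 D0] D0s con_ne[OF D0(2)] by blast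
  have t1: "trail (G0 @ tl S0 @ A @ [u0] @ ms) D0" if "A = A10 \<or> A = A20" for A
    by (rule trail_step[OF t0 b0' that D0s(1) ms(1-5) ms(7)])
  define G1 where "G1 = G0 @ tl S0 @ A10 @ [u0] @ ms"
  have l1: "last (G0 @ tl S0 @ A @ [u0] @ ms) = last ms" for A using ms(2) by simp
  have "last ms \<in> insert n0 C0" "last ms \<notin> D0" using last_in_set[OF ms(2)] ms(4,5) by blast+
  then have lm: "last ms \<in> V" "last ms \<notin> D0" using d0(7,8) K0V by blast+
  have D0V: "D0 \<subseteq> V" using D0s K0V by blast
  have n51: "\<not> col D0 (51 + 4)" using D0(3) by simp
  obtain S1 A11 A21 u1 n1 C1 where b1: "bead (last ms) D0 51 S1 A11 A21 u1 n1 C1"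
    using bead_exists[OF D0V D0(2) lm ms(6) n51] by auto
  note d1 = beadD[OF b1]
  \<comment> \<open>Position 2 is even and has two vertices of the arc on either side, as a rope
    demands of the contact of \<open>pt\<close>.\<close>
  define tt where "tt = A21 ! 2"
  have tA: "tt \<in> set A21" using d1(16) by (simp add: tt_def)
  have tD: "tt \<in> D0" using tA d1(5) by blast
  have D0X: "D0 \<subseteq> X" using D0s K0 H by blast
  obtain pt where pt: "pt \<in> P" "E pt tt" using XP tD D0X by blast
  have n48: "\<not> col C1 (48 + 1)" using d1(25) by simp
  have C1V: "C1 \<subseteq> V" using d1(8) D0V by blast
  \<comment> \<open>From here on the rope stays among non-neighbours of \<open>pt\<close>, so the
    third bead has no contact with it.\<close>
  obtain D1 where D1: "D1 \<subseteq> C1" "con D1" "\<not> col D1 48" "\<And>x. x \<in> D1 \<Longrightarrow> \<not> E pt x" using cut_step[OF d1(20) n48 C1V, of pt] by blast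
  have n1D: "n1 \<notin> D1" using D1(1) d1(23) by blast
  obtain c1 where "c1 \<in> C1" "E n1 c1" using d1(24) by blast
  then have "con (insert n1 C1)" using con_insert[OF d1(20)] by blast
  then obtain ms' where ms': "ipath ms'" "ms' \<noteq> []" "hd ms' = n1" "set ms' \<subseteq> insert n1 C1" "set ms' \<inter> D1 = {}" "\<exists>k\<in>D1. E (last ms') k"
    "\<forall>v\<in>set (butlast ms'). \<forall>k\<in>D1. \<not> E v k" using approach_path[of n1 C1 D1] D1(1) n1D con_ne[OF D1(2)] by blast
  have b1': "bead (last (G0 @ tl S0 @ A @ [u0] @ ms)) D0 51 S1 A11 A21 u1 n1 C1" for A using b1 l1 by simp
  have t2: "trail ((G0 @ tl S0 @ A @ [u0] @ ms) @ tl S1 @ A' @ [u1] @ ms') D1" if "A = A10 \<or> A = A20" "A' = A11 \<or> A' = A21" for A A'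
    by (rule trail_step[OF t1[OF that(1)] b1' that(2) D1(1) ms'(1-5) ms'(7)])
  define G2 where "G2 = G1 @ tl S1 @ A11 @ [u1] @ ms'"
  have t2': "trail G2 D1" unfolding G2_def G1_def by (rule t2) auto
  have l2: "last (G @ tl S1 @ A' @ [u1] @ ms') = last ms'" for G A' using ms'(2) by simp
  have "last ms' \<in> insert n1 C1" "last ms' \<notin> D1" using last_in_set[OF ms'(2)] ms'(4,5) by blast+
  then have lm': "last ms' \<in> V" "last ms' \<notin> D1" using d1(7) D0V C1V by blast+
  have D1V: "D1 \<subseteq> V" using D1 C1V by blast
  have n44: "\<not> col D1 (44 + 4)" using D1(3) by simp
  obtain S2 A12 A22 u2 n2 C2 where b2: "bead (last ms') D1 44 S2 A12 A22 u2 n2 C2"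
    using bead_exists[OF D1V D1(2) lm' ms'(6) n44] by auto
  note d2 = beadD[OF b2]
  have b2': "bead (last ((G0 @ tl S0 @ A @ [u0] @ ms) @ tl S1 @ A' @ [u1] @ ms')) D1 44 S2 A12 A22 u2 n2 C2" for A A' using b2 l2 by simp
  have b2'': "bead (last G2) D1 44 S2 A12 A22 u2 n2 C2" using b2 l2 by (simp add: G2_def)
  have K0X: "K0 \<subseteq> X" using K0 H by blast
  have S0s: "set S0 \<subseteq> insert a K0" "set S1 \<subseteq> insert (last ms) D0" "set S2 \<subseteq> insert (last ms') D1"
  proof -
    have h: "set S \<subseteq> insert (hd S) (set (tl S))" for S :: "'a list" by (cases S) auto
    show "set S0 \<subseteq> insert a K0" "set S1 \<subseteq> insert (last ms) D0" "set S2 \<subseteq> insert (last ms') D1"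
      using h[of S0] h[of S1] h[of S2] d0(2,3) d1(2,3) d2(2,3) by auto
  qed
  have tls: "set (tl S) \<subseteq> set S" for S :: "'a list" by (cases S) auto
  have msX: "set ms \<subseteq> K0" "set ms' \<subseteq> D0" using ms(4) ms'(4) d0(7,8) d1(7,8) by auto
  have aX: "a \<in> X" using a H by blast
  have rope_X: "set (tl S0) \<union> set A10 \<union> set A20 \<union> {u0} \<union> set ms \<subseteq> K0" "set (tl S1) \<union> set A11 \<union> set A21 \<union> {u1} \<union> set ms' \<subseteq> D0"
     "set (tl S2) \<union> set A12 \<union> set A22 \<union> {u2, n2} \<union> C2 \<subseteq> D1"
    using d0(3-6) d1(3-6) d2(3-8) msX by auto
  have G2s: "set G2 \<subseteq> insert pa (insert a K0)" using rope_X D0s by (auto simp: G2_def G1_def G0_def)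
  have G2V: "set G2 \<subseteq> V" using G2s aV K0V by blast
  have D1K: "D1 \<subseteq> K0" "D1 \<subseteq> D0" using D1(1) d1(8) D0s by auto
  define bad1 where "bad1 = {x \<in> C2. \<exists>p\<in>P'. E p x \<and> (\<exists>z\<in>set G2 \<union> set S2 \<union> set A12 \<union> set A22 \<union> {u2}. E p z)}"
  have c1: "col bad1 29" unfolding bad1_def
    by (rule trail_clean[OF t2' b2'' G2V D1V]) (use P'X G2s K0X D1K aX in auto)
  define q1 where "q1 = last S1"
  have q1S: "q1 \<in> set S1" using d1(1) by (simp add: q1_def)
  have S1G: "set S1 \<union> set A11 \<union> {u1} \<subseteq> set G2"
  proof -
    have "last ms \<in> set ms" using ms(2) by simp
    moreover have "set S1 \<subseteq> insert (last ms) (set (tl S1))" using d1(1,2) by (cases S1) auto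
    ultimately show ?thesis by (auto simp: G2_def G1_def)
  qed
  have cy1: "icyc q1 (A11 @ u1 # rev A21)" unfolding q1_def
    by (rule theta_cyc[OF d1(9,10) d1(1) _ _ d1(11,12)]) (use d1(13-16) in auto)
  \<comment> \<open>\<open>G2\<close> passes the second bead along \<open>A11\<close>, so parents
    with contacts on the other arc are paid for separately. They miss \<open>q1\<close>, which lies
    on \<open>G2\<close>, so 12 colours suffice.\<close>
  define bad2 where "bad2 = {x \<in> C2. \<exists>p\<in>P'. E p x \<and> (\<forall>z\<in>set G2. \<not> E p z) \<and> (\<exists>z\<in>set A21. E p z)}"
  have cyV: "insert q1 (set (A11 @ u1 # rev A21)) \<subseteq> set S1 \<union> set A11 \<union> set A21 \<union> {u1}" using q1S by auto
  have C2C1: "C2 \<subseteq> C1" using d2(8) D1(1) by blast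
  have allX: "set S1 \<union> set A11 \<union> set A21 \<union> {u1} \<subseteq> K0" using S0s(2) ms(2) msX rope_X(2) D0s last_in_set[OF ms(2)] by blast
  have c2: "col bad2 12"
  proof (rule col_below_cycle_avoiding[OF cy1])
    show "set (A11 @ u1 # rev A21) \<subseteq> V" "q1 \<in> V" using cyV allX K0V by blast+
    show "bad2 \<subseteq> V" using C2C1 C1V by (auto simp: bad2_def)
    show "anti bad2 (insert q1 (set (A11 @ u1 # rev A21)))" using d1(22) cyV C2C1 unfolding anti_def bad2_def by blast
    show "bad2 \<inter> insert q1 (set (A11 @ u1 # rev A21)) = {}" using d1(21) cyV C2C1 unfolding bad2_def by blast
    show "\<exists>p. p \<notin> insert q1 (set (A11 @ u1 # rev A21)) \<and> E p x \<and> \<not> E p q1 \<and> (\<exists>z\<in>set (A11 @ u1 # rev A21). E p z)" if x: "x \<in> bad2" for x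
    proof -
      obtain p where p: "p \<in> P'" "E p x" "\<forall>z\<in>set G2. \<not> E p z" "\<exists>z\<in>set A21. E p z" using x unfolding bad2_def by blast
      have "p \<notin> K0" using p(1) P'X K0X by blast
      then have "p \<notin> insert q1 (set (A11 @ u1 # rev A21))" using cyV allX by blast
      moreover have "\<not> E p q1" using p(3) S1G q1S by blast
      ultimately show ?thesis using p by auto
    qed
  qed
  define bad3 where "bad3 = {x \<in> C2. \<exists>p. E p x \<and> E p pt}"
  have c3: "col bad3 1" unfolding bad3_def by (rule col_two_away)
  have "col (bad1 \<union> bad2 \<union> bad3) (29 + 12 + 1)" by (intro col_Un c1 c2 c3)
  then have "\<not> C2 \<subseteq> bad1 \<union> bad2 \<union> bad3" using d2(25) col_mono[of "bad1 \<union> bad2 \<union> bad3" 42 C2 42] by auto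
  then obtain x where x: "x \<in> C2" "x \<notin> bad1" "x \<notin> bad2" "x \<notin> bad3" by blast
  have xD: "x \<in> D1" "x \<in> D0" "x \<in> K0" using x d2(8) D1K by auto
  \<comment> \<open>The right end of the rope. Because \<open>x\<close> lies in none of the bad
    sets, \<open>px\<close> misses \<open>pt\<close> and both arcs of all three beads; on the rope
    it can see only the stretch after \<open>u2\<close>.\<close>
  obtain px where px: "px \<in> P" "E px x" using XP xD K0X by blast
  have pxP: "px \<in> P'" using P'p px xD by blast
  have px1: "\<not> E px z" if "z \<in> set G2 \<union> set S2 \<union> set A12 \<union> set A22 \<union> {u2}" for z
    using x(1,2) pxP px(2) that unfolding bad1_def by blast
  have px2: "\<not> E px z" if "z \<in> set A21" for z using x(1,3) pxP px(2) that px1 unfolding bad2_def by blast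
  have px3: "\<not> E px pt" using x(1,4) px(2) unfolding bad3_def by blast
  have px0: "\<not> E px z" if "z \<in> set G0 \<union> set S0 \<union> set A10 \<union> set A20 \<union> {u0}" for z using clean0[OF xD(2) px that] .
  have pt0: "\<not> E pt z" if "z \<in> set G0 \<union> set S0 \<union> set A10 \<union> set A20 \<union> {u0}" for z using clean0[OF tD pt that] .
  obtain c2 where "c2 \<in> C2" "E n2 c2" using d2(24) by blast
  then have "con (insert n2 C2)" using con_insert[OF d2(20)] by blast
  then obtain ka where ka: "geod (insert n2 C2) n2 {v. E px v} ka"
    using geod_exists[of "insert n2 C2" n2 x "{v. E px v}"] x px by blast
  have kai: "ipath ka" using geod_ipath[OF ka] .
  have kan: "ka \<noteq> []" "hd ka = n2" "set ka \<subseteq> insert n2 C2" "E px (last ka)" using geodD[OF ka] by auto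
  have kal: "v \<in> set ka \<Longrightarrow> E px v \<Longrightarrow> v = last ka" for v using geod_only_last[OF ka] by blast
  have t3: "ipath (((G0 @ tl S0 @ A @ [u0] @ ms) @ tl S1 @ A' @ [u1] @ ms') @ tl S2 @ A'' @ [u2] @ ka)"
    if "A = A10 \<or> A = A20" "A' = A11 \<or> A' = A21" "A'' = A12 \<or> A'' = A22" for A A' A''
    using trail_step[OF t2[OF that(1,2)] b2' that(3), of "{}" ka] kai kan unfolding trail_def by simp
  have pxX: "px \<notin> X" "pt \<notin> X" using px pt P by auto
  have pane: "px \<noteq> pa" "pt \<noteq> pa" using pxP P'X P'p[OF pt] tD D0s by auto
  have ptpx: "pt \<noteq> px" using D1(4)[OF xD(1)] px by blast
  have kaD: "set ka \<subseteq> D1" using kan(3) rope_X(3) by auto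
  have t4: "ipath ((((G0 @ tl S0 @ A @ [u0] @ ms) @ tl S1 @ A' @ [u1] @ ms') @ tl S2 @ A'' @ [u2] @ ka) @ [px])"
    if A: "A = A10 \<or> A = A20" "A' = A11 \<or> A' = A21" "A'' = A12 \<or> A'' = A22" for A A' A''
  proof -
    let ?R = "((G0 @ tl S0 @ A @ [u0] @ ms) @ tl S1 @ A' @ [u1] @ ms') @ tl S2 @ A'' @ [u2] @ ka"
    have Rl: "last ?R = last ka" using kan(1) by simp
    have "set A \<subseteq> K0" "set A' \<subseteq> K0" "set A'' \<subseteq> K0" using A rope_X D0s D1K by blast+
    moreover have "set (tl S0) \<subseteq> K0" "set ms \<subseteq> K0" "u0 \<in> K0" using rope_X(1) by blast+
    moreover have "set (tl S1) \<subseteq> K0" "set ms' \<subseteq> K0" "u1 \<in> K0" using rope_X(2) D0s(2) by blast+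
    moreover have "set (tl S2) \<subseteq> K0" "u2 \<in> K0" using rope_X(3) D1K(1) by blast+
    moreover have "set ka \<subseteq> K0" using kaD D1K(1) by blast
    ultimately have Rs: "set ?R \<subseteq> insert pa (insert a K0)" by (auto simp: G0_def)
    have R2: "set ?R \<subseteq> (set G0 \<union> set S0 \<union> set A10 \<union> set A20 \<union> {u0}) \<union> (set G2 \<union> set S2 \<union> set A12 \<union> set A22 \<union> {u2}) \<union> set A21 \<union> set ka"
      using A tls[of S0] tls[of S2] by (auto simp: G2_def G1_def)
    have "E y px \<longleftrightarrow> y = last ka" if y: "y \<in> set ?R" for y
    proof
      assume "E y px"
      then have e: "E px y" using s by blast
      then have "y \<in> set ka" using R2 y px0 px1 px2 by blast
      then show "y = last ka" using kal e by blast
    next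
      assume "y = last ka" then show "E y px" using kan(4) s by blast
    qed
    moreover have "px \<notin> set ?R" using Rs pane pxX K0X aX by blast
    ultimately show ?thesis using t3[OF A] Rl unfolding ipath_append[of ?R "[px]"] by (auto simp: ipath_Cons)
  qed
  define f where "f = last ka"
  have kaf: "ka = butlast ka @ [f]" using kan(1) by (simp add: f_def)
  \<comment> \<open>The first and the third bead become the ends of free parity; the second bead
    keeps both of its arcs explicit in the middle.\<close>
  define B where "B e = tl S0 @ (if e then A10 else A20) @ [u0]" for e
  define F where "F d = tl S2 @ (if d then A12 else A22) @ [u2] @ butlast ka" for d
  define Q1 where "Q1 = ms @ tl S1"
  define Q2 where "Q2 = u1 # ms'"
  have Bs: "set (a # B e) \<subseteq> X" "set (a # B e) \<subseteq> set G0 \<union> set S0 \<union> set A10 \<union> set A20 \<union> {u0}" for e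
    using rope_X(1) K0X aX tls[of S0] by (auto simp: B_def G0_def split: if_splits)
  have kab: "set (butlast ka) \<subseteq> set ka" "f \<in> set ka" using kan(1) by (auto simp: f_def dest: in_set_butlastD)
  have Fs: "set (F d @ [f]) \<subseteq> D1" for d using rope_X(3) kaD kab by (auto simp: F_def split: if_splits)
  have D1X: "D1 \<subseteq> X" using D1K K0X by blast
  have Ms: "set Q1 \<union> set A11 \<union> set A21 \<union> set Q2 \<subseteq> X" using rope_X D0X K0X by (auto simp: Q1_def Q2_def)
  show False
  proof (rule no_closed_rope[where U = U and pa = pa and px = px and pt = pt and b = a and B = B and F = F and ?Q1.0 = Q1 and ?Q2.0 = Q2 and ?A1.0 = A11 and ?A2.0 = A21 and f = f and k = 2])
    show "con U" "U \<subseteq> V" by fact+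
    show "pa \<notin> U" "px \<notin> U" "pt \<notin> U" using pa px pt P by auto
    show "\<exists>u\<in>U. E pa u" "\<exists>u\<in>U. E px u" "\<exists>u\<in>U. E pt u" using PU pa px pt by auto
    show "ipath ((pa # a # B e) @ Q1 @ A @ Q2 @ (F d @ [f, px]))" if A: "A = A11 \<or> A = A21" for e d A
    proof -
      have A0: "(if e then A10 else A20) = A10 \<or> (if e then A10 else A20) = A20" "(if d then A12 else A22) = A12 \<or> (if d then A12 else A22) = A22" by auto
      have "(((G0 @ tl S0 @ (if e then A10 else A20) @ [u0] @ ms) @ tl S1 @ A @ [u1] @ ms') @ tl S2 @ (if d then A12 else A22) @ [u2] @ (butlast ka @ [f])) @ [px]
        = (pa # a # B e) @ Q1 @ A @ Q2 @ (F d @ [f, px])" by (simp add: G0_def B_def Q1_def Q2_def F_def)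
      then show ?thesis using t4[OF A0(1) A A0(2)] kaf by simp
    qed
    show "B e \<noteq> []" "F e \<noteq> []" for e by (auto simp: B_def F_def)
    show "Q1 \<noteq> []" "Q2 \<noteq> []" "A11 \<noteq> []" using ms(2) d1(14) by (auto simp: Q1_def Q2_def)
    show "even (length (B True)) \<noteq> even (length (B False))" using d0(13,15) by (simp add: B_def)
    show "even (length (F True)) \<noteq> even (length (F False))" using d2(13,15) by (simp add: F_def)
    show "even (length A11)" "odd (length A21)" "set A11 \<inter> set A21 = {}" "anti (set A11) (set A21)" using d1 by auto
    show "pa \<in> V" "px \<in> V" "pt \<in> V" using PV pa px pt by auto
    show "set (a # B e) \<subseteq> V" for e using Bs(1)[of e] X by blast
    show "set (F d @ [f]) \<subseteq> V" for d using Fs[of d] D1V by blast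
    show "set Q1 \<union> set A11 \<union> set A21 \<union> set Q2 \<subseteq> V" using Ms X by blast
    show "pt \<notin> set (pa # a # B e)" for e using Bs(1)[of e] pane pxX by auto
    show "pt \<notin> set (F d @ [f, px])" for d using Fs[of d] D1X ptpx pxX by auto
    show "pt \<notin> set Q1 \<union> set A11 \<union> set A21 \<union> set Q2" using Ms pxX by blast
    show "\<not> E pt z" if "z \<in> set (pa # a # B e)" for e z
      using pt0[of z] that Bs(2)[of e] by (auto simp: G0_def)
    show "\<not> E pt z" if "z \<in> set (F d @ [f, px])" for d z
    proof -
      have "z \<in> D1 \<or> z = px" using that Fs[of d] by auto
      then show ?thesis using D1(4) px3 s by blast
    qed
    have UX: "U \<inter> Z = {}" "anti U Z" if "Z \<subseteq> X" for Z using that X(2,3) unfolding anti_def by blast+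
    show "U \<inter> set (a # B e) = {}" "anti U (set (a # B e))" for e using UX[OF Bs(1)[of e]] by auto
    have FX: "set (F d @ [f]) \<subseteq> X" for d using Fs[of d] D1X by blast
    show "U \<inter> set (F d @ [f]) = {}" "anti U (set (F d @ [f]))" for d using UX[OF FX[of d]] by auto
    show "U \<inter> (set Q1 \<union> set A11 \<union> set A21 \<union> set Q2) = {}" "anti U (set Q1 \<union> set A11 \<union> set A21 \<union> set Q2)" using UX[OF Ms] by auto
    show "2 + 2 < length A21" using d1(16) by simp
    show "E pt (A21 ! 2)" using pt by (simp add: tt_def)
  qed auto
qed

end

section \<open>Distance levels and their two alternating palettes\<close>

context sgraph begin

lemma distance_exists:
  assumes K: "con K" "r \<in> K"
  shows "\<exists>d :: 'a \<Rightarrow> nat. (\<forall>v\<in>K. d v = 0 \<longleftrightarrow> v = r) \<and> (\<forall>v\<in>K. \<forall>i. d v = Suc i \<longrightarrow> (\<exists>u\<in>K. d u = i \<and> E u v)) \<and>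
    (\<forall>u\<in>K. \<forall>v\<in>K. E u v \<longrightarrow> d v \<le> Suc (d u))"
proof -
  have "\<exists>ys. geod K r {v} ys" if "v \<in> K" for v using geod_exists[OF K that] by blast
  then obtain g where g: "\<And>v. v \<in> K \<Longrightarrow> geod K r {v} (g v)" by metis
  define d where "d v = length (g v) - 1" for v
  have w: "g v \<noteq> []" "hd (g v) = r" "set (g v) \<subseteq> K" "last (g v) = v" "successively E (g v)" if "v \<in> K" for v
    using geodD[OF g[OF that]] by auto
  have len: "length (g v) = Suc (d v)" if "v \<in> K" for v using w(1)[OF that] by (cases "g v") (auto simp: d_def)
  have min: "Suc (d v) \<le> length ys" if "v \<in> K" "wlk K r {v} ys" for v ys
    using g[OF that(1)] that len[OF that(1)] unfolding geod_def by metis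
  have e: "d v \<le> Suc (d u)" if "u \<in> K" "v \<in> K" "E u v" for u v
  proof -
    have "wlk K r {v} (g u @ [v])" using w[OF that(1)] that by (auto simp: wlk_def successively_append_iff)
    then show ?thesis using min[OF that(2)] len[OF that(1)] by fastforce
  qed
  show ?thesis
  proof (intro exI[of _ d] conjI ballI allI impI)
    fix v assume v: "v \<in> K"
    show "d v = 0 \<longleftrightarrow> v = r"
    proof
      assume "d v = 0"
      then have "length (g v) = 1" using len[OF v] by simp
      then obtain z where "g v = [z]" by (auto simp: length_Suc_conv)
      then show "v = r" using w(2,4)[OF v] by simp
    next
      assume "v = r"
      then have "wlk K r {v} [r]" using K by (simp add: wlk_def)
      then show "d v = 0" using min[OF v] by fastforce
    qed
  next
    fix v i assume v: "v \<in> K" and i: "d v = Suc i"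
    obtain zs where zs: "g v = zs @ [v]" using w(1,4)[OF v] by (metis append_butlast_last_id)
    have lz: "length zs = Suc i" using len[OF v] i zs by simp
    then have ne: "zs \<noteq> []" by auto
    define u where "u = last zs"
    have zw: "wlk K r {u} zs" using w[OF v] ne unfolding zs by (auto simp: wlk_def u_def successively_append_iff)
    have uK: "u \<in> K" using zw ne unfolding wlk_def u_def by auto
    have uv: "E u v" using w(5)[OF v] ne unfolding zs by (simp add: successively_append_iff u_def)
    have "d u \<le> i" using min[OF uK zw] lz by simp
    moreover have "d v \<le> Suc (d u)" using e[OF uK v uv] .
    ultimately have "d u = i" using i by simp
    then show "\<exists>u\<in>K. d u = i \<and> E u v" using uK uv by blast
  next
    fix u v assume "u \<in> K" "v \<in> K" "E u v" then show "d v \<le> Suc (d u)" by (rule e)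
  qed
qed

end

context hgraph begin

text \<open>Edges join equal or consecutive levels, so two palettes of 91 colours can alternate.
  Levels 0 and 1 are stable. For level \<open>j + 2\<close> the levels up to \<open>j\<close> form
  the connected set \<open>U\<close>, and level \<open>j + 1\<close> supplies the parents.\<close>

lemma col_large_odd_girth: "col V 182"
proof (rule ccontr)
  assume "\<not> col V 182"
  then obtain K where K: "K \<subseteq> V" "con K" "\<not> col K 182" using con_component[OF finV] by metis
  obtain r where r: "r \<in> K" using con_ne[OF K(2)] by blast
  obtain d :: "'a \<Rightarrow> nat" where d: "\<forall>v\<in>K. d v = 0 \<longleftrightarrow> v = r" "\<forall>v\<in>K. \<forall>i. d v = Suc i \<longrightarrow> (\<exists>u\<in>K. d u = i \<and> E u v)"
    "\<forall>u\<in>K. \<forall>v\<in>K. E u v \<longrightarrow> d v \<le> Suc (d u)"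
    using distance_exists[OF K(2) r] by (elim exE conjE) (rule that)
  have d0: "d v = 0 \<longleftrightarrow> v = r" if "v \<in> K" for v using d(1) that by simp
  have dr: "d r = 0" using d0[OF r] by simp
  have dS: "\<exists>u\<in>K. d u = i \<and> E u v" if "v \<in> K" "d v = Suc i" for v i using d(2) that by simp
  have de: "d v \<le> Suc (d u)" if "u \<in> K" "v \<in> K" "E u v" for u v using d(3) that by simp
  have lev: "col {v \<in> K. d v = i} 91" for i
  proof -
    consider "i = 0" | "i = 1" | j where "i = Suc (Suc j)" by (metis One_nat_def not0_implies_Suc)
    then show ?thesis
    proof cases
      case 1
      have "anti {v \<in> K. d v = i} {v \<in> K. d v = i}" using 1 d0 irrE unfolding anti_def by auto
      then have "col {v \<in> K. d v = i} 1" by (rule col_stable)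
      then show ?thesis by (rule col_mono) auto
    next
      case 2
      have "{v \<in> K. d v = i} \<subseteq> {v \<in> K. E r v}"
      proof
        fix v assume v: "v \<in> {v \<in> K. d v = i}"
        then obtain u where "u \<in> K" "d u = 0" "E u v" using dS[of v 0] 2 by auto
        then show "v \<in> {v \<in> K. E r v}" using d0 v by auto
      qed
      then show ?thesis using col_mono[OF nbhd_col[of K r]] by simp
    next
      case (3 j)
      define U where "U = {v \<in> K. d v \<le> j}"
      define P where "P = {v \<in> K. d v = Suc j}"
      show ?thesis
      proof (rule col_next_level[where U = U and P = P])
        show "con U"
        proof (rule con_rank[of "{r}" _ d])
          fix v assume v: "v \<in> U" "v \<notin> {r}"
          then obtain k where k: "d v = Suc k" using d0[of v] by (cases "d v") (auto simp: U_def)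
          then obtain u where "u \<in> K" "d u = k" "E u v" using dS[of v k] v by (auto simp: U_def)
          then show "\<exists>u\<in>U. E v u \<and> (u \<in> {r} \<or> d u < d v)" using k v symE by (intro bexI[of _ u]) (auto simp: U_def)
        qed (use r dr in \<open>auto simp: U_def\<close>)
        show "U \<subseteq> V" "{v \<in> K. d v = i} \<subseteq> V" using K by (auto simp: U_def)
        show "anti U {v \<in> K. d v = i}" using de 3 unfolding anti_def U_def by fastforce
        show "U \<inter> {v \<in> K. d v = i} = {}" "P \<inter> U = {}" "P \<inter> {v \<in> K. d v = i} = {}" using 3 by (auto simp: U_def P_def)
        show "\<exists>p\<in>P. E p x" if "x \<in> {v \<in> K. d v = i}" for x using dS[of x "Suc j"] that 3 by (auto simp: P_def)
        show "\<exists>u\<in>U. E p u" if "p \<in> P" for p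
        proof -
          obtain u where "u \<in> K" "d u = j" "E u p" using dS[of p j] \<open>p \<in> P\<close> by (auto simp: P_def)
          then show ?thesis using symE by (auto simp: U_def)
        qed
      qed
    qed
  qed
  have "\<forall>i. \<exists>c. (\<forall>v\<in>{v \<in> K. d v = i}. c v < (91::nat)) \<and> (\<forall>u\<in>{v \<in> K. d v = i}. \<forall>v\<in>{v \<in> K. d v = i}. E u v \<longrightarrow> c u \<noteq> c v)"
    using lev[unfolded col_def] by (rule allI)
  from choice[OF this] obtain c where "\<forall>i. (\<forall>v\<in>{v \<in> K. d v = i}. c i v < (91::nat)) \<and> (\<forall>u\<in>{v \<in> K. d v = i}. \<forall>v\<in>{v \<in> K. d v = i}. E u v \<longrightarrow> c i u \<noteq> c i v)"
    by (elim exE) (rule that)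
  then have c: "(\<forall>v\<in>{v \<in> K. d v = i}. c i v < (91::nat)) \<and> (\<forall>u\<in>{v \<in> K. d v = i}. \<forall>v\<in>{v \<in> K. d v = i}. E u v \<longrightarrow> c i u \<noteq> c i v)" for i
    by (rule spec)
  have "col K 182"
  proof (rule colI[of _ "\<lambda>v. c (d v) v + 91 * (d v mod 2)"])
    fix v assume v: "v \<in> K"
    then have "c (d v) v < 91" using c[of "d v"] by blast
    moreover have "d v mod 2 < 2" by simp
    ultimately show "c (d v) v + 91 * (d v mod 2) < 182" by linarith
  next
    fix u v assume uv: "u \<in> K" "v \<in> K" "E u v"
    have b: "c (d u) u < 91" "c (d v) v < 91" using c[of "d u"] c[of "d v"] uv by blast+
    show "c (d u) u + 91 * (d u mod 2) \<noteq> c (d v) v + 91 * (d v mod 2)"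
    proof
      assume eq: "c (d u) u + 91 * (d u mod 2) = c (d v) v + 91 * (d v mod 2)"
      then have m: "d u mod 2 = d v mod 2" using b by linarith
      have "d u \<le> Suc (d v)" "d v \<le> Suc (d u)" using de uv symE by blast+
      then have "d u = d v" using m by presburger
      then show False using eq c[of "d v"] uv by auto
    qed
  qed
  then show False using K by blast
qed

end

context tgraph begin

section \<open>Odd girth and the translation from t-perfect graphs\<close>

text \<open>With the uniform weight \<open>m / (2 m + 1)\<close> the odd cycle constraint is tight for the cycles of length \<open>2 m + 1\<close>.\<close>
lemma girth_step:
  assumes m: "1 \<le> m" and g: "\<And>n c. odd n \<Longrightarrow> clw n c \<Longrightarrow> 2 * m + 1 \<le> n"
  shows "\<exists>S\<subseteq>V. anti S S \<and> (\<forall>c. clw (2 * m + 1) c \<longrightarrow> (\<exists>j<2 * m + 1. c j \<in> S))"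
proof -
  define x :: "'a \<Rightarrow> real" where "x v = real m / real (2 * m + 1)" for v
  have xm: "x v * real (2 * m + 1) = real m" for v by (simp add: x_def)
  have "\<exists>N S w. (\<forall>i<N. S i \<subseteq> V \<and> (\<forall>u\<in>S i. \<forall>v\<in>S i. \<not> E u v) \<and> (0::real) < w i) \<and> (\<Sum>i<(N::nat). w i) = 1 \<and>
       (\<forall>v\<in>V. x v = (\<Sum>i<N. if v \<in> S i then w i else 0))"
  proof (rule tp)
    show "0 \<le> x v" for v by (simp add: x_def)
    show "x v \<le> 1" for v by (simp add: x_def)
    show "x u + x v \<le> 1" for u v by (simp add: x_def add_divide_distrib[symmetric])
    fix n c assume n: "odd n" "3 \<le> n" "clw n c" "inj_on c {..<n}"
    have "2 * m + 1 \<le> n" using g n by blast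
    then have le: "real (2 * m + 1) \<le> real n" by linarith
    have "(\<Sum>i<n. x (c i)) = real n * (real m / real (2 * m + 1))" by (simp add: x_def)
    also have "\<dots> \<le> (real n - 1) / 2"
    proof -
      have "2 * (real n * real m) \<le> (real n - 1) * real (2 * m + 1)" using le by (simp add: algebra_simps)
      then show ?thesis by (simp add: field_simps)
    qed
    finally show "(\<Sum>i<n. x (c i)) \<le> (real n - 1) / 2" .
  qed
  then obtain N S w where NS: "\<forall>i<N. S i \<subseteq> V \<and> (\<forall>u\<in>S i. \<forall>v\<in>S i. \<not> E u v) \<and> (0::real) < w i"
    and w2: "(\<Sum>i<(N::nat). w i) = 1" and xs: "\<forall>v\<in>V. x v = (\<Sum>i<N. if v \<in> S i then w i else 0)"
    by (elim exE conjE) (rule that)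
  have S: "S i \<subseteq> V" "anti (S i) (S i)" "0 < w i" if "i < N" for i using NS that unfolding anti_def by blast+
  have N0: "0 < N" using w2 by (cases N) auto
  have "\<exists>j<2 * m + 1. c j \<in> S 0" if c: "clw (2 * m + 1) c" for c
  proof -
    let ?n = "2 * m + 1"
    have cE: "j < ?n \<Longrightarrow> E (c j) (c (Suc j))" for j using c by (simp add: clw_def)
    \<comment> \<open>Positions are counted, so the walk may repeat vertices. Stability bounds each
      count by \<open>m\<close>, the weighted average equals \<open>m\<close>, and hence every count
      is \<open>m\<close>, in particular positive.\<close>
    define k where "k i = card {j. j < ?n \<and> c j \<in> S i}" for i
    have ks: "real (k i) = (\<Sum>j<?n. if c j \<in> S i then 1 else 0)" for i
    proof -
      have "(\<Sum>j<?n. if c j \<in> S i then 1 else (0::real)) = (\<Sum>j\<in>{j \<in> {..<?n}. c j \<in> S i}. 1)" by (rule sum.inter_filter[symmetric]) simp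
      then show ?thesis by (simp add: k_def lessThan_def Collect_conj_eq)
    qed
    have km: "k i \<le> m" if i: "i < N" for i
    proof -
      have "2 * real (k i) = (\<Sum>j<?n. (if c j \<in> S i then 1 else 0) + (if c (Suc j) \<in> S i then 1 else (0::real)))"
        unfolding ks by (rule clw_sum[OF c, of "\<lambda>v. if v \<in> S i then 1 else 0"])
      also have "\<dots> \<le> (\<Sum>j<?n. 1)"
        by (rule sum_mono) (use S(2)[OF i] cE in \<open>auto simp: anti_def\<close>)
      finally have "2 * k i \<le> ?n" by simp
      then show ?thesis by simp
    qed
    have "(\<Sum>j<?n. x (c j)) = (\<Sum>j<?n. \<Sum>i<N. if c j \<in> S i then w i else 0)"
      by (rule sum.cong) (use xs inV cE in auto)
    also have "\<dots> = (\<Sum>i<N. \<Sum>j<?n. if c j \<in> S i then w i else 0)" by (rule sum.swap)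
    also have "\<dots> = (\<Sum>i<N. real (k i) * w i)"
    proof (rule sum.cong)
      fix i assume "i \<in> {..<N}"
      have "(\<Sum>j<?n. if c j \<in> S i then w i else 0) = (\<Sum>j<?n. (if c j \<in> S i then 1 else 0) * w i)" by (rule sum.cong) auto
      also have "\<dots> = real (k i) * w i" unfolding ks by (rule sum_distrib_right[symmetric])
      finally show "(\<Sum>j<?n. if c j \<in> S i then w i else 0) = real (k i) * w i" .
    qed simp
    finally have "(\<Sum>i<N. real (k i) * w i) = real ?n * (real m / real ?n)" by (simp add: x_def)
    then have tot: "(\<Sum>i<N. real (k i) * w i) = real m" by simp
    have "real (k 0) / real m = 1"
    proof (rule convex_tight[of N w 0 "\<lambda>i. real (k i) / real m"])
      show "real (k i) / real m \<le> 1" if "i < N" for i using km[OF that] m by simp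
      have "(\<Sum>i<N. real (k i) / real m * w i) = (\<Sum>i<N. real (k i) * w i) / real m"
        by (simp add: sum_divide_distrib)
      then show "(\<Sum>i<N. real (k i) / real m * w i) = 1" using tot m by simp
    qed (use S w2 N0 in auto)
    then have "k 0 \<noteq> 0" by auto
    then have "{j. j < ?n \<and> c j \<in> S 0} \<noteq> {}" unfolding k_def by (metis card.empty)
    then show ?thesis by blast
  qed
  then show ?thesis using S[OF N0] by blast
qed

text \<open>Allows \<open>girth_step\<close> to be repeated on what is left after a stable set has
  been removed.\<close>

lemma tgraph_sub: assumes Y: "Y \<subseteq> V" shows "tgraph Y (\<lambda>u v. E u v \<and> u \<in> Y \<and> v \<in> Y)"
proof -
  interpret S: sgraph Y "\<lambda>u v. E u v \<and> u \<in> Y \<and> v \<in> Y"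
    by unfold_locales (use Y finV finite_subset symE irrE in auto)
  show ?thesis
  proof unfold_locales
    fix x :: "'a \<Rightarrow> real"
    assume x: "\<And>v. v \<in> Y \<Longrightarrow> 0 \<le> x v" "\<And>v. v \<in> Y \<Longrightarrow> x v \<le> 1" "\<And>u v. E u v \<and> u \<in> Y \<and> v \<in> Y \<Longrightarrow> x u + x v \<le> 1"
      "\<And>n c. odd n \<Longrightarrow> 3 \<le> n \<Longrightarrow> S.clw n c \<Longrightarrow> inj_on c {..<n} \<Longrightarrow> (\<Sum>i<n. x (c i)) \<le> (real n - 1) / 2"
    have "\<exists>N S w. (\<forall>i<N. S i \<subseteq> Y \<and> (\<forall>u\<in>S i. \<forall>v\<in>S i. \<not> E u v) \<and> (0::real) < w i) \<and> (\<Sum>i<(N::nat). w i) = 1 \<and>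
       (\<forall>v\<in>Y. x v = (\<Sum>i<N. if v \<in> S i then w i else 0))"
    proof (rule tp_sub[OF Y])
      fix n c assume n: "odd n" "3 \<le> n" "clw n c" "inj_on c {..<n}" "\<And>i. c i \<in> Y"
      then have "S.clw n c" unfolding clw_def S.clw_def by blast
      then show "(\<Sum>i<n. x (c i)) \<le> (real n - 1) / 2" using x(4) n by blast
    qed (use x in auto)
    then obtain N S w where "\<forall>i<N. S i \<subseteq> Y \<and> (\<forall>u\<in>S i. \<forall>v\<in>S i. \<not> E u v) \<and> (0::real) < w i"
      "(\<Sum>i<(N::nat). w i) = 1" "\<forall>v\<in>Y. x v = (\<Sum>i<N. if v \<in> S i then w i else 0)" by (elim exE conjE) (rule that)
    then show "\<exists>N S w. (\<forall>i<N. S i \<subseteq> Y \<and> (\<forall>u\<in>S i. \<forall>v\<in>S i. \<not> (E u v \<and> u \<in> Y \<and> v \<in> Y)) \<and> (0::real) < w i) \<and> (\<Sum>i<(N::nat). w i) = 1 \<and>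
       (\<forall>v\<in>Y. x v = (\<Sum>i<N. if v \<in> S i then w i else 0))"
      by (intro exI[of _ N] exI[of _ S] exI[of _ w]) blast
  qed
qed

end

text \<open>Each step spends one colour on a stable set that meets all closed walks of length
  \<open>2 * m + 1\<close>; by parity the bound rises by 2. At \<open>m = 5\<close> it is the bound
  11 of \<open>hgraph\<close>.\<close>

lemma girth_col:
  assumes "tgraph V E" "1 \<le> m" "m + j = 5" "\<And>n c. odd n \<Longrightarrow> sgraph.clw E n c \<Longrightarrow> 2 * m + 1 \<le> n"
  shows "sgraph.col E V (182 + j)"
  using assms
proof (induction j arbitrary: V E m)
  case 0
  interpret tgraph V E by fact
  interpret hgraph V E
  proof unfold_locales
    show "11 \<le> n" if "odd n" "clw n c" for n c using 0(4)[OF that] 0(3) by simp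
  qed
  show ?case using col_large_odd_girth by simp
next
  case (Suc j)
  interpret tgraph V E by fact
  have "\<exists>S\<subseteq>V. anti S S \<and> (\<forall>c. clw (2 * m + 1) c \<longrightarrow> (\<exists>j<2 * m + 1. c j \<in> S))"
    by (rule girth_step[OF Suc.prems(2)]) (rule Suc.prems(4))
  then obtain S where S: "S \<subseteq> V" "anti S S" "\<forall>c. clw (2 * m + 1) c \<longrightarrow> (\<exists>j<2 * m + 1. c j \<in> S)" by blast
  define Y where "Y = V - S"
  define E' where "E' = (\<lambda>u v. E u v \<and> u \<in> Y \<and> v \<in> Y)"
  have t: "tgraph Y E'" unfolding E'_def by (rule tgraph_sub) (auto simp: Y_def)
  interpret T: tgraph Y E' by (rule t)
  have "T.col Y (182 + j)"
  proof (rule Suc.IH[OF t, of "Suc m"])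
    show "1 \<le> Suc m" "Suc m + j = 5" using Suc.prems by auto
    fix n c assume n: "odd n" "T.clw n c"
    then have n2: "\<forall>i<n. E' (c i) (c (Suc i))" "c n = c 0" unfolding T.clw_def by blast+
    then have c: "clw n c" unfolding clw_def E'_def by blast
    have "2 * m + 1 \<le> n" using Suc.prems(4)[OF n(1) c] .
    moreover have "n \<noteq> 2 * m + 1"
    proof
      assume nm: "n = 2 * m + 1"
      then obtain i where "i < n" "c i \<in> S" using S(3) c by blast
      moreover have "c i \<in> Y" using n2(1) \<open>i < n\<close> unfolding E'_def by blast
      ultimately show False by (simp add: Y_def)
    qed
    ultimately show "2 * Suc m + 1 \<le> n" using n(1) by presburger
  qed
  then obtain c where c: "\<forall>v\<in>Y. c v < 182 + j" "\<forall>u\<in>Y. \<forall>v\<in>Y. E' u v \<longrightarrow> c u \<noteq> (c v :: nat)" unfolding T.col_def by blast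
  have "col Y (182 + j)" by (rule colI[of _ c]) (use c in \<open>auto simp: E'_def\<close>)
  then have "col (Y \<union> S) (182 + j + 1)" using col_Un col_stable[OF S(2)] by blast
  then show ?case by (rule_tac col_mono) (auto simp: Y_def)
qed

section \<open>From the convex hull and arc lists to weighted stable sets and closed walks\<close>

lemma sum_fun_apply: "(\<Sum>y\<in>A. f y) v = (\<Sum>y\<in>A. f y v)" for f :: "'b \<Rightarrow> 'a \<Rightarrow> real"
  by (induction A rule: infinite_finite_induct) auto

lemma stable_set_polytope_decompose:
  assumes "x \<in> stable_set_polytope G"
  shows "\<exists>N S w. (\<forall>i<N. stable_set G (S i) \<and> (0::real) < w i) \<and> (\<Sum>i<(N::nat). w i) = 1 \<and>
       (\<forall>v. x v = (\<Sum>i<N. if v \<in> S i then w i else 0))"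
proof -
  obtain A u where A: "finite A" "A \<subseteq> {indicator S | S. stable_set G S}" "\<forall>a\<in>A. 0 \<le> u a" "sum u A = 1" "(\<Sum>a\<in>A. u a *\<^sub>R a) = x"
    using assms unfolding stable_set_polytope_def convex_hull_explicit by blast
  \<comment> \<open>A convex hull only provides nonnegative coefficients; zero ones are dropped
    because the locale demands positive weights.\<close>
  define A' where "A' = {a \<in> A. u a \<noteq> 0}"
  have fA: "finite A'" using A(1) by (simp add: A'_def)
  obtain h where h: "bij_betw h {..<card A'} A'" using ex_bij_betw_nat_finite[OF fA] by (auto simp: atLeast0LessThan)
  have "\<forall>a\<in>A. \<exists>S. stable_set G S \<and> a = indicator S" using A(2) by blast
  then obtain T where T: "\<And>a. a \<in> A \<Longrightarrow> stable_set G (T a) \<and> a = indicator (T a)" by metis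
  have hA: "h i \<in> A'" if "i < card A'" for i using h that unfolding bij_betw_def by blast
  have 1: "stable_set G (T (h i))" "0 < u (h i)" if "i < card A'" for i
    using hA[OF that] T[of "h i"] A(3) unfolding A'_def by (auto simp: less_le)
  have "(\<Sum>i<card A'. u (h i)) = sum u A'" by (rule sum.reindex_bij_betw[OF h])
  also have "\<dots> = sum u A" by (rule sum.mono_neutral_left) (use A(1) in \<open>auto simp: A'_def\<close>)
  finally have 2: "(\<Sum>i<card A'. u (h i)) = 1" using A(4) by simp
  have 3: "x v = (\<Sum>i<card A'. if v \<in> T (h i) then u (h i) else 0)" for v
  proof -
    have "x v = (\<Sum>a\<in>A. (u a *\<^sub>R a) v)" using A(5) sum_fun_apply[of "\<lambda>a. u a *\<^sub>R a" A v] by simp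
    also have "\<dots> = (\<Sum>a\<in>A'. (u a *\<^sub>R a) v)"
      by (rule sum.mono_neutral_right) (use A(1) in \<open>auto simp: A'_def scaleR_fun_def\<close>)
    also have "\<dots> = (\<Sum>a\<in>A'. if v \<in> T a then u a else 0)"
    proof (rule sum.cong)
      fix a assume "a \<in> A'"
      then have "a = indicator (T a)" using T[of a] by (simp add: A'_def)
      then have "a v = indicator (T a) v" by metis
      then show "(u a *\<^sub>R a) v = (if v \<in> T a then u a else 0)" by (simp add: scaleR_fun_def indicator_def)
    qed simp
    also have "\<dots> = (\<Sum>i<card A'. if v \<in> T (h i) then u (h i) else 0)" by (rule sum.reindex_bij_betw[OF h, symmetric])
    finally show ?thesis .
  qed
  show ?thesis using 1 2 3 by (intro exI[of _ "card A'"] exI[of _ "\<lambda>i. T (h i)"] exI[of _ "\<lambda>i. u (h i)"]) auto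
qed

lemma pcas_nth: "pcas u p v \<Longrightarrow> Suc i < length p \<Longrightarrow> snd (p ! i) = fst (p ! Suc i)"
proof (induction p arbitrary: u i)
  case (Cons e p)
  then show ?case by (cases i; cases p) auto
qed simp

lemma pcas_ends: "pcas u p v \<Longrightarrow> p \<noteq> [] \<Longrightarrow> fst (hd p) = u \<and> snd (last p) = v"
proof (induction p arbitrary: u)
  case (Cons e p)
  then show ?case by (cases p) auto
qed simp

text \<open>The point is extended by 0 outside the vertex set, and each odd cycle given by arcs is
  turned into an injective closed walk of the same length, so the constraints of the two settings
  correspond.\<close>

lemma t_perfect_tgraph:
  assumes G: "pair_graph G" and t: "t_perfect G"
  shows "tgraph (pverts G) (\<lambda>u v. (u, v) \<in> parcs G)"
proof -
  interpret G: pair_graph G by fact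
  interpret S: sgraph "pverts G" "\<lambda>u v. (u, v) \<in> parcs G"
  proof unfold_locales
    show "finite (pverts G)" by (rule G.pair_finite_verts)
    show "(v, u) \<in> parcs G" if "(u, v) \<in> parcs G" for u v using that by (rule G.arcs_symmetric)
    show "(v, v) \<notin> parcs G" for v using G.pair_no_loops[of "(v, v)"] by auto
    show "u \<in> pverts G" if "(u, v) \<in> parcs G" for u v using that by (rule G.in_arcsD1)
  qed
  show ?thesis
  proof unfold_locales
    fix x :: "'a \<Rightarrow> real"
    assume x: "\<And>v. v \<in> pverts G \<Longrightarrow> 0 \<le> x v" "\<And>v. v \<in> pverts G \<Longrightarrow> x v \<le> 1" "\<And>u v. (u, v) \<in> parcs G \<Longrightarrow> x u + x v \<le> 1"
      "\<And>n c. odd n \<Longrightarrow> 3 \<le> n \<Longrightarrow> S.clw n c \<Longrightarrow> inj_on c {..<n} \<Longrightarrow> (\<Sum>i<n. x (c i)) \<le> (real n - 1) / 2"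
    define y where "y v = (if v \<in> pverts G then x v else 0)" for v
    have "y \<in> odd_cycle_polytope G"
      unfolding odd_cycle_polytope_def
    proof (intro CollectI conjI allI ballI impI)
      show "y u + y v \<le> 1" if "(u, v) \<in> parcs G" for u v using x(3)[OF that] S.inV[OF that] S.inV'[OF that] by (simp add: y_def)
      fix C assume C: "graph_cycle G C \<and> odd (card (cycle_verts C))"
      define n where "n = length C"
      obtain u where u: "pcas u C u" "set C \<subseteq> parcs G" "distinct (tl (pawalk_verts u C))" "3 \<le> n" "C \<noteq> []"
        using C unfolding graph_cycle_def pre_digraph.cycle_def pre_digraph.awalk_def n_def
        by (auto simp: cas_with_proj_eq awalk_verts_with_proj_eq)
      \<comment> \<open>Tails of the arcs, read modulo \<open>n\<close> so that
        \<open>c n = c 0\<close>.\<close>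
      define c where "c i = fst (C ! (i mod n))" for i
      have n0: "0 < n" using u(4) by simp
      have step: "snd (C ! i) = c (Suc i)" if "i < n" for i
      proof (cases "Suc i = n")
        case True
        then have "i = n - 1" by simp
        then have "snd (C ! i) = snd (last C)" using u(5) by (simp add: last_conv_nth n_def)
        then show ?thesis using True pcas_ends[OF u(1,5)] u(5) by (simp add: c_def hd_conv_nth)
      next
        case False
        then have "Suc i < n" using that by simp
        then show ?thesis using pcas_nth[OF u(1), of i] by (simp add: c_def n_def)
      qed
      have cl: "S.clw n c" unfolding S.clw_def
      proof (intro conjI allI impI)
        fix i assume i: "i < n"
        have "C ! i \<in> parcs G" using u(2) i by (auto simp: n_def)
        moreover have "C ! i = (c i, c (Suc i))" using step[OF i] i by (simp add: c_def prod_eq_iff)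
        ultimately show "(c i, c (Suc i)) \<in> parcs G" by simp
      qed (simp add: c_def)
      have vs: "tl (pawalk_verts u C) = map snd C" for u
      proof -
        have "pawalk_verts w p = w # map snd p" if "pcas w p z" for w p z
          using that by (induction p arbitrary: w) auto
        then have "tl (pawalk_verts u C) = map snd C" if "pcas u C u" for u using that by fastforce
        moreover have "tl (pawalk_verts u C) = tl (pawalk_verts v C)" for u v using u(5) by (cases C) auto
        ultimately show ?thesis using u(1) by metis
      qed
      have ds: "distinct (map snd C)" using u(3) vs by simp
      have inj: "inj_on c {..<n}"
      proof (rule inj_onI)
        fix i k assume ik: "i \<in> {..<n}" "k \<in> {..<n}" and eq: "c i = c k"
        \<comment> \<open>The cycle condition makes the heads of the arcs distinct, while
          \<open>c\<close> lists the tails. The tail of arc \<open>i\<close> is the head of its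
          cyclic predecessor \<open>p i\<close>.\<close>
        define p where "p i = (if i = 0 then n - 1 else i - 1)" for i
        have pp: "p i < n" "c (Suc (p i)) = c i" if "i < n" for i using that n0 by (auto simp: p_def c_def)
        have "snd (C ! p i) = snd (C ! p k)" using step pp ik eq by simp
        then have "p i = p k" using ds pp(1)[of i] pp(1)[of k] ik nth_eq_iff_index_eq[OF ds, of "p i" "p k"] by (simp add: n_def)
        then show "i = k" using ik by (auto simp: p_def split: if_splits)
      qed
      have cv: "cycle_verts C = c ` {..<n}"
      proof -
        have "set C = (\<lambda>i. C ! i) ` {..<n}" by (auto simp: set_conv_nth n_def)
        then show ?thesis unfolding cycle_verts_def by (auto simp: c_def image_iff)
      qed
      then have cn: "card (cycle_verts C) = n" using card_image[OF inj] by simp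
      have "(\<Sum>v\<in>cycle_verts C. y v) = (\<Sum>i<n. y (c i))" unfolding cv by (rule sum.reindex[OF inj, unfolded o_def])
      also have "\<dots> = (\<Sum>i<n. x (c i))"
        by (rule sum.cong) (use cl S.inV in \<open>auto simp: y_def S.clw_def\<close>)
      also have "\<dots> \<le> (real n - 1) / 2" by (rule x(4)) (use C cn u(4) cl inj in auto)
      finally show "(\<Sum>v\<in>cycle_verts C. y v) \<le> 1 / 2 * (real (card (cycle_verts C)) - 1)" unfolding cn by simp
    qed (use x in \<open>auto simp: y_def\<close>)
    then have "y \<in> stable_set_polytope G" using t unfolding t_perfect_def by simp
    obtain N S w where NS: "\<forall>i<N. stable_set G (S i) \<and> (0::real) < w i" "(\<Sum>i<(N::nat). w i) = 1"
       "\<forall>v. y v = (\<Sum>i<N. if v \<in> S i then w i else 0)" using stable_set_polytope_decompose[OF \<open>y \<in> stable_set_polytope G\<close>] by (elim exE conjE) (rule that)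
    have "x v = (\<Sum>i<N. if v \<in> S i then w i else 0)" if "v \<in> pverts G" for v using NS(3) that by (metis y_def)
    then show "\<exists>N S w. (\<forall>i<N. S i \<subseteq> pverts G \<and> (\<forall>u\<in>S i. \<forall>v\<in>S i. (u, v) \<notin> parcs G) \<and> (0::real) < w i) \<and> (\<Sum>i<(N::nat). w i) = 1 \<and>
       (\<forall>v\<in>pverts G. x v = (\<Sum>i<N. if v \<in> S i then w i else 0))"
      using NS(1,2) unfolding stable_set_def by (intro exI[of _ N] exI[of _ S] exI[of _ w]) blast
  qed
qed

theorem theorem1p1:
  fixes G :: "'a pair_pre_digraph"
  assumes "pair_graph G" and "t_perfect G"
  shows "chromatic_number G \<le> 186"
proof -
  interpret tgraph "pverts G" "\<lambda>u v. (u, v) \<in> parcs G" by (rule t_perfect_tgraph[OF assms])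
  have "col (pverts G) (182 + 4)"
  proof (rule girth_col[where m = 1])
    show "tgraph (pverts G) (\<lambda>u v. (u, v) \<in> parcs G)" by unfold_locales
    fix n c assume n: "odd n" "clw n c"
    have "n \<noteq> 1"
    proof
      assume "n = 1"
      then have "(c 0, c 1) \<in> parcs G" "c 1 = c 0" using n(2) by (auto simp: clw_def)
      then show False using irrE by metis
    qed
    then show "2 * 1 + 1 \<le> n" using n(1) by presburger
  qed auto
  then obtain c where "\<forall>v\<in>pverts G. c v < (186::nat)" "\<forall>u\<in>pverts G. \<forall>v\<in>pverts G. (u, v) \<in> parcs G \<longrightarrow> c u \<noteq> c v"
    unfolding col_def by auto
  then have "colorable G 186" unfolding colorable_def using inV inV' by (intro exI[of _ c]) auto
  then show ?thesis unfolding chromatic_number_def by (rule Least_le)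
qed

end
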